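(* Let $(\phi,\eta,\xi,G)$ be a $K$-paracontact Finsler structure on a vector bundle $E$, and let $D$ be a Finsler connection on $E$ with curvature $R$. Then: (i) the vertical flag curvatures of all plane sections (in $VE$) containing $\xi^V$ are equal to $-\frac14$; (ii) the horizontal flag curvatures of all plane sections (in $HE$) containing $\xi^H$ are equal to $-\frac14$ if and only if $G(D^V_{[X^H,\xi^H]}\xi^H,X^H)=0$ for every horizontal vector field $X^H$.
   Context: Setting. $(E,\pi,M)$ is a smooth vector bundle with $\dim M=n$ and fibre dimension $m$; $E$ also denotes the $(n+m)$-dimensional total space. $VE$ is the vertical bundle, and a nonlinear connection is fixed, i.e. a smooth distribution $HE$ on $E$ with $TE=HE\oplus VE$. For a vector field $X$ on $E$, $X^H$ and $X^V$ denote its horizontal and vertical components, so $X=X^H+X^V$. For a 1-form $\omega$ on $E$, $\omega^H(X)=\omega(X^H)$ and $\omega^V(X)=\omega(X^V)$. Almost paracontact Finsler structure. It is a triple $(\phi,\eta,\xi)$ where $\phi$ is a $(1,1)$-tensor field on $E$ with $\phi(HE)\subseteq HE$ and $\phi(VE)\subseteq VE$, $\eta$ is a 1-form on $E$ and $\xi$ is a vector field on $E$, such that $$\phi^2=I-\eta^H\otimes\xi^H-\eta^V\otimes\xi^V,\qquad \eta^H(\xi^H)=\eta^V(\xi^V)=1 .$$ Metric structures. A pseudo-metric structure on $E$ is a symmetric non-degenerate $(0,2)$-tensor $G=G^H+G^V$ with $G^H(X,Y)=G(X^H,Y^H)$ non-degenerate on $HE$ and $G^V(X,Y)=G(X^V,Y^V)$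 non-degenerate on $VE$. $(\phi,\eta,\xi,G)$ is an almost paracontact metric Finsler structure if $(\phi,\eta,\xi)$ is an almost paracontact Finsler structure and $$G^H(\phi X,\phi Y)=-G^H(X,Y)+\eta^H(X)\eta^H(Y),\quad G^V(\phi X,\phi Y)=-G^V(X,Y)+\eta^V(X)\eta^V(Y).$$ Its fundamental 2-form is $\Phi(X,Y)=G(X,\phi Y)$. It is a paracontact metric Finsler structure if $d\eta^H(X,Y)=\Phi(X^H,Y^H)$ and $d\eta^V(X,Y)=\Phi(X^V,Y^V)$ for all vector fields $X,Y$ on $E$, where $d\omega(X,Y)=X(\omega(Y))-Y(\omega(X))-\omega([X,Y])$ for a 1-form $\omega$. A paracontact metric Finsler structure is a $K$-paracontact Finsler structure if $\xi^H$ and $\xi^V$ are Killing with respect to $G^H$ and $G^V$ respectively, i.e. $\pounds_{\xi^H}G^H=0$ and $\pounds_{\xi^V}G^V=0$ as tensors on $E$. Finsler connection. A linear connection $D$ on $E$ is a d-connection if it preserves $HE$ and $VE$ by parallelism ($Dh=0=Dv$ for the projectors $h,v$ onto $HE,VE$). It is metrical if $D_XG=0$ for all $X$. It is symmetric if $D_{X^H}Y^H-D_{Y^H}X^H-[X^H,Y^H]^H=0$ and $D_{X^V}Y^V-D_{Y^V}X^V-[X^V,Y^V]^V=0$ for all $X,Y$. A Finsler connection is a symmetric metrical d-connection. Notation: $D^V_XY=D_{X^V}Y$; in particular $D^V_{[X^H,\xi^H]}\xi^H=D_{[X^H,\xi^H]^V}\xi^H$. Curvature: $R(X,Y)Z=D_XD_YZ-D_YD_XZ-D_{[X,Y]}Z$.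 Flag curvature. For a $G$-non-degenerate plane section in $V_uE$ (vertical case) or in $H_uE$ (horizontal case) spanned by two $G$-orthogonal non-null vectors $A,B$, the vertical (resp. horizontal) flag curvature is $$K(A,B)=\frac{G(R(A,B)B,A)}{G(A,A)\,G(B,B)} .$$ *)

theory Defs
  imports "HOL-Analysis.Analysis" "HOL-Library.Function_Algebras"
begin

(* Theory Function_Algebras supplies pointwise 0, +, -, * on functions; these are the
   operations used below on real functions, tangent vectors and vector fields. *)

section \<open>Smooth manifolds\<close>

text \<open>
  C^k and C^infinity for maps between normed spaces; only used on open sets S.
\<close>

primrec Ck_on :: "nat \<Rightarrow> 'a::real_normed_vector set \<Rightarrow> ('a \<Rightarrow> 'b::real_normed_vector) \<Rightarrow> bool" where
  "Ck_on 0 S f \<longleftrightarrow> continuous_on S f"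
| "Ck_on (Suc k) S f \<longleftrightarrow>
     (\<forall>x\<in>S. f differentiable (at x)) \<and> (\<forall>v. Ck_on k S (\<lambda>x. frechet_derivative f (at x) v))"

definition smooth_on :: "'a::real_normed_vector set \<Rightarrow> ('a \<Rightarrow> 'b::real_normed_vector) \<Rightarrow> bool" where
  "smooth_on S f \<longleftrightarrow> (\<forall>k. Ck_on k S f)"

text \<open>
  A chart is a pair (U, c) of an open set U and a homeomorphism c from U onto an open subset
  of the model space. The manifold is the whole type 'a; only the values of c on U matter.
\<close>

type_synonym ('a, 'b) atlas = "('a set \<times> ('a \<Rightarrow> 'b)) set"

definition smooth_manifold ::
  "('a::{t2_space, second_countable_topology}, 'b::euclidean_space) atlas \<Rightarrow> bool" where
  "smooth_manifold A \<longleftrightarrow>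
     (\<forall>(U, c)\<in>A. open U \<and> open (c ` U) \<and> homeomorphism U (c ` U) c (inv_into U c)) \<and>
     (\<Union>(U, c)\<in>A. U) = UNIV \<and>
     (\<forall>(U, c)\<in>A. \<forall>(V, d)\<in>A. smooth_on (c ` (U \<inter> V)) (d \<circ> inv_into U c))"

definition std_atlas :: "('b, 'b) atlas" where
  "std_atlas = {(UNIV, id)}"

definition prod_atlas :: "('a, 'b) atlas \<Rightarrow> ('c, 'd) atlas \<Rightarrow> ('a \<times> 'c, 'b \<times> 'd) atlas" where
  "prod_atlas A B = {(U \<times> V, map_prod c d) | U c V d. (U, c) \<in> A \<and> (V, d) \<in> B}"

definition smooth_map_on ::
  "('a::topological_space, 'b::euclidean_space) atlas \<Rightarrow>
   ('c::topological_space, 'd::euclidean_space) atlas \<Rightarrow> 'a set \<Rightarrow> ('a \<Rightarrow> 'c) \<Rightarrow> bool" where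
  "smooth_map_on A B S F \<longleftrightarrow>
     continuous_on S F \<and>
     (\<forall>(U, c)\<in>A. \<forall>(V, d)\<in>B.
        smooth_on (c ` (S \<inter> U \<inter> F -` V)) (d \<circ> F \<circ> inv_into U c))"

definition diffeomorphism_on ::
  "('a::topological_space, 'b::euclidean_space) atlas \<Rightarrow>
   ('c::topological_space, 'd::euclidean_space) atlas \<Rightarrow> 'a set \<Rightarrow> 'c set \<Rightarrow> ('a \<Rightarrow> 'c) \<Rightarrow> bool" where
  "diffeomorphism_on A B S T F \<longleftrightarrow>
     bij_betw F S T \<and> smooth_map_on A B S F \<and> smooth_map_on B A T (inv_into S F)"

definition smooth_fun :: "('a::topological_space, 'b::euclidean_space) atlas \<Rightarrow> ('a \<Rightarrow> real) \<Rightarrow> bool" where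
  "smooth_fun A f \<longleftrightarrow> smooth_map_on A std_atlas UNIV f"

section \<open>Tangent vectors, vector fields and tensor fields\<close>

text \<open>
  Tangent vectors at u are the derivations at u of the algebra of smooth functions. A derivation
  is represented by a function on all real functions that is 0 outside the smooth ones, so that
  equality of derivations is equality in HOL.
\<close>

type_synonym 'a tvec = "('a \<Rightarrow> real) \<Rightarrow> real"
type_synonym 'a vfield = "'a \<Rightarrow> 'a tvec"

definition tscale :: "real \<Rightarrow> 'a tvec \<Rightarrow> 'a tvec" (infixr "*\<^sub>T" 75) where
  "c *\<^sub>T v = (\<lambda>f. c * v f)"

definition tangent_space :: "('a::topological_space, 'b::euclidean_space) atlas \<Rightarrow> 'a \<Rightarrow> 'a tvec set" where
  "tangent_space A u = {v.
     (\<forall>f. \<not> smooth_fun A f \<longrightarrow> v f = 0) \<and>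
     (\<forall>f g. smooth_fun A f \<longrightarrow> smooth_fun A g \<longrightarrow>
        v (f + g) = v f + v g \<and> v (f * g) = f u * v g + g u * v f) \<and>
     (\<forall>c f. smooth_fun A f \<longrightarrow> v (\<lambda>x. c * f x) = c * v f)}"

definition vector_field :: "('a::topological_space, 'b::euclidean_space) atlas \<Rightarrow> 'a vfield \<Rightarrow> bool" where
  "vector_field A X \<longleftrightarrow>
     (\<forall>u. X u \<in> tangent_space A u) \<and> (\<forall>f. smooth_fun A f \<longrightarrow> smooth_fun A (\<lambda>u. X u f))"

definition fmult :: "('a \<Rightarrow> real) \<Rightarrow> 'a vfield \<Rightarrow> 'a vfield" where
  "fmult f X = (\<lambda>u. f u *\<^sub>T X u)"

definition lie_bracket :: "'a vfield \<Rightarrow> 'a vfield \<Rightarrow> 'a vfield" where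
  "lie_bracket X Y = (\<lambda>u f. X u (\<lambda>p. Y p f) - Y u (\<lambda>p. X p f))"

text \<open>
  Tensor fields are families of linear or bilinear maps on the tangent spaces (values off the
  tangent spaces are irrelevant) that send smooth vector fields to smooth objects.
\<close>

definition one_form ::
  "('a::topological_space, 'b::euclidean_space) atlas \<Rightarrow> ('a \<Rightarrow> 'a tvec \<Rightarrow> real) \<Rightarrow> bool" where
  "one_form A \<omega> \<longleftrightarrow>
     (\<forall>u. \<forall>a\<in>tangent_space A u.
        (\<forall>b\<in>tangent_space A u. \<omega> u (a + b) = \<omega> u a + \<omega> u b) \<and> (\<forall>c. \<omega> u (c *\<^sub>T a) = c * \<omega> u a)) \<and>
     (\<forall>X. vector_field A X \<longrightarrow> smooth_fun A (\<lambda>u. \<omega> u (X u)))"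

definition tensor_11 ::
  "('a::topological_space, 'b::euclidean_space) atlas \<Rightarrow> ('a \<Rightarrow> 'a tvec \<Rightarrow> 'a tvec) \<Rightarrow> bool" where
  "tensor_11 A \<phi> \<longleftrightarrow>
     (\<forall>u. \<forall>a\<in>tangent_space A u. \<phi> u a \<in> tangent_space A u \<and>
        (\<forall>b\<in>tangent_space A u. \<phi> u (a + b) = \<phi> u a + \<phi> u b) \<and> (\<forall>c. \<phi> u (c *\<^sub>T a) = c *\<^sub>T \<phi> u a)) \<and>
     (\<forall>X. vector_field A X \<longrightarrow> vector_field A (\<lambda>u. \<phi> u (X u)))"

definition tensor_02 ::
  "('a::topological_space, 'b::euclidean_space) atlas \<Rightarrow> ('a \<Rightarrow> 'a tvec \<Rightarrow> 'a tvec \<Rightarrow> real) \<Rightarrow> bool" where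
  "tensor_02 A T \<longleftrightarrow>
     (\<forall>u. \<forall>a\<in>tangent_space A u. \<forall>b\<in>tangent_space A u.
        (\<forall>c\<in>tangent_space A u. T u (a + c) b = T u a b + T u c b \<and> T u a (b + c) = T u a b + T u a c) \<and>
        (\<forall>r. T u (r *\<^sub>T a) b = r * T u a b \<and> T u a (r *\<^sub>T b) = r * T u a b)) \<and>
     (\<forall>X Y. vector_field A X \<longrightarrow> vector_field A Y \<longrightarrow> smooth_fun A (\<lambda>u. T u (X u) (Y u)))"

definition ext_deriv ::
  "('a \<Rightarrow> 'a tvec \<Rightarrow> real) \<Rightarrow> 'a vfield \<Rightarrow> 'a vfield \<Rightarrow> 'a \<Rightarrow> real" where
  "ext_deriv \<omega> X Y = (\<lambda>u. X u (\<lambda>p. \<omega> p (Y p)) - Y u (\<lambda>p. \<omega> p (X p)) - \<omega> u (lie_bracket X Y u))"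

definition lie_deriv_02 ::
  "'a vfield \<Rightarrow> ('a \<Rightarrow> 'a tvec \<Rightarrow> 'a tvec \<Rightarrow> real) \<Rightarrow> 'a vfield \<Rightarrow> 'a vfield \<Rightarrow> 'a \<Rightarrow> real" where
  "lie_deriv_02 Z T X Y = (\<lambda>u. Z u (\<lambda>p. T p (X p) (Y p))
     - T u (lie_bracket Z X u) (Y u) - T u (X u) (lie_bracket Z Y u))"

definition linear_connection ::
  "('a::topological_space, 'b::euclidean_space) atlas \<Rightarrow> ('a vfield \<Rightarrow> 'a vfield \<Rightarrow> 'a vfield) \<Rightarrow> bool" where
  "linear_connection A D \<longleftrightarrow>
     (\<forall>X Y Z f. vector_field A X \<longrightarrow> vector_field A Y \<longrightarrow> vector_field A Z \<longrightarrow> smooth_fun A f \<longrightarrow>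
        vector_field A (D X Y) \<and>
        D (X + Y) Z = D X Z + D Y Z \<and>
        D X (Y + Z) = D X Y + D X Z \<and>
        D (fmult f X) Y = fmult f (D X Y) \<and>
        D X (fmult f Y) = fmult (\<lambda>u. X u f) Y + fmult f (D X Y))"

definition curvature ::
  "('a vfield \<Rightarrow> 'a vfield \<Rightarrow> 'a vfield) \<Rightarrow> 'a vfield \<Rightarrow> 'a vfield \<Rightarrow> 'a vfield \<Rightarrow> 'a vfield" where
  "curvature D X Y Z = D X (D Y Z) - D Y (D X Z) - D (lie_bracket X Y) Z"

text \<open>
  The value R(a,b)c at tangent vectors: the curvature is evaluated on smooth vector fields
  through a, b, c. Such fields exist, and as R is a tensor their choice does not matter.
\<close>

definition extension :: "('a::topological_space, 'b::euclidean_space) atlas \<Rightarrow> 'a \<Rightarrow> 'a tvec \<Rightarrow> 'a vfield" where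
  "extension A u a = (SOME X. vector_field A X \<and> X u = a)"

definition curvature_at ::
  "('a::topological_space, 'b::euclidean_space) atlas \<Rightarrow> ('a vfield \<Rightarrow> 'a vfield \<Rightarrow> 'a vfield) \<Rightarrow>
   'a \<Rightarrow> 'a tvec \<Rightarrow> 'a tvec \<Rightarrow> 'a tvec \<Rightarrow> 'a tvec" where
  "curvature_at A D u a b c =
     curvature D (extension A u a) (extension A u b) (extension A u c) u"

definition plane :: "'a tvec \<Rightarrow> 'a tvec \<Rightarrow> 'a tvec set" where
  "plane a b = {s *\<^sub>T a + t *\<^sub>T b | s t. True}"

text \<open>
  Orthogonal non-null a, b in the subspace W u of the tangent space. They are automatically
  linearly independent, and the planes they span are exactly the G-non-degenerate ones.
\<close>

definition orthogonal_nonnull ::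
  "('a \<Rightarrow> 'a tvec set) \<Rightarrow> ('a \<Rightarrow> 'a tvec \<Rightarrow> 'a tvec \<Rightarrow> real) \<Rightarrow> 'a \<Rightarrow> 'a tvec \<Rightarrow> 'a tvec \<Rightarrow> bool" where
  "orthogonal_nonnull W G u a b \<longleftrightarrow>
     a \<in> W u \<and> b \<in> W u \<and> G u a b = 0 \<and> G u a a \<noteq> 0 \<and> G u b b \<noteq> 0"

definition flag_curvature ::
  "('a::topological_space, 'b::euclidean_space) atlas \<Rightarrow> ('a \<Rightarrow> 'a tvec \<Rightarrow> 'a tvec \<Rightarrow> real) \<Rightarrow>
   ('a vfield \<Rightarrow> 'a vfield \<Rightarrow> 'a vfield) \<Rightarrow> 'a \<Rightarrow> 'a tvec \<Rightarrow> 'a tvec \<Rightarrow> real" where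
  "flag_curvature A G D u a b = G u (curvature_at A D u a b b) a / (G u a a * G u b b)"

section \<open>Vector bundles and nonlinear connections\<close>

text \<open>
  The base has dimension CARD('n), the fibres have dimension CARD('k), and the total space is
  modelled on the product. The operations badd and bscale are the linear structure of the
  fibres: badd p q is meaningful only for p and q in the same fibre.
\<close>

record ('e, 'm, 'n, 'k) vector_bundle =
  base_atlas :: "('m, real^('n::finite)) atlas"
  total_atlas :: "('e, (real^('n::finite)) \<times> (real^('k::finite))) atlas"
  bproj :: "'e \<Rightarrow> 'm"
  badd :: "'e \<Rightarrow> 'e \<Rightarrow> 'e"
  bscale :: "real \<Rightarrow> 'e \<Rightarrow> 'e"

text \<open>
  Since each fibre over U is mapped bijectively onto R^k by the operation-preserving map
  \<psi>, the vector space axioms hold in the fibres.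
\<close>

definition local_trivialization ::
  "('e::topological_space, 'm::topological_space, 'n::finite, 'k::finite) vector_bundle \<Rightarrow>
   'm set \<Rightarrow> ('e \<Rightarrow> real^'k) \<Rightarrow> bool" where
  "local_trivialization B U \<psi> \<longleftrightarrow>
     open U \<and>
     diffeomorphism_on (total_atlas B) (prod_atlas (base_atlas B) std_atlas)
       (bproj B -` U) (U \<times> UNIV) (\<lambda>p. (bproj B p, \<psi> p)) \<and>
     (\<forall>p q. bproj B p \<in> U \<longrightarrow> bproj B q = bproj B p \<longrightarrow>
        bproj B (badd B p q) = bproj B p \<and> \<psi> (badd B p q) = \<psi> p + \<psi> q) \<and>
     (\<forall>c p. bproj B p \<in> U \<longrightarrow>
        bproj B (bscale B c p) = bproj B p \<and> \<psi> (bscale B c p) = c *\<^sub>R \<psi> p)"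

definition smooth_vector_bundle ::
  "('e::{t2_space, second_countable_topology}, 'm::{t2_space, second_countable_topology},
    'n::finite, 'k::finite) vector_bundle \<Rightarrow> bool" where
  "smooth_vector_bundle B \<longleftrightarrow>
     smooth_manifold (base_atlas B) \<and> smooth_manifold (total_atlas B) \<and>
     smooth_map_on (total_atlas B) (base_atlas B) UNIV (bproj B) \<and> surj (bproj B) \<and>
     (\<forall>x. \<exists>U \<psi>. x \<in> U \<and> local_trivialization B U \<psi>)"

abbreviation TE ::
  "('e::topological_space, 'm, 'n::finite, 'k::finite) vector_bundle \<Rightarrow> 'e \<Rightarrow> 'e tvec set" where
  "TE B \<equiv> tangent_space (total_atlas B)"

abbreviation vfield_on_E ::
  "('e::topological_space, 'm, 'n::finite, 'k::finite) vector_bundle \<Rightarrow> 'e vfield \<Rightarrow> bool" where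
  "vfield_on_E B \<equiv> vector_field (total_atlas B)"

text \<open>VE is the kernel of the differential of the projection, which maps v to g \<mapsto> v (g o pi).\<close>

definition VE ::
  "('e::topological_space, 'm::topological_space, 'n::finite, 'k::finite) vector_bundle \<Rightarrow>
   'e \<Rightarrow> 'e tvec set" where
  "VE B u = {v \<in> TE B u. \<forall>g. smooth_fun (base_atlas B) g \<longrightarrow> v (g \<circ> bproj B) = 0}"

text \<open>
  HE is a smooth distribution of rank n complementary to VE. The local frames are given by
  globally defined vector fields that form a basis of HE over a neighbourhood W; cutting off a
  frame defined only near u yields such fields.
\<close>

definition nonlinear_connection ::
  "('e::topological_space, 'm::topological_space, 'n::finite, 'k::finite) vector_bundle \<Rightarrow>
   ('e \<Rightarrow> 'e tvec set) \<Rightarrow> bool" where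
  "nonlinear_connection B HE \<longleftrightarrow>
     (\<forall>u. \<exists>W (X :: 'n \<Rightarrow> 'e vfield). open W \<and> u \<in> W \<and> (\<forall>i. vfield_on_E B (X i)) \<and>
        (\<forall>p\<in>W. HE p = {\<Sum>i\<in>UNIV. (c $ i) *\<^sub>T X i p | c :: real^'n. True} \<and>
           (\<forall>c :: real^'n. (\<Sum>i\<in>UNIV. (c $ i) *\<^sub>T X i p) = 0 \<longrightarrow> c = 0))) \<and>
     (\<forall>u. HE u \<inter> VE B u = {0} \<and> TE B u = {a + b | a b. a \<in> HE u \<and> b \<in> VE B u})"

definition hor ::
  "('e::topological_space, 'm::topological_space, 'n::finite, 'k::finite) vector_bundle \<Rightarrow>
   ('e \<Rightarrow> 'e tvec set) \<Rightarrow> 'e \<Rightarrow> 'e tvec \<Rightarrow> 'e tvec" where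
  "hor B HE u v = (THE a. a \<in> HE u \<and> v - a \<in> VE B u)"

definition ver ::
  "('e::topological_space, 'm::topological_space, 'n::finite, 'k::finite) vector_bundle \<Rightarrow>
   ('e \<Rightarrow> 'e tvec set) \<Rightarrow> 'e \<Rightarrow> 'e tvec \<Rightarrow> 'e tvec" where
  "ver B HE u v = v - hor B HE u v"

definition hpart ::
  "('e::topological_space, 'm::topological_space, 'n::finite, 'k::finite) vector_bundle \<Rightarrow>
   ('e \<Rightarrow> 'e tvec set) \<Rightarrow> 'e vfield \<Rightarrow> 'e vfield" where
  "hpart B HE X = (\<lambda>u. hor B HE u (X u))"

definition vpart ::
  "('e::topological_space, 'm::topological_space, 'n::finite, 'k::finite) vector_bundle \<Rightarrow>
   ('e \<Rightarrow> 'e tvec set) \<Rightarrow> 'e vfield \<Rightarrow> 'e vfield" where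
  "vpart B HE X = (\<lambda>u. ver B HE u (X u))"

definition hform ::
  "('e::topological_space, 'm::topological_space, 'n::finite, 'k::finite) vector_bundle \<Rightarrow>
   ('e \<Rightarrow> 'e tvec set) \<Rightarrow> ('e \<Rightarrow> 'e tvec \<Rightarrow> real) \<Rightarrow> 'e \<Rightarrow> 'e tvec \<Rightarrow> real" where
  "hform B HE \<omega> = (\<lambda>u a. \<omega> u (hor B HE u a))"

definition vform ::
  "('e::topological_space, 'm::topological_space, 'n::finite, 'k::finite) vector_bundle \<Rightarrow>
   ('e \<Rightarrow> 'e tvec set) \<Rightarrow> ('e \<Rightarrow> 'e tvec \<Rightarrow> real) \<Rightarrow> 'e \<Rightarrow> 'e tvec \<Rightarrow> real" where
  "vform B HE \<omega> = (\<lambda>u a. \<omega> u (ver B HE u a))"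

definition hmetric ::
  "('e::topological_space, 'm::topological_space, 'n::finite, 'k::finite) vector_bundle \<Rightarrow>
   ('e \<Rightarrow> 'e tvec set) \<Rightarrow> ('e \<Rightarrow> 'e tvec \<Rightarrow> 'e tvec \<Rightarrow> real) \<Rightarrow>
   'e \<Rightarrow> 'e tvec \<Rightarrow> 'e tvec \<Rightarrow> real" where
  "hmetric B HE G = (\<lambda>u a b. G u (hor B HE u a) (hor B HE u b))"

definition vmetric ::
  "('e::topological_space, 'm::topological_space, 'n::finite, 'k::finite) vector_bundle \<Rightarrow>
   ('e \<Rightarrow> 'e tvec set) \<Rightarrow> ('e \<Rightarrow> 'e tvec \<Rightarrow> 'e tvec \<Rightarrow> real) \<Rightarrow>
   'e \<Rightarrow> 'e tvec \<Rightarrow> 'e tvec \<Rightarrow> real" where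
  "vmetric B HE G = (\<lambda>u a b. G u (ver B HE u a) (ver B HE u b))"

section \<open>Paracontact Finsler structures\<close>

definition almost_paracontact_Finsler ::
  "('e::topological_space, 'm::topological_space, 'n::finite, 'k::finite) vector_bundle \<Rightarrow>
   ('e \<Rightarrow> 'e tvec set) \<Rightarrow> ('e \<Rightarrow> 'e tvec \<Rightarrow> 'e tvec) \<Rightarrow> ('e \<Rightarrow> 'e tvec \<Rightarrow> real) \<Rightarrow>
   'e vfield \<Rightarrow> bool" where
  "almost_paracontact_Finsler B HE \<phi> \<eta> \<xi> \<longleftrightarrow>
     tensor_11 (total_atlas B) \<phi> \<and> one_form (total_atlas B) \<eta> \<and> vfield_on_E B \<xi> \<and>
     (\<forall>u. \<phi> u ` HE u \<subseteq> HE u \<and> \<phi> u ` VE B u \<subseteq> VE B u) \<and>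
     (\<forall>u. \<forall>a\<in>TE B u. \<phi> u (\<phi> u a) =
        a - hform B HE \<eta> u a *\<^sub>T hpart B HE \<xi> u - vform B HE \<eta> u a *\<^sub>T vpart B HE \<xi> u) \<and>
     (\<forall>u. hform B HE \<eta> u (hpart B HE \<xi> u) = 1 \<and> vform B HE \<eta> u (vpart B HE \<xi> u) = 1)"

definition nondegenerate_on ::
  "('a \<Rightarrow> 'a tvec set) \<Rightarrow> ('a \<Rightarrow> 'a tvec \<Rightarrow> 'a tvec \<Rightarrow> real) \<Rightarrow> bool" where
  "nondegenerate_on W G \<longleftrightarrow> (\<forall>u. \<forall>a\<in>W u. (\<forall>b\<in>W u. G u a b = 0) \<longrightarrow> a = 0)"

definition pseudo_metric ::
  "('e::topological_space, 'm::topological_space, 'n::finite, 'k::finite) vector_bundle \<Rightarrow>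
   ('e \<Rightarrow> 'e tvec set) \<Rightarrow> ('e \<Rightarrow> 'e tvec \<Rightarrow> 'e tvec \<Rightarrow> real) \<Rightarrow> bool" where
  "pseudo_metric B HE G \<longleftrightarrow>
     tensor_02 (total_atlas B) G \<and>
     (\<forall>u. \<forall>a\<in>TE B u. \<forall>b\<in>TE B u.
        G u a b = G u b a \<and> G u a b = hmetric B HE G u a b + vmetric B HE G u a b) \<and>
     nondegenerate_on (TE B) G \<and>
     nondegenerate_on HE (hmetric B HE G) \<and> nondegenerate_on (VE B) (vmetric B HE G)"

definition almost_paracontact_metric_Finsler ::
  "('e::topological_space, 'm::topological_space, 'n::finite, 'k::finite) vector_bundle \<Rightarrow>
   ('e \<Rightarrow> 'e tvec set) \<Rightarrow> ('e \<Rightarrow> 'e tvec \<Rightarrow> 'e tvec) \<Rightarrow> ('e \<Rightarrow> 'e tvec \<Rightarrow> real) \<Rightarrow>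
   'e vfield \<Rightarrow> ('e \<Rightarrow> 'e tvec \<Rightarrow> 'e tvec \<Rightarrow> real) \<Rightarrow> bool" where
  "almost_paracontact_metric_Finsler B HE \<phi> \<eta> \<xi> G \<longleftrightarrow>
     almost_paracontact_Finsler B HE \<phi> \<eta> \<xi> \<and> pseudo_metric B HE G \<and>
     (\<forall>u. \<forall>a\<in>TE B u. \<forall>b\<in>TE B u.
        hmetric B HE G u (\<phi> u a) (\<phi> u b) =
          - hmetric B HE G u a b + hform B HE \<eta> u a * hform B HE \<eta> u b \<and>
        vmetric B HE G u (\<phi> u a) (\<phi> u b) =
          - vmetric B HE G u a b + vform B HE \<eta> u a * vform B HE \<eta> u b)"

definition fundamental_form ::
  "('a \<Rightarrow> 'a tvec \<Rightarrow> 'a tvec) \<Rightarrow> ('a \<Rightarrow> 'a tvec \<Rightarrow> 'a tvec \<Rightarrow> real) \<Rightarrow>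
   'a \<Rightarrow> 'a tvec \<Rightarrow> 'a tvec \<Rightarrow> real" where
  "fundamental_form \<phi> G = (\<lambda>u a b. G u a (\<phi> u b))"

definition paracontact_metric_Finsler ::
  "('e::topological_space, 'm::topological_space, 'n::finite, 'k::finite) vector_bundle \<Rightarrow>
   ('e \<Rightarrow> 'e tvec set) \<Rightarrow> ('e \<Rightarrow> 'e tvec \<Rightarrow> 'e tvec) \<Rightarrow> ('e \<Rightarrow> 'e tvec \<Rightarrow> real) \<Rightarrow>
   'e vfield \<Rightarrow> ('e \<Rightarrow> 'e tvec \<Rightarrow> 'e tvec \<Rightarrow> real) \<Rightarrow> bool" where
  "paracontact_metric_Finsler B HE \<phi> \<eta> \<xi> G \<longleftrightarrow>
     almost_paracontact_metric_Finsler B HE \<phi> \<eta> \<xi> G \<and>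
     (\<forall>X Y. vfield_on_E B X \<longrightarrow> vfield_on_E B Y \<longrightarrow>
        (\<forall>u. ext_deriv (hform B HE \<eta>) X Y u =
               fundamental_form \<phi> G u (hpart B HE X u) (hpart B HE Y u) \<and>
             ext_deriv (vform B HE \<eta>) X Y u =
               fundamental_form \<phi> G u (vpart B HE X u) (vpart B HE Y u)))"

definition K_paracontact_Finsler ::
  "('e::topological_space, 'm::topological_space, 'n::finite, 'k::finite) vector_bundle \<Rightarrow>
   ('e \<Rightarrow> 'e tvec set) \<Rightarrow> ('e \<Rightarrow> 'e tvec \<Rightarrow> 'e tvec) \<Rightarrow> ('e \<Rightarrow> 'e tvec \<Rightarrow> real) \<Rightarrow>
   'e vfield \<Rightarrow> ('e \<Rightarrow> 'e tvec \<Rightarrow> 'e tvec \<Rightarrow> real) \<Rightarrow> bool" where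
  "K_paracontact_Finsler B HE \<phi> \<eta> \<xi> G \<longleftrightarrow>
     paracontact_metric_Finsler B HE \<phi> \<eta> \<xi> G \<and>
     (\<forall>X Y. vfield_on_E B X \<longrightarrow> vfield_on_E B Y \<longrightarrow>
        (\<forall>u. lie_deriv_02 (hpart B HE \<xi>) (hmetric B HE G) X Y u = 0 \<and>
             lie_deriv_02 (vpart B HE \<xi>) (vmetric B HE G) X Y u = 0))"

section \<open>Finsler connections\<close>

definition d_connection ::
  "('e::topological_space, 'm::topological_space, 'n::finite, 'k::finite) vector_bundle \<Rightarrow>
   ('e \<Rightarrow> 'e tvec set) \<Rightarrow> ('e vfield \<Rightarrow> 'e vfield \<Rightarrow> 'e vfield) \<Rightarrow> bool" where
  "d_connection B HE D \<longleftrightarrow>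
     linear_connection (total_atlas B) D \<and>
     (\<forall>X Y. vfield_on_E B X \<longrightarrow> vfield_on_E B Y \<longrightarrow>
        D X (hpart B HE Y) = hpart B HE (D X Y) \<and> D X (vpart B HE Y) = vpart B HE (D X Y))"

definition metrical ::
  "('e::topological_space, 'm::topological_space, 'n::finite, 'k::finite) vector_bundle \<Rightarrow>
   ('e \<Rightarrow> 'e tvec \<Rightarrow> 'e tvec \<Rightarrow> real) \<Rightarrow> ('e vfield \<Rightarrow> 'e vfield \<Rightarrow> 'e vfield) \<Rightarrow> bool" where
  "metrical B G D \<longleftrightarrow>
     (\<forall>X Y Z. vfield_on_E B X \<longrightarrow> vfield_on_E B Y \<longrightarrow> vfield_on_E B Z \<longrightarrow>
        (\<forall>u. X u (\<lambda>p. G p (Y p) (Z p)) - G u (D X Y u) (Z u) - G u (Y u) (D X Z u) = 0))"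

definition symmetric_connection ::
  "('e::topological_space, 'm::topological_space, 'n::finite, 'k::finite) vector_bundle \<Rightarrow>
   ('e \<Rightarrow> 'e tvec set) \<Rightarrow> ('e vfield \<Rightarrow> 'e vfield \<Rightarrow> 'e vfield) \<Rightarrow> bool" where
  "symmetric_connection B HE D \<longleftrightarrow>
     (\<forall>X Y. vfield_on_E B X \<longrightarrow> vfield_on_E B Y \<longrightarrow>
        D (hpart B HE X) (hpart B HE Y) - D (hpart B HE Y) (hpart B HE X)
          - hpart B HE (lie_bracket (hpart B HE X) (hpart B HE Y)) = 0 \<and>
        D (vpart B HE X) (vpart B HE Y) - D (vpart B HE Y) (vpart B HE X)
          - vpart B HE (lie_bracket (vpart B HE X) (vpart B HE Y)) = 0)"

definition Finsler_connection ::
  "('e::topological_space, 'm::topological_space, 'n::finite, 'k::finite) vector_bundle \<Rightarrow>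
   ('e \<Rightarrow> 'e tvec set) \<Rightarrow> ('e \<Rightarrow> 'e tvec \<Rightarrow> 'e tvec \<Rightarrow> real) \<Rightarrow>
   ('e vfield \<Rightarrow> 'e vfield \<Rightarrow> 'e vfield) \<Rightarrow> bool" where
  "Finsler_connection B HE G D \<longleftrightarrow>
     d_connection B HE D \<and> metrical B G D \<and> symmetric_connection B HE D"

end

theory Submission
  imports Defs
begin

text \<open>
  Both parts follow from one computation on a distribution \<open>W\<close>, which is either \<open>HE\<close> or \<open>VE\<close>, with
  \<open>\<xi>\<close> the component of the given field in \<open>W\<close>. For fields \<open>X\<close>, \<open>Y\<close> in \<open>W\<close>, the contact condition
  gives the skew part and the Killing condition the symmetric part of \<open>(X, Y) \<mapsto> G(D\<^sub>X \<xi>, Y)\<close>, because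
  on \<open>W\<close> the connection is metric and torsion free; together they say that
  \<open>2 G(D\<^sub>X \<xi>, Y) = - G(\<phi> X, Y)\<close> (lemma \<open>G_D_xi\<close>). Inserting this into the definition of the curvature,
  and splitting \<open>[C, \<xi>]\<close> into its part in \<open>W\<close> and the transversal part \<open>Q\<close>, gives
  \<open>G(R(C, \<xi>) \<xi>, C) = - 1/4 (G(C, C) - G(C, \<xi>)\<^sup>2) - G(D\<^sub>Q \<xi>, C)\<close> (lemma \<open>xi_curvature\<close>). The flag
  curvature of a plane through \<open>\<xi>\<close> may be computed with \<open>\<xi>\<close> and a vector \<open>C\<close> orthogonal to it, so it is
  \<open>- 1/4\<close> exactly if \<open>G(D\<^sub>Q \<xi>, C) = 0\<close>. For the vertical bundle \<open>Q = 0\<close>, because \<open>VE\<close> is integrable;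
  for \<open>HE\<close> this is the condition in the statement. That condition ranges over all horizontal \<open>X\<close>, while
  flag curvatures only see non-null \<open>X\<close> orthogonal to \<open>\<xi>\<close>; but the expression is a quadratic form in
  \<open>X\<close>, does not change if a multiple of \<open>\<xi>\<close> is added to \<open>X\<close>, and vanishes on null vectors as soon as it
  vanishes on the nearby non-null ones (theorem \<open>xi_flag_curvature_iff\<close>).

  The computation is carried out with global vector fields, whereas flag curvatures are defined with
  tangent vectors, that is, derivations. The passage between the two rests on three facts. By Hadamard's
  lemma every derivation is a directional derivative in a chart (\<open>tangent_chart\<close>); hence tangent
  vectors extend to vector fields (\<open>vector_field_through\<close>), and expressions linear over the smooth
  functions depend on the value of a field at the point only (\<open>tensorial_pointwise\<close>), which applies to
  the curvature. Finally the horizontal part of a smooth field is smooth (\<open>vector_field_hpart\<close>): its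
  coefficients in a local frame of \<open>HE\<close> solve a linear system with the Gram matrix of the frame, and
  the Gram determinant does not vanish since \<open>G\<close> is non-degenerate on \<open>HE\<close>.
\<close>

section \<open>Calculus of \<open>C\<^sup>k\<close> maps\<close>
lemma has_derivative_cong_open:
  assumes "open S" "x \<in> S" "\<And>y. y \<in> S \<Longrightarrow> f y = g y"
  shows "(f has_derivative f') (at x) \<longleftrightarrow> (g has_derivative f') (at x)"
  using has_derivative_transform_within_open[OF _ assms(1,2)] assms(3) by metis

text \<open>
  The last premise is the congruence rule of order \<open>k\<close>. It is kept as a premise because this lemma is
  the induction step in the proof of that very rule, \<open>Ck_on_cong\<close>.
\<close>
lemma Ck_on_SucI:
  fixes f :: "'a::real_normed_vector \<Rightarrow> 'b::real_normed_vector"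
  assumes "\<And>x. x \<in> S \<Longrightarrow> (f has_derivative f' x) (at x)"
    and "\<And>v. Ck_on k S (\<lambda>x. f' x v)"
    and cong: "\<And>g h :: 'a \<Rightarrow> 'b. (\<And>x. x \<in> S \<Longrightarrow> g x = h x) \<Longrightarrow> Ck_on k S g \<Longrightarrow> Ck_on k S h"
  shows "Ck_on (Suc k) S f"
proof -
  have eq: "f' x = frechet_derivative f (at x)" if "x \<in> S" for x
    using frechet_derivative_at[OF assms(1)[OF that]] .
  have "Ck_on k S (\<lambda>x. frechet_derivative f (at x) v)" for v
    by (rule cong[of "\<lambda>x. f' x v"]) (simp_all add: eq assms(2))
  then show ?thesis
    using assms(1) by (auto simp: differentiable_def)
qed

lemma Ck_on_cong:
  assumes "open S" "\<And>x. x \<in> S \<Longrightarrow> f x = g x" "Ck_on k S f"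
  shows "Ck_on k S g"
  using assms(2,3)
proof (induction k arbitrary: f g)
  case 0
  then show ?case using continuous_on_cong by (metis Ck_on.simps(1))
next
  case (Suc k)
  have "(g has_derivative frechet_derivative f (at x)) (at x)" if "x \<in> S" for x
    using has_derivative_cong_open[OF assms(1) that, of f g] Suc.prems that
      frechet_derivative_works[of f "at x"] by (metis Ck_on.simps(2))
  moreover have "Ck_on k S (\<lambda>x. frechet_derivative f (at x) v)" for v
    using Suc.prems by simp
  ultimately show ?case
    using Suc.IH by (intro Ck_on_SucI) auto
qed

lemma Ck_on_SucI_open:
  assumes "open S" "\<And>x. x \<in> S \<Longrightarrow> (f has_derivative f' x) (at x)"
    and "\<And>v. Ck_on k S (\<lambda>x. f' x v)"
  shows "Ck_on (Suc k) S f"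
  using assms(2,3) Ck_on_cong[OF assms(1)] by (rule Ck_on_SucI)

lemma Ck_on_SucD:
  assumes "Ck_on (Suc k) S f"
  shows "x \<in> S \<Longrightarrow> (f has_derivative frechet_derivative f (at x)) (at x)"
    and "Ck_on k S (\<lambda>x. frechet_derivative f (at x) v)"
  using assms frechet_derivative_works by auto

lemma Ck_on_subset: "Ck_on k S f \<Longrightarrow> T \<subseteq> S \<Longrightarrow> Ck_on k T f"
  by (induction k arbitrary: f) (auto intro: continuous_on_subset)

lemma Ck_on_Suc_imp_Ck_on: "Ck_on (Suc k) S f \<Longrightarrow> Ck_on k S f"
proof (induction k arbitrary: f)
  case 0
  then show ?case
    by (auto intro!: differentiable_imp_continuous_on simp: differentiable_on_def differentiable_at_withinI)
next
  case (Suc k)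
  then show ?case by (metis Ck_on.simps(2))
qed

lemma Ck_on_continuous: "Ck_on k S f \<Longrightarrow> continuous_on S f"
  by (induction k) (auto dest: Ck_on_Suc_imp_Ck_on simp del: Ck_on.simps(2))

lemma Ck_on_local:
  assumes "\<And>x. x \<in> S \<Longrightarrow> \<exists>T. open T \<and> x \<in> T \<and> Ck_on k T f"
  shows "Ck_on k S f"
  using assms
proof (induction k arbitrary: f)
  case 0
  show ?case
    unfolding Ck_on.simps continuous_on_eq_continuous_within
  proof
    fix x assume "x \<in> S"
    then obtain T where "open T" "x \<in> T" "continuous_on T f" using 0 by (metis Ck_on.simps(1))
    then show "continuous (at x within S) f"
      using continuous_on_eq_continuous_at continuous_at_imp_continuous_at_within by blast
  qed
next
  case (Suc k)
  have "Ck_on k S (\<lambda>x. frechet_derivative f (at x) v)" for v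
    by (rule Suc.IH) (metis Ck_on_SucD(2) Suc.prems)
  moreover have "f differentiable (at x)" if "x \<in> S" for x
    using Suc.prems[OF that] by auto
  ultimately show ?case by simp
qed

lemma Ck_on_const: "Ck_on k S (\<lambda>x. c)"
  by (induction k arbitrary: c) auto

lemma Ck_on_add:
  assumes "open S" "Ck_on k S f" "Ck_on k S g"
  shows "Ck_on k S (\<lambda>x. f x + g x)"
  using assms(2,3)
proof (induction k arbitrary: f g)
  case 0
  then show ?case by (auto intro: continuous_intros)
next
  case (Suc k)
  note D = Ck_on_SucD[OF Suc.prems(1)] Ck_on_SucD[OF Suc.prems(2)]
  show ?case
  proof (rule Ck_on_SucI_open[OF assms(1)])
    show "((\<lambda>x. f x + g x) has_derivative
        (\<lambda>v. frechet_derivative f (at x) v + frechet_derivative g (at x) v)) (at x)" if "x \<in> S" for x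
      using that by (intro has_derivative_add D)
  qed (intro Suc.IH D)
qed

lemma Ck_on_mult:
  fixes f g :: "'a::real_normed_vector \<Rightarrow> real"
  assumes "open S" "Ck_on k S f" "Ck_on k S g"
  shows "Ck_on k S (\<lambda>x. f x * g x)"
  using assms(2,3)
proof (induction k arbitrary: f g)
  case 0
  then show ?case by (auto intro: continuous_intros)
next
  case (Suc k)
  note D = Ck_on_SucD[OF Suc.prems(1)] Ck_on_SucD[OF Suc.prems(2)]
  note I = Suc.prems[THEN Ck_on_Suc_imp_Ck_on]
  show ?case
  proof (rule Ck_on_SucI_open[OF assms(1)])
    show "((\<lambda>x. f x * g x) has_derivative
        (\<lambda>v. f x * frechet_derivative g (at x) v + frechet_derivative f (at x) v * g x)) (at x)" if "x \<in> S" for x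
      using that by (intro has_derivative_mult D)
  qed (intro Ck_on_add[OF assms(1)] Suc.IH D I)
qed

lemma Ck_on_sum:
  assumes "open S" "\<And>i. i \<in> I \<Longrightarrow> Ck_on k S (f i)"
  shows "Ck_on k S (\<lambda>x. \<Sum>i\<in>I. f i x)"
  using assms(2)
  by (induction I rule: infinite_finite_induct) (auto intro: Ck_on_const Ck_on_add[OF assms(1)])

lemma Ck_on_inverse:
  fixes f :: "'a::real_normed_vector \<Rightarrow> real"
  assumes "open S" "Ck_on k S f" "\<And>x. x \<in> S \<Longrightarrow> f x \<noteq> 0"
  shows "Ck_on k S (\<lambda>x. inverse (f x))"
  using assms(2)
proof (induction k)
  case 0
  then show ?case using assms(3) by (auto intro: continuous_intros)
next
  case (Suc k)
  note D = Ck_on_SucD[OF Suc.prems]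
  note I = Suc.IH[OF Suc.prems[THEN Ck_on_Suc_imp_Ck_on]]
  have "Ck_on k S (\<lambda>x. (- 1) * (inverse (f x) * frechet_derivative f (at x) v * inverse (f x)))" for v
    by (intro Ck_on_mult[OF assms(1)] Ck_on_const I D)
  moreover have "((\<lambda>x. inverse (f x)) has_derivative
      (\<lambda>v. (- 1) * (inverse (f x) * frechet_derivative f (at x) v * inverse (f x)))) (at x)" if "x \<in> S" for x
    using Deriv.has_derivative_inverse[OF assms(3) D(1)] that by simp
  ultimately show ?case
    by (intro Ck_on_SucI_open[OF assms(1), where f' = "\<lambda>x v. (- 1) * (inverse (f x) * frechet_derivative f (at x) v * inverse (f x))"])
qed

lemma Ck_on_bounded_linear:
  assumes "open S" "bounded_linear L" "Ck_on k S f"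
  shows "Ck_on k S (\<lambda>x. L (f x))"
  using assms(3)
proof (induction k arbitrary: f)
  case 0
  then show ?case
    using assms(2) bounded_linear.continuous_on by auto
next
  case (Suc k)
  note D = Ck_on_SucD[OF Suc.prems]
  show ?case
  proof (rule Ck_on_SucI_open[OF assms(1)])
    show "((\<lambda>x. L (f x)) has_derivative (\<lambda>v. L (frechet_derivative f (at x) v))) (at x)" if "x \<in> S" for x
      using that by (intro bounded_linear.has_derivative[OF assms(2)] D)
  qed (intro Suc.IH D)
qed

lemma Ck_on_id: "open S \<Longrightarrow> Ck_on k S (\<lambda>x. x)"
  by (cases k) (auto intro: Ck_on_const Ck_on_SucI_open[OF _ has_derivative_ident])

text \<open>
  Expressing the derivative by its values on the basis makes the derivative of a composition a finite sum
  of products of functions that are \<open>C\<^sup>k\<close> by induction.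
\<close>
lemma frechet_derivative_eq_sum:
  fixes f :: "'a::euclidean_space \<Rightarrow> 'b::real_normed_vector"
  assumes "(f has_derivative f') (at x)"
  shows "f' v = (\<Sum>b\<in>Basis. (v \<bullet> b) *\<^sub>R f' b)"
proof -
  interpret bounded_linear f' using assms has_derivative_bounded_linear by blast
  have "f' v = f' (\<Sum>b\<in>Basis. (v \<bullet> b) *\<^sub>R b)" by (simp add: euclidean_representation)
  then show ?thesis by (simp add: sum scaleR)
qed

lemma Ck_on_compose:
  fixes g :: "'b::euclidean_space \<Rightarrow> real" and f :: "'a::real_normed_vector \<Rightarrow> 'b"
  assumes "open S" "open T" "Ck_on k T g" "Ck_on k S f" "f ` S \<subseteq> T"
  shows "Ck_on k S (\<lambda>x. g (f x))"
  using assms(3,4)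
proof (induction k arbitrary: g)
  case 0
  then show ?case using assms(5) by (auto intro: continuous_on_compose2)
next
  case (Suc k)
  note D = Ck_on_SucD[OF Suc.prems(1)] Ck_on_SucD[OF Suc.prems(2)]
  have I: "Ck_on k S f" using Suc.prems by (metis Ck_on_Suc_imp_Ck_on)
  let ?g = "\<lambda>x. frechet_derivative g (at (f x))" and ?f = "\<lambda>x. frechet_derivative f (at x)"
  show ?case
  proof (rule Ck_on_SucI_open[OF assms(1)])
    fix x assume x: "x \<in> S"
    then have "f x \<in> T" using assms(5) by auto
    then have "((\<lambda>x. g (f x)) has_derivative (\<lambda>v. ?g x (?f x v))) (at x)"
      using has_derivative_compose[OF D(3)[OF x] D(1)] by simp
    moreover have "(\<lambda>v. ?g x (?f x v)) = (\<lambda>v. \<Sum>b\<in>Basis. (?f x v \<bullet> b) * ?g x b)"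
      using frechet_derivative_eq_sum[OF D(1)[OF \<open>f x \<in> T\<close>]]
      unfolding real_scaleR_def by (rule ext)
    ultimately show "((\<lambda>x. g (f x)) has_derivative (\<lambda>v. \<Sum>b\<in>Basis. (?f x v \<bullet> b) * ?g x b)) (at x)"
      by (rule back_subst)
  next
    fix v
    show "Ck_on k S (\<lambda>x. \<Sum>b\<in>Basis. (?f x v \<bullet> b) * ?g x b)"
      by (intro Ck_on_sum Ck_on_mult assms Suc.IH D I
          Ck_on_bounded_linear[OF _ bounded_linear_inner_left])
  qed
qed

lemma smooth_on_const: "smooth_on S (\<lambda>x. c)"
  by (simp add: smooth_on_def Ck_on_const)

lemma smooth_on_id: "open S \<Longrightarrow> smooth_on S (\<lambda>x. x)"
  by (simp add: smooth_on_def Ck_on_id)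

lemma smooth_on_inner: "open S \<Longrightarrow> smooth_on S f \<Longrightarrow> smooth_on S (\<lambda>x. f x \<bullet> b)"
  by (simp add: smooth_on_def Ck_on_bounded_linear[OF _ bounded_linear_inner_left])

lemma smooth_on_add: "open S \<Longrightarrow> smooth_on S f \<Longrightarrow> smooth_on S g \<Longrightarrow> smooth_on S (\<lambda>x. f x + g x)"
  by (simp add: smooth_on_def Ck_on_add)

lemma smooth_on_mult:
  fixes f g :: "'a::real_normed_vector \<Rightarrow> real"
  shows "open S \<Longrightarrow> smooth_on S f \<Longrightarrow> smooth_on S g \<Longrightarrow> smooth_on S (\<lambda>x. f x * g x)"
  by (simp add: smooth_on_def Ck_on_mult)

lemma smooth_on_sum:
  "open S \<Longrightarrow> (\<And>i. i \<in> I \<Longrightarrow> smooth_on S (f i)) \<Longrightarrow> smooth_on S (\<lambda>x. \<Sum>i\<in>I. f i x)"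
  by (simp add: smooth_on_def Ck_on_sum)

lemma smooth_on_inverse:
  fixes f :: "'a::real_normed_vector \<Rightarrow> real"
  shows "open S \<Longrightarrow> smooth_on S f \<Longrightarrow> (\<And>x. x \<in> S \<Longrightarrow> f x \<noteq> 0) \<Longrightarrow> smooth_on S (\<lambda>x. inverse (f x))"
  by (simp add: smooth_on_def Ck_on_inverse)

lemma smooth_on_compose:
  fixes g :: "'b::euclidean_space \<Rightarrow> real" and f :: "'a::real_normed_vector \<Rightarrow> 'b"
  shows "open S \<Longrightarrow> open T \<Longrightarrow> smooth_on T g \<Longrightarrow> smooth_on S f \<Longrightarrow> f ` S \<subseteq> T \<Longrightarrow>
    smooth_on S (\<lambda>x. g (f x))"
  by (simp add: smooth_on_def Ck_on_compose)

lemma smooth_on_cong: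
  "open S \<Longrightarrow> smooth_on S f \<Longrightarrow> (\<And>x. x \<in> S \<Longrightarrow> f x = g x) \<Longrightarrow> smooth_on S g"
  unfolding smooth_on_def using Ck_on_cong by blast

lemma smooth_on_subset: "smooth_on S f \<Longrightarrow> T \<subseteq> S \<Longrightarrow> smooth_on T f"
  unfolding smooth_on_def using Ck_on_subset by blast

lemma smooth_on_local:
  assumes "\<And>x. x \<in> S \<Longrightarrow> \<exists>T. open T \<and> x \<in> T \<and> smooth_on T f"
  shows "smooth_on S f"
  unfolding smooth_on_def using assms Ck_on_local unfolding smooth_on_def by metis

lemma smooth_on_frechet_derivative:
  "smooth_on S f \<Longrightarrow> smooth_on S (\<lambda>x. frechet_derivative f (at x) v)"
  unfolding smooth_on_def using Ck_on_SucD(2) by metis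

lemma smooth_on_has_derivative:
  "smooth_on S f \<Longrightarrow> x \<in> S \<Longrightarrow> (f has_derivative frechet_derivative f (at x)) (at x)"
  unfolding smooth_on_def using Ck_on_SucD(1) by metis

lemma smooth_on_continuous: "smooth_on S f \<Longrightarrow> continuous_on S f"
  unfolding smooth_on_def using Ck_on.simps(1) by metis

section \<open>Bump functions and Hadamard's lemma\<close>

text \<open>
  The powers of \<open>1/t\<close> are included because the derivative of \<open>exp (- 1/t)\<close> produces them: up to linear
  combinations the family is closed under differentiation, so that smoothness is an induction over the order.
\<close>
definition flat_exp :: "nat \<Rightarrow> real \<Rightarrow> real" where
  "flat_exp k t = (if t > 0 then inverse t ^ k * exp (- inverse t) else 0)"

lemma flat_exp_tendsto_0: "(flat_exp k \<longlongrightarrow> 0) (at 0)"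
proof -
  have "((\<lambda>y::real. y ^ k / exp y) \<longlongrightarrow> 0) at_top" by (rule tendsto_power_div_exp_0)
  then have "((\<lambda>t::real. inverse t ^ k / exp (inverse t)) \<longlongrightarrow> 0) (at_right 0)"
    by (rule filterlim_compose) (rule filterlim_inverse_at_top_right)
  then have "(flat_exp k \<longlongrightarrow> 0) (at_right 0)"
    by (rule Lim_transform_eventually)
      (auto simp: flat_exp_def exp_minus field_simps eventually_at intro!: exI[of _ 1])
  moreover have "(flat_exp k \<longlongrightarrow> 0) (at_left 0)"
    by (rule Lim_transform_eventually[OF tendsto_const])
      (auto simp: flat_exp_def eventually_at intro!: exI[of _ 1])
  ultimately show ?thesis by (simp add: filterlim_split_at)
qed

lemma flat_exp_has_derivative:
  "(flat_exp k has_field_derivative (flat_exp (k + 2) t - real k * flat_exp (k + 1) t)) (at t)"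
proof -
  consider "t > 0" | "t < 0" | "t = 0" by linarith
  then show ?thesis
  proof cases
    case 1
    define y where "y = inverse t"
    have 1: "((\<lambda>y. y ^ k * exp (- y)) has_field_derivative (real k * y ^ (k - 1) * exp (- y) - y ^ k * exp (- y))) (at (inverse t))"
      by (auto intro!: derivative_eq_intros simp: y_def)
    have "((\<lambda>t. inverse t ^ k * exp (- inverse t)) has_field_derivative
        (real k * y ^ (k - 1) * exp (- y) - y ^ k * exp (- y)) * (- (y ^ 2))) (at t)"
      using DERIV_chain2[OF 1 DERIV_inverse[of t UNIV]] \<open>t > 0\<close> by (simp add: y_def numeral_2_eq_2)
    moreover have "(real k * y ^ (k - 1) * exp (- y) - y ^ k * exp (- y)) * (- (y ^ 2)) =
        flat_exp (k + 2) t - real k * flat_exp (k + 1) t"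
      using \<open>t > 0\<close> unfolding flat_exp_def y_def[symmetric]
      by (cases k) (simp_all add: algebra_simps power2_eq_square)
    ultimately have *: "((\<lambda>t. inverse t ^ k * exp (- inverse t)) has_field_derivative
        (flat_exp (k + 2) t - real k * flat_exp (k + 1) t)) (at t)" by metis
    show ?thesis
      by (rule has_field_derivative_transform_within_open[OF *, of "{0<..}"])
        (use \<open>t > 0\<close> in \<open>auto simp: flat_exp_def\<close>)
  next
    case 2
    show ?thesis
      by (rule has_field_derivative_transform_within_open[of "\<lambda>_. 0" _ _ "{..<0}"])
        (use 2 in \<open>auto simp: flat_exp_def\<close>)
  next
    case 3
    have "((\<lambda>h. (flat_exp k (0 + h) - flat_exp k 0) / h) \<longlongrightarrow> 0) (at 0)"
      by (rule Lim_transform_eventually[OF flat_exp_tendsto_0[of "Suc k"]])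
        (auto simp: flat_exp_def field_simps eventually_at intro!: exI[of _ 1])
    then show ?thesis using 3 by (simp add: flat_exp_def DERIV_def)
  qed
qed

lemma smooth_on_flat_exp: "smooth_on UNIV (flat_exp k)"
proof -
  have "Ck_on n UNIV (flat_exp k)" for n
  proof (induction n arbitrary: k)
    case 0
    then show ?case
      using flat_exp_has_derivative by (auto intro: DERIV_isCont simp: continuous_on_eq_continuous_at)
  next
    case (Suc n)
    have "Ck_on n UNIV (\<lambda>t. (flat_exp (k + 2) t + (- real k) * flat_exp (k + 1) t) * v)" for v
      by (intro Ck_on_mult Ck_on_add Ck_on_const Suc open_UNIV)
    then show ?case
      using flat_exp_has_derivative
      by (intro Ck_on_SucI_open[of UNIV]) (auto simp: has_field_derivative_def)
  qed
  then show ?thesis by (simp add: smooth_on_def)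
qed

text \<open>Scaled such that the value at the centre is 1.\<close>
definition bump :: "'a::euclidean_space \<Rightarrow> real \<Rightarrow> 'a \<Rightarrow> real" where
  "bump x0 r x = flat_exp 0 (r\<^sup>2 - (x - x0) \<bullet> (x - x0)) / flat_exp 0 (r\<^sup>2)"

lemma smooth_on_bump: "smooth_on UNIV (bump x0 r)"
proof -
  have "smooth_on UNIV (\<lambda>x. r\<^sup>2 + (- 1) * (\<Sum>b\<in>Basis. ((x + - x0) \<bullet> b) * ((x + - x0) \<bullet> b)))"
    by (intro smooth_on_add smooth_on_mult smooth_on_sum smooth_on_inner smooth_on_id smooth_on_const open_UNIV)
  also have "(\<lambda>x. r\<^sup>2 + (- 1) * (\<Sum>b\<in>Basis. ((x + - x0) \<bullet> b) * ((x + - x0) \<bullet> b))) =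
      (\<lambda>x. r\<^sup>2 - (x - x0) \<bullet> (x - x0))"
    by (subst euclidean_inner) simp
  finally have "smooth_on UNIV (\<lambda>x. flat_exp 0 (r\<^sup>2 - (x - x0) \<bullet> (x - x0)) * inverse (flat_exp 0 (r\<^sup>2)))"
    by (intro smooth_on_mult smooth_on_compose[OF _ _ smooth_on_flat_exp] smooth_on_const open_UNIV) auto
  then show ?thesis by (simp add: bump_def[abs_def] divide_inverse)
qed

lemma bump_center [simp]: "r > 0 \<Longrightarrow> bump x0 r x0 = 1"
  by (simp add: bump_def flat_exp_def)

lemma bump_outside: "r > 0 \<Longrightarrow> x \<notin> ball x0 r \<Longrightarrow> bump x0 r x = 0"
proof -
  assume "r > 0" "x \<notin> ball x0 r"
  then have "(norm (x - x0))\<^sup>2 \<ge> r\<^sup>2" by (intro power_mono) (auto simp: dist_norm norm_minus_commute)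
  then show ?thesis by (simp add: bump_def flat_exp_def power2_norm_eq_inner)
qed

lemma segment_in_ball:
  fixes x0 :: "'a::real_normed_vector"
  assumes "x \<in> ball x0 R" "t \<in> {0..1}"
  shows "x0 + t *\<^sub>R (x - x0) \<in> ball x0 R"
proof -
  have "\<bar>t\<bar> * norm (x - x0) \<le> 1 * norm (x - x0)"
    using assms(2) by (intro mult_right_mono) auto
  then show ?thesis using assms(1) by (simp add: dist_norm norm_minus_commute)
qed

lemma continuous_on_segment_average:
  fixes x0 :: "'a::euclidean_space" and g :: "'a \<Rightarrow> real"
  assumes "continuous_on (ball x0 R) g"
  shows "continuous_on (ball x0 R \<times> cbox 0 1) (\<lambda>(x, t). t ^ j * g (x0 + t *\<^sub>R (x - x0)))"
  unfolding split_beta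
  by (intro continuous_intros continuous_on_compose2[OF assms]) (auto intro: segment_in_ball)

text \<open>
  Differentiation under the integral sign brings out a factor \<open>t\<close> from the inner derivative; the weight
  \<open>t ^ j\<close> with arbitrary \<open>j\<close> makes the induction over \<open>k\<close> go through.
\<close>
lemma Ck_on_segment_average:
  fixes x0 :: "'a::euclidean_space" and g :: "'a \<Rightarrow> real"
  assumes "Ck_on k (ball x0 R) g"
  shows "Ck_on k (ball x0 R) (\<lambda>x. integral (cbox 0 1) (\<lambda>t. t ^ j * g (x0 + t *\<^sub>R (x - x0))))"
  using assms
proof (induction k arbitrary: g j)
  case 0
  then show ?case
    using integral_continuous_on_param[OF continuous_on_segment_average[of x0 R g j]] by simp
next
  case (Suc k)
  let ?B = "ball x0 R"
  let ?\<sigma> = "\<lambda>x t. x0 + t *\<^sub>R (x - x0)"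
  let ?g = "\<lambda>b x. frechet_derivative g (at x) b"
  note D = Ck_on_SucD[OF Suc.prems]
  have cont: "continuous_on ?B (?g b)" for b
    using D(2) by (rule Ck_on_continuous)
  have contg: "continuous_on ?B g"
    using Suc.prems by (rule Ck_on_continuous)
  have seg: "continuous_on (cbox 0 1) (\<lambda>t. t ^ i * f (?\<sigma> x t))"
    if "continuous_on ?B f" "x \<in> ?B" for f :: "'a \<Rightarrow> real" and x i
    using that by (intro continuous_intros continuous_on_compose2[OF that(1)]) (auto intro: segment_in_ball)
  define L where "L x t = (\<Sum>b\<in>Basis. (t ^ Suc j * ?g b (?\<sigma> x t)) *\<^sub>R blinfun_inner_left b)" for x t
  have "((\<lambda>x. integral (cbox 0 1) (\<lambda>t. t ^ j * g (?\<sigma> x t))) has_derivative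
      (\<lambda>v. \<Sum>b\<in>Basis. (v \<bullet> b) * integral (cbox 0 1) (\<lambda>t. t ^ Suc j * ?g b (?\<sigma> x t)))) (at x)"
    if x: "x \<in> ?B" for x
  proof -
    have "((\<lambda>x. integral (cbox 0 1) (\<lambda>t. t ^ j * g (?\<sigma> x t))) has_derivative
        blinfun_apply (integral (cbox 0 1) (L x))) (at x within ?B)"
    proof (rule leibniz_rule[OF _ _ _ x convex_ball])
      fix y t assume y: "y \<in> ?B" and t: "t \<in> cbox 0 (1::real)"
      then have s: "?\<sigma> y t \<in> ?B" by (intro segment_in_ball) auto
      have "((\<lambda>y. ?\<sigma> y t) has_derivative (\<lambda>v. t *\<^sub>R v)) (at y)"
        by (auto intro!: derivative_eq_intros)
      from has_derivative_compose[OF this D(1)[OF s]]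
      have "((\<lambda>y. t ^ j * g (?\<sigma> y t)) has_derivative
          (\<lambda>v. t ^ j * frechet_derivative g (at (?\<sigma> y t)) (t *\<^sub>R v))) (at y)"
        by (auto intro: derivative_eq_intros)
      moreover have "t ^ j * frechet_derivative g (at (?\<sigma> y t)) (t *\<^sub>R v) = blinfun_apply (L y t) v" for v
        using frechet_derivative_eq_sum[OF D(1)[OF s], of "t *\<^sub>R v"]
        by (simp add: L_def blinfun.sum_left blinfun.scaleR_left sum_distrib_left mult_ac)
      ultimately show "((\<lambda>y. t ^ j * g (?\<sigma> y t)) has_derivative blinfun_apply (L y t)) (at y within ?B)"
        by (simp add: has_derivative_at_withinI)
    next
      fix y assume "y \<in> ?B"
      then show "(\<lambda>t. t ^ j * g (?\<sigma> y t)) integrable_on cbox 0 1"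
        by (intro integrable_continuous seg contg)
    next
      show "continuous_on (?B \<times> cbox 0 1) (\<lambda>(x, t). L x t)"
        using continuous_on_segment_average[OF cont, of "Suc j"]
        unfolding L_def split_beta by (intro continuous_on_sum continuous_on_scaleR continuous_on_const)
    qed
    moreover have "blinfun_apply (integral (cbox 0 1) (L x)) v =
        (\<Sum>b\<in>Basis. (v \<bullet> b) * integral (cbox 0 1) (\<lambda>t. t ^ Suc j * ?g b (?\<sigma> x t)))" for v
    proof -
      have i: "(\<lambda>t. t ^ Suc j * ?g b (?\<sigma> x t)) integrable_on cbox 0 1" for b
        by (intro integrable_continuous seg cont x)
      have "L x integrable_on cbox 0 1"
        unfolding L_def by (intro integrable_continuous continuous_intros continuous_on_sum seg cont x)
      then have "blinfun_apply (integral (cbox 0 1) (L x)) v = integral (cbox 0 1) (\<lambda>t. blinfun_apply (L x t) v)"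
        using integral_linear[OF _ blinfun.bounded_linear_left[of v], of "L x" "cbox 0 1"]
        by (simp add: o_def)
      also have "\<dots> = integral (cbox 0 1) (\<lambda>t. \<Sum>b\<in>Basis. (t ^ Suc j * ?g b (?\<sigma> x t)) * (v \<bullet> b))"
        by (simp add: L_def blinfun.sum_left blinfun.scaleR_left)
      also have "\<dots> = (\<Sum>b\<in>Basis. integral (cbox 0 1) (\<lambda>t. (t ^ Suc j * ?g b (?\<sigma> x t)) * (v \<bullet> b)))"
        using i by (intro integral_sum integrable_on_mult_left) auto
      also have "\<dots> = (\<Sum>b\<in>Basis. (v \<bullet> b) * integral (cbox 0 1) (\<lambda>t. t ^ Suc j * ?g b (?\<sigma> x t)))"
        by (rule sum.cong[OF refl], subst integral_mult_left, rule mult.commute)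
      finally show ?thesis .
    qed
    then have "blinfun_apply (integral (cbox 0 1) (L x)) =
        (\<lambda>v. \<Sum>b\<in>Basis. (v \<bullet> b) * integral (cbox 0 1) (\<lambda>t. t ^ Suc j * ?g b (?\<sigma> x t)))"
      by (rule ext)
    ultimately show ?thesis
      unfolding at_within_open[OF x open_ball] by (simp only:)
  qed
  note deriv = this
  show ?case
  proof (rule Ck_on_SucI_open[OF open_ball])
    show "Ck_on k ?B (\<lambda>x. \<Sum>b\<in>Basis. (v \<bullet> b) * integral (cbox 0 1) (\<lambda>t. t ^ Suc j * ?g b (?\<sigma> x t)))" for v
      by (intro Ck_on_sum Ck_on_mult Ck_on_const Suc.IH D(2) open_ball)
  qed (rule deriv)
qed

text \<open>
  The fundamental theorem of calculus along the segment from \<open>x0\<close> to \<open>x\<close>; \<open>h b\<close> is the average over the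
  segment of the partial derivative in direction \<open>b\<close>.
\<close>
lemma Hadamard:
  fixes g :: "'a::euclidean_space \<Rightarrow> real"
  assumes g: "smooth_on (ball x0 R) g"
  obtains h where "\<And>b. smooth_on (ball x0 R) (h b)"
    "\<And>b. h b x0 = frechet_derivative g (at x0) b"
    "\<And>x. x \<in> ball x0 R \<Longrightarrow> g x = g x0 + (\<Sum>b\<in>Basis. ((x - x0) \<bullet> b) * h b x)"
proof
  let ?g = "\<lambda>b x. frechet_derivative g (at x) b"
  define h where "h b x = integral (cbox 0 1) (\<lambda>t. t ^ 0 * ?g b (x0 + t *\<^sub>R (x - x0)))" for b x
  show "smooth_on (ball x0 R) (h b)" for b
    using smooth_on_frechet_derivative[OF g, of b] Ck_on_segment_average[of _ x0 R "?g b" 0]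
    unfolding smooth_on_def h_def by blast
  show "h b x0 = ?g b x0" for b by (simp add: h_def)
  fix x assume x: "x \<in> ball x0 R"
  let ?\<sigma> = "\<lambda>t. x0 + t *\<^sub>R (x - x0)"
  have s: "?\<sigma> t \<in> ball x0 R" if "t \<in> {0..1}" for t using segment_in_ball[OF x that] .
  have cont: "continuous_on {0..1} (\<lambda>t. ?g b (?\<sigma> t))" for b
    using s by (intro continuous_on_compose2[OF smooth_on_continuous[OF smooth_on_frechet_derivative[OF g]]] continuous_intros) auto
  have "((\<lambda>t. frechet_derivative g (at (?\<sigma> t)) (x - x0)) has_integral (g (?\<sigma> 1) - g (?\<sigma> 0))) {0..1}"
  proof (rule fundamental_theorem_of_calculus)
    fix t :: real assume t: "t \<in> {0..1}"
    have d: "(?\<sigma> has_derivative (\<lambda>r. r *\<^sub>R (x - x0))) (at t within {0..1})"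
      by (auto intro!: derivative_eq_intros)
    have L: "bounded_linear (frechet_derivative g (at (?\<sigma> t)))"
      using smooth_on_has_derivative[OF g s[OF t]] has_derivative_bounded_linear by blast
    show "((\<lambda>t. g (?\<sigma> t)) has_vector_derivative frechet_derivative g (at (?\<sigma> t)) (x - x0)) (at t within {0..1})"
      using has_derivative_compose[OF d smooth_on_has_derivative[OF g s[OF t]]]
      by (simp add: has_vector_derivative_def linear_simps[OF L])
  qed simp
  then have "g x - g x0 = integral {0..1} (\<lambda>t. frechet_derivative g (at (?\<sigma> t)) (x - x0))"
    by (simp add: integral_unique)
  also have "\<dots> = integral {0..1} (\<lambda>t. \<Sum>b\<in>Basis. ((x - x0) \<bullet> b) * ?g b (?\<sigma> t))"
    by (intro integral_cong) (use frechet_derivative_eq_sum[OF smooth_on_has_derivative[OF g s]] in auto)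
  also have "\<dots> = (\<Sum>b\<in>Basis. integral {0..1} (\<lambda>t. ((x - x0) \<bullet> b) * ?g b (?\<sigma> t)))"
    by (intro integral_sum integrable_continuous_real continuous_intros cont) auto
  finally show "g x = g x0 + (\<Sum>b\<in>Basis. ((x - x0) \<bullet> b) * h b x)"
    by (simp add: h_def)
qed

section \<open>Smooth functions and tangent vectors on a manifold\<close>
lemma sum_fun_apply: "(\<Sum>i\<in>I. f i) x = (\<Sum>i\<in>I. f i x)"
  by (induction I rule: infinite_finite_induct) simp_all

locale manifold =
  fixes A :: "('a::{t2_space, second_countable_topology}, 'b::euclidean_space) atlas"
  assumes smooth_manifold: "smooth_manifold A"
begin

lemma chart:
  assumes "(U, c) \<in> A"
  shows "open U" "open (c ` U)" "homeomorphism U (c ` U) c (inv_into U c)" "inj_on c U"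
proof -
  show "open U" "open (c ` U)" and *: "homeomorphism U (c ` U) c (inv_into U c)"
    using smooth_manifold assms unfolding smooth_manifold_def by blast+
  then show "inj_on c U" by (metis homeomorphism_apply1 inj_on_inverseI)
qed

lemma chart_at: obtains U c where "(U, c) \<in> A" "p \<in> U"
  using smooth_manifold unfolding smooth_manifold_def by blast

lemma chart_transition:
  "(U, c) \<in> A \<Longrightarrow> (V, d) \<in> A \<Longrightarrow> smooth_on (c ` (U \<inter> V)) (d \<circ> inv_into U c)"
  using smooth_manifold unfolding smooth_manifold_def by fast

lemma chart_open_image:
  assumes "(U, c) \<in> A" "open W"
  shows "open (c ` (U \<inter> W))"
proof -
  have "openin (top_of_set (c ` U)) (c ` (U \<inter> W))"
    using homeomorphism_imp_open_map[OF chart(3)[OF assms(1)]] assms(2) by (simp add: openin_open_Int)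
  then show ?thesis using chart(2)[OF assms(1)] openin_open_eq by blast
qed

lemma smooth_funI:
  assumes "\<And>U c. (U, c) \<in> A \<Longrightarrow> smooth_on (c ` U) (\<lambda>x. f (inv_into U c x))"
  shows "smooth_fun A f"
proof -
  have "continuous_on UNIV f"
    unfolding continuous_on_eq_continuous_at[OF open_UNIV]
  proof
    fix p
    obtain U c where U: "(U, c) \<in> A" "p \<in> U" by (rule chart_at)
    have "continuous_on U (\<lambda>q. f (inv_into U c (c q)))"
      by (rule continuous_on_compose2[OF smooth_on_continuous[OF assms[OF U(1)]]])
        (use chart(3)[OF U(1)] in \<open>auto simp: homeomorphism_def\<close>)
    then have "continuous_on U f"
      by (rule continuous_on_eq) (simp add: chart(4)[OF U(1)])
    then show "isCont f p" using chart(1)[OF U(1)] U(2) continuous_on_eq_continuous_at by blast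
  qed
  then show ?thesis
    using assms by (auto simp: smooth_fun_def smooth_map_on_def std_atlas_def o_def)
qed

lemma smooth_funD:
  "smooth_fun A f \<Longrightarrow> (U, c) \<in> A \<Longrightarrow> smooth_on (c ` U) (\<lambda>x. f (inv_into U c x))"
  by (force simp: smooth_fun_def smooth_map_on_def std_atlas_def o_def)

lemma smooth_fun_const: "smooth_fun A (\<lambda>p. k)"
  by (rule smooth_funI, rule smooth_on_const)

lemma smooth_fun_add: "smooth_fun A f \<Longrightarrow> smooth_fun A g \<Longrightarrow> smooth_fun A (\<lambda>p. f p + g p)"
  by (rule smooth_funI, intro smooth_on_add chart(2) smooth_funD)

lemma smooth_fun_mult: "smooth_fun A f \<Longrightarrow> smooth_fun A g \<Longrightarrow> smooth_fun A (\<lambda>p. f p * g p)"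
  by (rule smooth_funI, intro smooth_on_mult chart(2) smooth_funD)

lemma smooth_fun_uminus: "smooth_fun A f \<Longrightarrow> smooth_fun A (\<lambda>p. - f p)"
  using smooth_fun_mult[OF smooth_fun_const[of "-1"], of f] by simp

lemma smooth_fun_diff: "smooth_fun A f \<Longrightarrow> smooth_fun A g \<Longrightarrow> smooth_fun A (\<lambda>p. f p - g p)"
  using smooth_fun_add[OF _ smooth_fun_uminus, of f g] by simp

lemma smooth_fun_sum: "(\<And>i. i \<in> I \<Longrightarrow> smooth_fun A (f i)) \<Longrightarrow> smooth_fun A (\<lambda>p. \<Sum>i\<in>I. f i p)"
  by (rule smooth_funI, intro smooth_on_sum chart(2) smooth_funD)

lemma smooth_fun_prod: "(\<And>i. i \<in> I \<Longrightarrow> smooth_fun A (f i)) \<Longrightarrow> smooth_fun A (\<lambda>p. \<Prod>i\<in>I. f i p)"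
  by (induction I rule: infinite_finite_induct) (auto intro: smooth_fun_const smooth_fun_mult)

lemmas smooth_fun_intros =
  smooth_fun_const smooth_fun_add smooth_fun_mult smooth_fun_uminus smooth_fun_diff smooth_fun_sum smooth_fun_prod

text \<open>
  Smoothness is local, and locally quotients with non-vanishing denominator are smooth. This form lets
  functions given by Cramer's rule in local frames be recognised as smooth while numerator and denominator
  are global smooth functions.
\<close>
lemma smooth_fun_local_quotient:
  assumes "\<And>p. \<exists>W N g. open W \<and> p \<in> W \<and> smooth_fun A N \<and> smooth_fun A g \<and>
    (\<forall>q\<in>W. g q \<noteq> 0 \<and> f q = N q / g q)"
  shows "smooth_fun A f"
proof (intro smooth_funI smooth_on_local)
  fix U c x assume U: "(U, c) \<in> A" and "x \<in> c ` U"
  then obtain p where p: "p \<in> U" "x = c p" by auto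
  obtain W N g where W: "open W" "p \<in> W" "smooth_fun A N" "smooth_fun A g"
    and q: "\<And>q. q \<in> W \<Longrightarrow> g q \<noteq> 0 \<and> f q = N q / g q"
    using assms by metis
  let ?T = "c ` (U \<inter> W)"
  have T: "open ?T" using chart_open_image[OF U W(1)] .
  have inv: "inv_into U c y \<in> W" if "y \<in> ?T" for y
    using that chart(4)[OF U] by auto
  have sm: "smooth_on ?T (\<lambda>x. h (inv_into U c x))" if "smooth_fun A h" for h
    using smooth_funD[OF that U] by (rule smooth_on_subset) auto
  have "smooth_on ?T (\<lambda>x. N (inv_into U c x) * inverse (g (inv_into U c x)))"
    using W q inv by (intro smooth_on_mult smooth_on_inverse T sm) auto
  then have "smooth_on ?T (\<lambda>x. f (inv_into U c x))"
    by (rule smooth_on_cong[OF T]) (use q inv in \<open>auto simp: divide_inverse\<close>)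
  then show "\<exists>T. open T \<and> x \<in> T \<and> smooth_on T (\<lambda>x. f (inv_into U c x))"
    using T p W(2) by blast
qed

text \<open>
  The function \<open>g\<close> on the model space, damped by a bump function around \<open>x0\<close> and read on the manifold.
  Only the values of \<open>g\<close> on the ball with radius \<open>r\<close> matter, so \<open>g\<close> may be smooth near \<open>x0\<close> only.
\<close>
definition cutoff :: "'a set \<Rightarrow> ('a \<Rightarrow> 'b) \<Rightarrow> 'b \<Rightarrow> real \<Rightarrow> ('b \<Rightarrow> real) \<Rightarrow> 'a \<Rightarrow> real" where
  "cutoff U c x0 r g p = (if p \<in> U then bump x0 r (c p) * g (c p) else 0)"

text \<open>
  At points outside the chart domain the function vanishes in a neighbourhood: the support is contained in
  the image of a compact ball, which is closed because the manifold is Hausdorff.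
\<close>
lemma smooth_fun_cutoff:
  assumes U: "(U, c) \<in> A" and r: "0 < r" "r < R" and R: "ball x0 R \<subseteq> c ` U"
    and g: "smooth_on (ball x0 R) g"
  shows "smooth_fun A (cutoff U c x0 r g)"
proof (intro smooth_funI smooth_on_local)
  have bg: "smooth_on UNIV (\<lambda>x. bump x0 r x * g x)"
  proof (rule smooth_on_local)
    fix x
    show "\<exists>T. open T \<and> x \<in> T \<and> smooth_on T (\<lambda>x. bump x0 r x * g x)"
    proof (cases "x \<in> ball x0 R")
      case True
      then show ?thesis
        by (intro exI[of _ "ball x0 R"] conjI open_ball smooth_on_mult g smooth_on_subset[OF smooth_on_bump]) auto
    next
      case False
      have "smooth_on (- cball x0 r) (\<lambda>x. bump x0 r x * g x)"
        by (rule smooth_on_cong[OF _ smooth_on_const[of _ 0]]) (auto simp: bump_outside r(1))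
      then show ?thesis using False r by (intro exI[of _ "- cball x0 r"]) auto
    qed
  qed
  fix V d y assume V: "(V, d) \<in> A" and "y \<in> d ` V"
  then obtain q where q: "q \<in> V" "y = d q" by auto
  have inv: "inv_into V d z = p" if "z = d p" "p \<in> V" for z p
    using that chart(4)[OF V] by simp
  show "\<exists>T. open T \<and> y \<in> T \<and> smooth_on T (\<lambda>x. cutoff U c x0 r g (inv_into V d x))"
  proof (cases "q \<in> U")
    case True
    let ?T = "d ` (V \<inter> U)"
    have T: "open ?T" using chart_open_image[OF V chart(1)[OF U]] .
    have "smooth_on ?T (\<lambda>x. (\<lambda>x. bump x0 r x * g x) ((c \<circ> inv_into V d) x))"
      by (rule smooth_on_compose[OF T open_UNIV bg chart_transition[OF V U]]) auto
    then have "smooth_on ?T (\<lambda>x. cutoff U c x0 r g (inv_into V d x))"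
      by (rule smooth_on_cong[OF T]) (auto simp: inv cutoff_def)
    then show ?thesis using T q True by blast
  next
    case False
    let ?K = "inv_into U c ` cball x0 r"
    have cb: "cball x0 r \<subseteq> c ` U" using R r by auto
    have "continuous_on (cball x0 r) (inv_into U c)"
      using chart(3)[OF U] cb by (meson continuous_on_subset homeomorphism_cont2)
    then have "compact ?K" by (rule compact_continuous_image) simp
    then have K: "open (- ?K)" by (simp add: compact_imp_closed open_Compl)
    let ?T = "d ` (V \<inter> - ?K)"
    have T: "open ?T" using chart_open_image[OF V K] .
    have "?K \<subseteq> U" using cb inv_into_into[of _ c U] by blast
    then have "q \<notin> ?K" using False by blast
    moreover have "cutoff U c x0 r g p = 0" if "p \<notin> ?K" for p
    proof (cases "p \<in> U")
      case True
      then have "c p \<notin> cball x0 r" using that inv_into_f_f[OF chart(4)[OF U] True] by (metis imageI)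
      then show ?thesis using r by (simp add: cutoff_def bump_outside)
    qed (simp add: cutoff_def)
    then have "smooth_on ?T (\<lambda>x. cutoff U c x0 r g (inv_into V d x))"
      by (intro smooth_on_cong[OF T smooth_on_const[of _ 0]]) (auto simp: inv)
    ultimately show ?thesis using T q by blast
  qed
qed

lemma chart_ball:
  assumes "(U, c) \<in> A" "p \<in> U" "open W" "p \<in> W"
  obtains R where "0 < R" "ball (c p) R \<subseteq> c ` (U \<inter> W)"
proof -
  have "c p \<in> c ` (U \<inter> W)" using assms(2,4) by blast
  then show thesis
    using chart_open_image[OF assms(1,3)] that by (force elim: openE)
qed

lemma tangent_nonsmooth: "v \<in> tangent_space A p \<Longrightarrow> \<not> smooth_fun A f \<Longrightarrow> v f = 0"
  by (simp add: tangent_space_def)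

lemma tangent_add:
  "v \<in> tangent_space A p \<Longrightarrow> smooth_fun A f \<Longrightarrow> smooth_fun A g \<Longrightarrow> v (\<lambda>x. f x + g x) = v f + v g"
  by (simp add: tangent_space_def plus_fun_def)

lemma tangent_mult:
  "v \<in> tangent_space A p \<Longrightarrow> smooth_fun A f \<Longrightarrow> smooth_fun A g \<Longrightarrow>
    v (\<lambda>x. f x * g x) = f p * v g + g p * v f"
  by (simp add: tangent_space_def times_fun_def)

lemma tangent_cmult: "v \<in> tangent_space A p \<Longrightarrow> smooth_fun A f \<Longrightarrow> v (\<lambda>x. k * f x) = k * v f"
  by (simp add: tangent_space_def)

lemma tangent_const: "v \<in> tangent_space A p \<Longrightarrow> v (\<lambda>x. k) = 0"
  using tangent_mult[OF _ smooth_fun_const smooth_fun_const, of v p 1 1]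
    tangent_cmult[OF _ smooth_fun_const, of v p k 1] by simp

lemma tangent_diff:
  "v \<in> tangent_space A p \<Longrightarrow> smooth_fun A f \<Longrightarrow> smooth_fun A g \<Longrightarrow> v (\<lambda>x. f x - g x) = v f - v g"
  using tangent_add[OF _ _ smooth_fun_uminus, of v p f g] tangent_cmult[of v p g "-1"] by simp

lemma tangent_sum:
  assumes "v \<in> tangent_space A p" "\<And>i. i \<in> I \<Longrightarrow> smooth_fun A (f i)"
  shows "v (\<lambda>x. \<Sum>i\<in>I. f i x) = (\<Sum>i\<in>I. v (f i))"
  using assms(2)
  by (induction I rule: infinite_finite_induct)
    (auto simp: tangent_const[OF assms(1)] tangent_add[OF assms(1) _ smooth_fun_sum])

lemma tangent_space_zero: "0 \<in> tangent_space A p"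
  by (simp add: tangent_space_def)

lemma tangent_space_add:
  "v \<in> tangent_space A p \<Longrightarrow> w \<in> tangent_space A p \<Longrightarrow> v + w \<in> tangent_space A p"
  by (simp add: tangent_space_def algebra_simps)

lemma tangent_space_scale: "v \<in> tangent_space A p \<Longrightarrow> k *\<^sub>T v \<in> tangent_space A p"
  by (simp add: tangent_space_def tscale_def algebra_simps)

lemma tangent_space_sum:
  "(\<And>i. i \<in> I \<Longrightarrow> v i \<in> tangent_space A p) \<Longrightarrow> (\<Sum>i\<in>I. v i) \<in> tangent_space A p"
  by (induction I rule: infinite_finite_induct) (auto intro: tangent_space_zero tangent_space_add)

lemma tangent_space_diff:
  assumes "v \<in> tangent_space A p" "w \<in> tangent_space A p"
  shows "v - w \<in> tangent_space A p"
proof -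
  have "v - w = v + (- 1) *\<^sub>T w" by (simp add: tscale_def fun_eq_iff)
  then show ?thesis using assms tangent_space_add tangent_space_scale by metis
qed

text \<open>
  Hadamard's lemma gives \<open>f - f(p) = \<Sum>\<^sub>b (x\<^sub>b - x\<^sub>b(p)) h\<^sub>b\<close> near \<open>p\<close>. Multiplied by the square of a cutoff
  \<open>\<rho>\<close>, one factor for the coordinates and one for the \<open>h\<^sub>b\<close>, this becomes an identity between globally
  defined smooth functions, to which the derivation \<open>v\<close> can be applied.
\<close>
lemma tangent_chart:
  assumes U: "(U, c) \<in> A" "p \<in> U" and v: "v \<in> tangent_space A p"
  obtains w where "\<And>f. smooth_fun A f \<Longrightarrow> v f = frechet_derivative (\<lambda>x. f (inv_into U c x)) (at (c p)) w"
proof -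
  obtain R where R: "0 < R" "ball (c p) R \<subseteq> c ` U" using chart_ball[OF U open_UNIV] by auto
  let ?C = "cutoff U c (c p) (R / 2)"
  have sm: "smooth_fun A (?C g)" if "smooth_on (ball (c p) R) g" for g
    using R that by (intro smooth_fun_cutoff[OF U(1), of _ R]) auto
  define y where "y b = ?C (\<lambda>x. (x + - c p) \<bullet> b)" for b
  have y: "smooth_fun A (y b)" for b
    unfolding y_def by (intro sm smooth_on_inner smooth_on_add smooth_on_id smooth_on_const) auto
  let ?w = "\<Sum>b\<in>Basis. v (y b) *\<^sub>R b"
  have "v f = frechet_derivative (\<lambda>x. f (inv_into U c x)) (at (c p)) ?w" if f: "smooth_fun A f" for f
  proof -
    let ?f = "\<lambda>x. f (inv_into U c x)"
    have inv: "inv_into U c (c q) = q" if "q \<in> U" for q using that chart(4)[OF U(1)] by simp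
    have fs: "smooth_on (c ` U) ?f" using smooth_funD[OF f U(1)] .
    obtain h where h: "\<And>b. smooth_on (ball (c p) R) (h b)"
      "\<And>b. h b (c p) = frechet_derivative ?f (at (c p)) b"
      "\<And>x. x \<in> ball (c p) R \<Longrightarrow> ?f x = ?f (c p) + (\<Sum>b\<in>Basis. ((x - c p) \<bullet> b) * h b x)"
      by (rule Hadamard[OF smooth_on_subset[OF fs R(2)]]) (rule that, assumption+)
    define \<rho> where "\<rho> = ?C (\<lambda>x. 1)"
    have \<rho>: "smooth_fun A \<rho>" unfolding \<rho>_def by (intro sm smooth_on_const)
    \<comment> \<open>Hadamard's formula on the ball; both sides vanish elsewhere.\<close>
    have "\<rho> q * \<rho> q * (f q - f p) = (\<Sum>b\<in>Basis. y b q * ?C (h b) q)" for q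
    proof (cases "q \<in> U \<and> c q \<in> ball (c p) R")
      case True
      then have "f q - f p = (\<Sum>b\<in>Basis. ((c q - c p) \<bullet> b) * h b (c q))"
        using h(3)[of "c q"] inv U(2) by simp
      then show ?thesis
        using True by (simp add: \<rho>_def y_def cutoff_def sum_distrib_left mult_ac)
    next
      case False
      then have "\<rho> q = 0" "y b q = 0" for b
        using R by (auto simp: \<rho>_def y_def cutoff_def intro!: bump_outside)
      then show ?thesis by simp
    qed
    then have "v (\<lambda>q. \<rho> q * \<rho> q * (f q - f p)) = v (\<lambda>q. \<Sum>b\<in>Basis. y b q * ?C (h b) q)" by presburger
    moreover have "v (\<lambda>q. \<rho> q * \<rho> q * (f q - f p)) = v f"
    proof -
      have "\<rho> p = 1" using R U by (simp add: \<rho>_def cutoff_def)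
      then show ?thesis
        using tangent_mult[OF v, of "\<lambda>q. \<rho> q * \<rho> q" "\<lambda>q. f q - f p"]
          tangent_diff[OF v f smooth_fun_const, of "f p"] tangent_const[OF v, of "f p"] f \<rho>
        by (simp add: smooth_fun_intros)
    qed
    moreover have "v (\<lambda>q. \<Sum>b\<in>Basis. y b q * ?C (h b) q) = (\<Sum>b\<in>Basis. v (y b) * h b (c p))"
    proof -
      have "v (\<lambda>q. y b q * ?C (h b) q) = v (y b) * h b (c p)" for b
        using tangent_mult[OF v y sm[OF h(1)], of b b] U R by (simp add: y_def cutoff_def)
      then show ?thesis using tangent_sum[OF v, of Basis "\<lambda>b q. y b q * ?C (h b) q"] smooth_fun_mult[OF y sm[OF h(1)]] by simp
    qed
    ultimately have "v f = (\<Sum>b\<in>Basis. v (y b) * h b (c p))" by simp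
    also have "\<dots> = frechet_derivative ?f (at (c p)) ?w"
      using frechet_derivative_eq_sum[OF smooth_on_has_derivative[OF fs, of "c p"], of ?w] U R(1) h(2)
      by simp
    finally show "v f = frechet_derivative ?f (at (c p)) ?w" .
  qed
  then show thesis by (rule that)
qed

section \<open>Vector fields and tensoriality\<close>
lemma vector_field_tangent: "vector_field A X \<Longrightarrow> X p \<in> tangent_space A p"
  by (simp add: vector_field_def)

lemma vector_field_smooth: "vector_field A X \<Longrightarrow> smooth_fun A (\<lambda>p. X p f)"
  by (cases "smooth_fun A f") (auto simp: vector_field_def tangent_space_def smooth_fun_const)

lemma vector_fieldI:
  "(\<And>p. X p \<in> tangent_space A p) \<Longrightarrow> (\<And>f. smooth_fun A f \<Longrightarrow> smooth_fun A (\<lambda>p. X p f)) \<Longrightarrow> vector_field A X"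
  by (simp add: vector_field_def)

lemma vector_field_zero: "vector_field A 0"
  by (simp add: vector_field_def tangent_space_zero smooth_fun_const)

lemma vector_field_add: "vector_field A X \<Longrightarrow> vector_field A Y \<Longrightarrow> vector_field A (X + Y)"
  by (simp add: vector_field_def tangent_space_add smooth_fun_add)

lemma vector_field_diff: "vector_field A X \<Longrightarrow> vector_field A Y \<Longrightarrow> vector_field A (X - Y)"
  by (simp add: vector_field_def tangent_space_diff smooth_fun_diff)

lemma vector_field_fmult: "smooth_fun A f \<Longrightarrow> vector_field A X \<Longrightarrow> vector_field A (fmult f X)"
  by (simp add: vector_field_def fmult_def tangent_space_scale) (simp add: tscale_def smooth_fun_mult)

lemma vector_field_sum: "(\<And>i. i \<in> I \<Longrightarrow> vector_field A (X i)) \<Longrightarrow> vector_field A (\<Sum>i\<in>I. X i)"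
  by (induction I rule: infinite_finite_induct) (auto intro: vector_field_zero vector_field_add)

lemma vector_field_lie_bracket:
  assumes X: "vector_field A X" and Y: "vector_field A Y"
  shows "vector_field A (lie_bracket X Y)"
proof (rule vector_fieldI)
  note sX = vector_field_smooth[OF X] and sY = vector_field_smooth[OF Y]
  show "smooth_fun A (\<lambda>p. lie_bracket X Y p f)" for f
    by (simp add: lie_bracket_def smooth_fun_diff sX sY)
  fix p
  note tX = vector_field_tangent[OF X] and tY = vector_field_tangent[OF Y]
  have "lie_bracket X Y p f = 0" if "\<not> smooth_fun A f" for f
    using tangent_nonsmooth[OF tX that] tangent_nonsmooth[OF tY that] tangent_const[OF tX] tangent_const[OF tY]
    by (simp add: lie_bracket_def)
  moreover have "lie_bracket X Y p (f + g) = lie_bracket X Y p f + lie_bracket X Y p g"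
    if "smooth_fun A f" "smooth_fun A g" for f g
    using tangent_add[OF tX that] tangent_add[OF tY that] tangent_add[OF tX sY sY] tangent_add[OF tY sX sX]
    by (simp add: lie_bracket_def plus_fun_def)
  moreover have "lie_bracket X Y p (f * g) = f p * lie_bracket X Y p g + g p * lie_bracket X Y p f"
    if f: "smooth_fun A f" and g: "smooth_fun A g" for f g
    using that
    by (simp add: lie_bracket_def times_fun_def tangent_mult[OF tX] tangent_mult[OF tY]
        tangent_add[OF tX] tangent_add[OF tY] smooth_fun_intros sX sY algebra_simps)
  moreover have "lie_bracket X Y p (\<lambda>x. k * f x) = k * lie_bracket X Y p f"
    if "smooth_fun A f" for f k
    using that by (simp add: lie_bracket_def tangent_cmult[OF tX] tangent_cmult[OF tY] sX sY algebra_simps)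
  ultimately show "lie_bracket X Y p \<in> tangent_space A p"
    unfolding tangent_space_def by blast
qed

text \<open>
  The constant field \<open>w\<close> of the chart, damped by a bump function. The case distinction on \<open>f\<close> reflects that
  tangent vectors are 0 on functions that are not smooth.
\<close>
definition coord_field :: "'a set \<Rightarrow> ('a \<Rightarrow> 'b) \<Rightarrow> 'b \<Rightarrow> real \<Rightarrow> 'b \<Rightarrow> 'a vfield" where
  "coord_field U c x0 r w = (\<lambda>p f. if smooth_fun A f
     then cutoff U c x0 r (\<lambda>x. frechet_derivative (\<lambda>x. f (inv_into U c x)) (at x) w) p else 0)"

lemma vector_field_coord_field:
  assumes U: "(U, c) \<in> A" and r: "0 < r" "r < R" and R: "ball x0 R \<subseteq> c ` U"
  shows "vector_field A (coord_field U c x0 r w)"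
proof (rule vector_fieldI)
  let ?X = "coord_field U c x0 r w"
  show "smooth_fun A (\<lambda>p. ?X p f)" if "smooth_fun A f" for f
    using that smooth_fun_cutoff[OF assms smooth_on_frechet_derivative[OF smooth_on_subset[OF smooth_funD[OF that U] R]]]
    by (simp add: coord_field_def)
  fix p
  show "?X p \<in> tangent_space A p"
  proof (cases "p \<in> U")
    case False
    then show ?thesis
      by (simp add: tangent_space_def coord_field_def cutoff_def)
  next
    case True
    let ?d = "\<lambda>f. frechet_derivative (\<lambda>x. f (inv_into U c x)) (at (c p))"
    have X: "?X p f = (if smooth_fun A f then bump x0 r (c p) * ?d f w else 0)" for f
      using True by (simp add: coord_field_def cutoff_def)
    have d: "((\<lambda>x. f (inv_into U c x)) has_derivative ?d f) (at (c p))" if "smooth_fun A f" for f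
      using smooth_on_has_derivative[OF smooth_funD[OF that U]] True by simp
    have inv: "inv_into U c (c p) = p" using True chart(4)[OF U] by simp
    have "?d (f + g) w = ?d f w + ?d g w" "?d (f * g) w = f p * ?d g w + g p * ?d f w"
      if "smooth_fun A f" "smooth_fun A g" for f g
      using frechet_derivative_at[OF has_derivative_add[OF d[OF that(1)] d[OF that(2)]]]
        frechet_derivative_at[OF has_derivative_mult[OF d[OF that(1)] d[OF that(2)]]]
      by (auto simp: plus_fun_def times_fun_def inv fun_eq_iff algebra_simps dest: spec[of _ w])
    moreover have "?d (\<lambda>x. k * f x) w = k * ?d f w" if "smooth_fun A f" for f k
      using frechet_derivative_at[OF has_derivative_mult_right[OF d[OF that], of k]]
      by (auto simp: fun_eq_iff dest: spec[of _ w])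
    moreover have "smooth_fun A (f + g)" "smooth_fun A (f * g)" "smooth_fun A (\<lambda>x. k * f x)"
      if "smooth_fun A f" "smooth_fun A g" for f g k
      using that by (auto simp: plus_fun_def times_fun_def intro: smooth_fun_intros)
    ultimately show ?thesis
      unfolding tangent_space_def X by (auto simp: algebra_simps)
  qed
qed

lemma vector_field_through:
  assumes "v \<in> tangent_space A p"
  shows "\<exists>X. vector_field A X \<and> X p = v"
proof -
  obtain U c where U: "(U, c) \<in> A" "p \<in> U" by (rule chart_at)
  obtain R where R: "0 < R" "ball (c p) R \<subseteq> c ` U" using chart_ball[OF U open_UNIV] by auto
  obtain w where w: "\<And>f. smooth_fun A f \<Longrightarrow> v f = frechet_derivative (\<lambda>x. f (inv_into U c x)) (at (c p)) w"
    by (rule tangent_chart[OF U assms]) blast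
  have "vector_field A (coord_field U c (c p) (R / 2) w)"
    using R by (intro vector_field_coord_field[OF U(1), of _ R]) auto
  moreover have "coord_field U c (c p) (R / 2) w p = v"
    using U R w tangent_nonsmooth[OF assms] by (auto simp: coord_field_def cutoff_def)
  ultimately show ?thesis by blast
qed

lemma extension: "v \<in> tangent_space A p \<Longrightarrow> vector_field A (extension A p v) \<and> extension A p v p = v"
  unfolding extension_def using vector_field_through by (rule someI_ex)

text \<open>
  A vector field is a linear combination of coordinate fields near \<open>p\<close>; after multiplication with a cutoff
  the identity holds globally. The coefficient \<open>X(x\<^sub>b)\<close> involves the coordinate \<open>x\<^sub>b\<close>, which is not a global
  function. It is recovered from the smooth functions \<open>\<rho>\<close> and \<open>y\<^sub>b = \<rho> x\<^sub>b\<close> by the quotient rule: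
  \<open>\<rho> X(y\<^sub>b) - y\<^sub>b X(\<rho>) = \<rho>\<^sup>2 X(x\<^sub>b)\<close>. With the factor \<open>\<rho>\<close> of the coordinate fields this makes \<open>\<rho>\<^sup>3\<close> the cutoff.
\<close>
lemma vector_field_expansion:
  obtains \<rho> E where "smooth_fun A \<rho>" "\<rho> p = 1" "\<And>b. vector_field A (E b)"
    "\<And>X. vector_field A X \<Longrightarrow> \<exists>F. (\<forall>b. smooth_fun A (F b) \<and> (X p = 0 \<longrightarrow> F b p = 0)) \<and>
       fmult \<rho> X = (\<Sum>b\<in>(Basis :: 'b set). fmult (F b) (E b))"
proof -
  obtain U c where U: "(U, c) \<in> A" "p \<in> U" by (rule chart_at)
  obtain R where R: "0 < R" "ball (c p) R \<subseteq> c ` U" using chart_ball[OF U open_UNIV] by auto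
  let ?C = "cutoff U c (c p) (R / 2)"
  have sm: "smooth_fun A (?C g)" if "smooth_on (ball (c p) R) g" for g
    using R that by (intro smooth_fun_cutoff[OF U(1), of _ R]) auto
  define \<rho> where "\<rho> = ?C (\<lambda>x. 1)"
  define y where "y b = ?C (\<lambda>x. x \<bullet> b)" for b
  define E where "E = coord_field U c (c p) (R / 2)"
  have \<rho>: "smooth_fun A \<rho>" and y: "smooth_fun A (y b)" for b
    unfolding \<rho>_def y_def by (intro sm smooth_on_const smooth_on_inner smooth_on_id open_ball)+
  show thesis
  proof
    show "smooth_fun A (\<lambda>q. \<rho> q * \<rho> q * \<rho> q)" by (intro smooth_fun_mult \<rho>)
    show "\<rho> p * \<rho> p * \<rho> p = 1" using U R by (simp add: \<rho>_def cutoff_def)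
    show "vector_field A (E b)" for b
      unfolding E_def using R by (intro vector_field_coord_field[OF U(1), of _ R]) auto
    fix X assume X: "vector_field A X"
    define F where "F b q = \<rho> q * X q (y b) - y b q * X q \<rho>" for b q
    have "smooth_fun A (F b)" for b
      unfolding F_def by (intro smooth_fun_intros \<rho> y vector_field_smooth[OF X])
    moreover have "X p = 0 \<longrightarrow> F b p = 0" for b by (simp add: F_def)
    moreover have "fmult (\<lambda>q. \<rho> q * \<rho> q * \<rho> q) X = (\<Sum>b\<in>Basis. fmult (F b) (E b))"
    proof (intro ext)
      fix q f
      have sum: "(\<Sum>b\<in>Basis. fmult (F b) (E b)) q f = (\<Sum>b\<in>Basis. F b q * E b q f)"
        by (simp add: sum_fun_apply fmult_def tscale_def)
      show "fmult (\<lambda>q. \<rho> q * \<rho> q * \<rho> q) X q f = (\<Sum>b\<in>Basis. fmult (F b) (E b)) q f"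
      proof (cases "q \<in> U \<and> smooth_fun A f")
        case False
        then have "\<rho> q * X q f = 0" "E b q f = 0" for b
          using tangent_nonsmooth[OF vector_field_tangent[OF X]]
          by (auto simp: \<rho>_def E_def coord_field_def cutoff_def)
        then show ?thesis unfolding sum by (simp add: fmult_def tscale_def)
      next
        case True
        then have q: "q \<in> U" and f: "smooth_fun A f" by auto
        let ?d = "\<lambda>f. frechet_derivative (\<lambda>x. f (inv_into U c x)) (at (c q))"
        obtain w where w: "\<And>f. smooth_fun A f \<Longrightarrow> X q f = ?d f w"
          by (rule tangent_chart[OF U(1) q vector_field_tangent[OF X]]) blast
        define \<beta> where "\<beta> = bump (c p) (R / 2)"
        let ?\<beta>' = "frechet_derivative \<beta> (at (c q))"
        have \<beta>: "(\<beta> has_derivative ?\<beta>') (at (c q))"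
          unfolding \<beta>_def by (rule smooth_on_has_derivative[OF smooth_on_bump]) simp
        \<comment> \<open>In the chart, a cutoff function is the product with the bump function.\<close>
        have "((\<lambda>x. ?C g (inv_into U c x)) has_derivative f') (at (c q))"
          if "((\<lambda>x. \<beta> x * g x) has_derivative f') (at (c q))" for g f'
        proof (rule has_derivative_transform_within_open[OF that chart(2)[OF U(1)]])
          show "c q \<in> c ` U" using q by simp
          fix x assume "x \<in> c ` U"
          then show "\<beta> x * g x = ?C g (inv_into U c x)"
            using chart(4)[OF U(1)] by (auto simp: cutoff_def \<beta>_def)
        qed
        note * = this[THEN frechet_derivative_at, THEN fun_cong, of _ _ w, symmetric]
        have "X q \<rho> = ?\<beta>' w"
          using w[OF \<rho>] * [of "\<lambda>x. 1", simplified, OF \<beta>] by (simp add: \<rho>_def)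
        moreover have "X q (y b) = \<beta> (c q) * (w \<bullet> b) + (c q \<bullet> b) * ?\<beta>' w" for b
          using w[OF y, of b] * [OF has_derivative_mult[OF \<beta> has_derivative_inner_left[OF has_derivative_ident, of b]]]
          by (simp add: y_def)
        moreover have "\<rho> q = \<beta> (c q)" "y b q = \<beta> (c q) * (c q \<bullet> b)" for b
          using q by (simp_all add: \<rho>_def y_def cutoff_def \<beta>_def)
        ultimately have F: "F b q = \<rho> q * \<rho> q * (w \<bullet> b)" for b
          by (simp add: F_def algebra_simps)
        have E: "E b q f = \<rho> q * ?d f b" for b
          using q f by (simp add: E_def \<rho>_def coord_field_def cutoff_def)
        have "?d f w = (\<Sum>b\<in>Basis. (w \<bullet> b) * ?d f b)"
          using frechet_derivative_eq_sum[OF smooth_on_has_derivative[OF smooth_funD[OF f U(1)]], of "c q" w] q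
          by simp
        then show ?thesis
          unfolding sum F E by (simp add: fmult_def tscale_def w[OF f] sum_distrib_left mult_ac)
      qed
    qed
    ultimately show "\<exists>F. (\<forall>b. smooth_fun A (F b) \<and> (X p = 0 \<longrightarrow> F b p = 0)) \<and>
       fmult (\<lambda>q. \<rho> q * \<rho> q * \<rho> q) X = (\<Sum>b\<in>(Basis :: 'b set). fmult (F b) (E b))"
      by blast
  qed
qed

text \<open>
  If \<open>X - Y\<close> vanishes at \<open>p\<close>, the expansion writes \<open>\<rho> (X - Y)\<close> as a combination of fields whose coefficients
  vanish at \<open>p\<close>, and \<open>\<rho>(p) = 1\<close>.
\<close>
lemma tensorial_pointwise:
  fixes T :: "'a vfield \<Rightarrow> real"
  assumes add: "\<And>X Y. vector_field A X \<Longrightarrow> vector_field A Y \<Longrightarrow> T (X + Y) = T X + T Y"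
    and mult: "\<And>f X. smooth_fun A f \<Longrightarrow> vector_field A X \<Longrightarrow> T (fmult f X) = f p * T X"
    and X: "vector_field A X" and Y: "vector_field A Y" and eq: "X p = Y p"
  shows "T X = T Y"
proof -
  have T0: "T 0 = 0"
    using mult[OF smooth_fun_const[of 0] vector_field_zero] by (simp add: fmult_def tscale_def zero_fun_def)
  define Z where "Z = X + fmult (\<lambda>_. - 1) Y"
  have Z: "vector_field A Z" "Z p = 0"
  proof -
    show "vector_field A Z"
      unfolding Z_def by (intro vector_field_add vector_field_fmult smooth_fun_const X Y)
    show "Z p = 0" unfolding Z_def using eq by (simp add: fmult_def tscale_def fun_eq_iff)
  qed
  obtain \<rho> E where \<rho>: "smooth_fun A \<rho>" "\<rho> p = 1" and E: "\<And>b. vector_field A (E b)"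
    and ex: "\<And>X. vector_field A X \<Longrightarrow> \<exists>F. (\<forall>b. smooth_fun A (F b) \<and> (X p = 0 \<longrightarrow> F b p = 0)) \<and>
       fmult \<rho> X = (\<Sum>b\<in>(Basis :: 'b set). fmult (F b) (E b))"
    by (rule vector_field_expansion[of p]) (rule that, assumption+)
  from ex[OF Z(1)] obtain F
    where "(\<forall>b. smooth_fun A (F b) \<and> (Z p = 0 \<longrightarrow> F b p = 0)) \<and>
       fmult \<rho> Z = (\<Sum>b\<in>(Basis :: 'b set). fmult (F b) (E b))" ..
  then have F: "smooth_fun A (F b)" "F b p = 0"
    "fmult \<rho> Z = (\<Sum>b\<in>(Basis :: 'b set). fmult (F b) (E b))" for b
    using Z(2) by simp_all
  have "T (\<Sum>b\<in>I. fmult (F b) (E b)) = 0" if "finite I" for I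
    using that
  proof (induction I rule: finite_induct)
    case empty
    show ?case using T0 by (simp only: sum.empty)
  next
    case (insert b I)
    have "vector_field A (fmult (F b) (E b))" "vector_field A (\<Sum>b\<in>I. fmult (F b) (E b))"
      by (intro vector_field_sum vector_field_fmult F E)+
    then have "T (\<Sum>b\<in>insert b I. fmult (F b) (E b)) =
        T (fmult (F b) (E b)) + T (\<Sum>b\<in>I. fmult (F b) (E b))"
      by (subst sum.insert[OF insert.hyps]) (rule add)
    also have "\<dots> = 0"
      using insert.IH mult[OF F(1) E, of b b] F(2)[of b] by simp
    finally show ?case .
  qed
  then have "T (fmult \<rho> Z) = 0" using F(3) by simp
  then have "T Z = 0" using mult[OF \<rho>(1) Z(1)] \<rho>(2) by simp
  then show ?thesis
    unfolding Z_def add[OF X vector_field_fmult[OF smooth_fun_const Y]] mult[OF smooth_fun_const Y] by simp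
qed

end

section \<open>Metric connections and their curvature\<close>
lemma fmult_apply: "fmult f X u = f u *\<^sub>T X u"
  by (simp add: fmult_def)

lemma tscale_apply: "(c *\<^sub>T v) f = c * v f"
  by (simp add: tscale_def)

context manifold
begin

lemma lie_bracket_fmult_left:
  assumes f: "smooth_fun A f" and X: "vector_field A X" and Y: "vector_field A Y"
  shows "lie_bracket (fmult f X) Y = fmult f (lie_bracket X Y) + fmult (\<lambda>u. - Y u f) X"
proof (intro ext)
  fix u g
  show "lie_bracket (fmult f X) Y u g = (fmult f (lie_bracket X Y) + fmult (\<lambda>u. - Y u f) X) u g"
    using tangent_mult[OF vector_field_tangent[OF Y] f vector_field_smooth[OF X]]
    by (simp add: lie_bracket_def fmult_def tscale_def algebra_simps)
qed

lemma lie_bracket_add_left: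
  assumes X: "vector_field A X" and Y: "vector_field A Y" and Z: "vector_field A Z"
  shows "lie_bracket (X + Y) Z = lie_bracket X Z + lie_bracket Y Z"
proof (intro ext)
  fix u g
  show "lie_bracket (X + Y) Z u g = (lie_bracket X Z + lie_bracket Y Z) u g"
    using tangent_add[OF vector_field_tangent[OF Z] vector_field_smooth[OF X] vector_field_smooth[OF Y]]
    by (simp add: lie_bracket_def algebra_simps)
qed

end

lemma lie_bracket_swap: "lie_bracket Y X = (\<lambda>u f. - lie_bracket X Y u f)"
  by (simp add: lie_bracket_def fun_eq_iff)

lemma fmult_minus_one: "fmult (\<lambda>_. - 1) X = (\<lambda>u f. - X u f)"
  by (simp add: fmult_def tscale_def)

lemma curvature_apply:
  "curvature D X Y Z u = D X (D Y Z) u - D Y (D X Z) u - D (lie_bracket X Y) Z u"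
  by (simp add: curvature_def)

locale symmetric_tensor = manifold A
  for A :: "('a::{t2_space, second_countable_topology}, 'b::euclidean_space) atlas" +
  fixes G :: "'a \<Rightarrow> 'a tvec \<Rightarrow> 'a tvec \<Rightarrow> real"
  assumes tensor_02: "tensor_02 A G"
    and G_sym: "\<And>u a b. a \<in> tangent_space A u \<Longrightarrow> b \<in> tangent_space A u \<Longrightarrow> G u a b = G u b a"
begin
lemma G_add:
  assumes "a \<in> tangent_space A u" "b \<in> tangent_space A u" "c \<in> tangent_space A u"
  shows "G u (a + c) b = G u a b + G u c b" "G u a (b + c) = G u a b + G u a c"
  using tensor_02 assms unfolding tensor_02_def by blast+

lemma G_scale:
  assumes "a \<in> tangent_space A u" "b \<in> tangent_space A u"
  shows "G u (r *\<^sub>T a) b = r * G u a b" "G u a (r *\<^sub>T b) = r * G u a b"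
  using tensor_02 assms unfolding tensor_02_def by blast+

lemma G_diff:
  assumes "a \<in> tangent_space A u" "b \<in> tangent_space A u" "c \<in> tangent_space A u"
  shows "G u (a - c) b = G u a b - G u c b" "G u a (b - c) = G u a b - G u a c"
proof -
  have *: "x - c = x + (- 1) *\<^sub>T c" for x by (simp add: tscale_def fun_eq_iff)
  show "G u (a - c) b = G u a b - G u c b" "G u a (b - c) = G u a b - G u a c"
    unfolding * using assms by (simp_all add: G_add G_scale tangent_space_scale del: plus_fun_apply)
qed

lemma G_zero:
  assumes "a \<in> tangent_space A u"
  shows "G u 0 a = 0" "G u a 0 = 0"
  using G_diff[OF assms assms assms] by simp_all

lemma smooth_fun_G: "vector_field A X \<Longrightarrow> vector_field A Y \<Longrightarrow> smooth_fun A (\<lambda>u. G u (X u) (Y u))"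
  using tensor_02 unfolding tensor_02_def by blast

lemma G_sum:
  assumes "\<And>i. i \<in> I \<Longrightarrow> e i \<in> tangent_space A u" "b \<in> tangent_space A u"
  shows "G u (\<Sum>i\<in>I. c i *\<^sub>T e i) b = (\<Sum>i\<in>I. c i * G u (e i) b)"
  using assms(1)
proof (induction I rule: infinite_finite_induct)
  case (insert i I)
  have "(\<Sum>i\<in>I. c i *\<^sub>T e i) \<in> tangent_space A u"
    using insert.prems by (intro tangent_space_sum tangent_space_scale) auto
  then show ?case
    using insert assms(2)
    by (simp add: G_add G_scale tangent_space_scale del: plus_fun_apply)
qed (simp_all add: G_zero assms(2) del: zero_fun_apply)

end

locale metric_connection = symmetric_tensor A G
  for A :: "('a::{t2_space, second_countable_topology}, 'b::euclidean_space) atlas"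
    and G :: "'a \<Rightarrow> 'a tvec \<Rightarrow> 'a tvec \<Rightarrow> real" +
  fixes D :: "'a vfield \<Rightarrow> 'a vfield \<Rightarrow> 'a vfield"
  assumes linear_connection: "linear_connection A D"
    and metric: "\<And>X Y Z u. vector_field A X \<Longrightarrow> vector_field A Y \<Longrightarrow> vector_field A Z \<Longrightarrow>
      X u (\<lambda>p. G p (Y p) (Z p)) = G u (D X Y u) (Z u) + G u (Y u) (D X Z u)"
begin

lemma D_vf: "vector_field A X \<Longrightarrow> vector_field A Y \<Longrightarrow> vector_field A (D X Y)"
  using linear_connection smooth_fun_const unfolding linear_connection_def by blast

lemma D_add_left: "vector_field A X \<Longrightarrow> vector_field A Y \<Longrightarrow> vector_field A Z \<Longrightarrow> D (X + Y) Z = D X Z + D Y Z"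
  using linear_connection smooth_fun_const unfolding linear_connection_def by blast

lemma D_add_right: "vector_field A X \<Longrightarrow> vector_field A Y \<Longrightarrow> vector_field A Z \<Longrightarrow> D X (Y + Z) = D X Y + D X Z"
  using linear_connection smooth_fun_const unfolding linear_connection_def by blast

lemma D_fmult_left: "smooth_fun A f \<Longrightarrow> vector_field A X \<Longrightarrow> vector_field A Y \<Longrightarrow> D (fmult f X) Y = fmult f (D X Y)"
  using linear_connection unfolding linear_connection_def by blast

lemma D_fmult_right: "smooth_fun A f \<Longrightarrow> vector_field A X \<Longrightarrow> vector_field A Y \<Longrightarrow>
    D X (fmult f Y) = fmult (\<lambda>u. X u f) Y + fmult f (D X Y)"
  using linear_connection unfolding linear_connection_def by blast

lemma D_uminus_left:
  assumes "vector_field A X" "vector_field A Y"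
  shows "D (\<lambda>u f. - X u f) Y = (\<lambda>u f. - D X Y u f)"
  using D_fmult_left[OF smooth_fun_const assms, of "- 1"] by (simp only: fmult_minus_one)

lemma curvature_vf:
  "vector_field A X \<Longrightarrow> vector_field A Y \<Longrightarrow> vector_field A Z \<Longrightarrow> vector_field A (curvature D X Y Z)"
  unfolding curvature_def by (intro vector_field_diff D_vf vector_field_lie_bracket)

lemma curvature_swap:
  assumes "vector_field A X" "vector_field A Y" "vector_field A Z"
  shows "curvature D Y X Z u f = - curvature D X Y Z u f"
  unfolding curvature_def lie_bracket_swap[of Y X]
    D_uminus_left[OF vector_field_lie_bracket[OF assms(1,2)] assms(3)] by simp

lemma curvature_add_left:
  assumes "vector_field A X" "vector_field A X'" "vector_field A Y" "vector_field A Z"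
  shows "curvature D (X + X') Y Z = curvature D X Y Z + curvature D X' Y Z"
  using assms unfolding curvature_def
  by (simp only: lie_bracket_add_left D_add_left D_add_right D_vf vector_field_lie_bracket)
    (simp add: fun_eq_iff)

lemma curvature_fmult_left:
  assumes f: "smooth_fun A f" and X: "vector_field A X" and Y: "vector_field A Y" and Z: "vector_field A Z"
  shows "curvature D (fmult f X) Y Z = fmult f (curvature D X Y Z)"
proof -
  have Yf: "smooth_fun A (\<lambda>u. - Y u f)" by (intro smooth_fun_uminus vector_field_smooth Y)
  have "D (lie_bracket (fmult f X) Y) Z = fmult f (D (lie_bracket X Y) Z) + fmult (\<lambda>u. - Y u f) (D X Z)"
    unfolding lie_bracket_fmult_left[OF f X Y]
    using f Yf X Y Z by (simp only: D_add_left D_fmult_left vector_field_fmult vector_field_lie_bracket)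
  then show ?thesis
    unfolding curvature_def D_fmult_left[OF f X D_vf[OF Y Z]] D_fmult_left[OF f X Z]
      D_fmult_right[OF f Y D_vf[OF X Z]]
    by (simp add: fun_eq_iff fmult_apply tscale_apply algebra_simps)
qed

lemma curvature_add_right:
  assumes "vector_field A X" "vector_field A Y" "vector_field A Z" "vector_field A Z'"
  shows "curvature D X Y (Z + Z') = curvature D X Y Z + curvature D X Y Z'"
  using assms unfolding curvature_def
  by (simp only: D_add_right D_vf vector_field_lie_bracket) (simp add: fun_eq_iff)

lemma curvature_fmult_right:
  assumes f: "smooth_fun A f" and X: "vector_field A X" and Y: "vector_field A Y" and Z: "vector_field A Z"
  shows "curvature D X Y (fmult f Z) = fmult f (curvature D X Y Z)"
proof -
  have s: "smooth_fun A (\<lambda>u. X u f)" "smooth_fun A (\<lambda>u. Y u f)"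
    by (intro vector_field_smooth X Y)+
  have *: "D X (D Y (fmult f Z)) = fmult (\<lambda>u. X u (\<lambda>p. Y p f)) Z + fmult (\<lambda>u. Y u f) (D X Z)
      + (fmult (\<lambda>u. X u f) (D Y Z) + fmult f (D X (D Y Z)))"
    if "vector_field A X" "vector_field A Y" for X Y
    using f Z that vector_field_smooth[OF that(2)]
    by (simp only: D_fmult_right D_add_right D_vf vector_field_fmult)
  show ?thesis
    unfolding curvature_def *[OF X Y] *[OF Y X] D_fmult_right[OF f vector_field_lie_bracket[OF X Y] Z]
    by (simp add: fun_eq_iff fmult_apply tscale_apply lie_bracket_def algebra_simps)
qed

text \<open>
  The operators \<open>X Y - Y X\<close> and \<open>[X, Y]\<close> agree on the function \<open>G(Z, W)\<close>. Expanding both with the metric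
  property, the mixed terms \<open>G(D\<^sub>X Z, D\<^sub>Y W)\<close> cancel.
\<close>
lemma curvature_skew:
  assumes X: "vector_field A X" and Y: "vector_field A Y" and Z: "vector_field A Z" and W: "vector_field A W"
  shows "G u (curvature D X Y Z u) (W u) = - G u (Z u) (curvature D X Y W u)"
proof -
  let ?g = "\<lambda>Z W p. G p (Z p) (W p)"
  note t = vector_field_tangent
  have 2: "X u (\<lambda>p. Y p (?g Z W)) = ?g (D X (D Y Z)) W u + ?g (D Y Z) (D X W) u
      + (?g (D X Z) (D Y W) u + ?g Z (D X (D Y W)) u)"
    if X: "vector_field A X" and Y: "vector_field A Y" for X Y
  proof -
    have "X u (\<lambda>p. Y p (?g Z W)) = X u (\<lambda>p. ?g (D Y Z) W p + ?g Z (D Y W) p)"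
      unfolding metric[OF Y Z W] ..
    also have "\<dots> = X u (?g (D Y Z) W) + X u (?g Z (D Y W))"
      by (intro tangent_add[OF t[OF X]] smooth_fun_G D_vf Y Z W)
    finally show ?thesis
      using metric[OF X D_vf[OF Y Z] W] metric[OF X Z D_vf[OF Y W]] by simp
  qed
  have "lie_bracket X Y u (?g Z W) = ?g (D (lie_bracket X Y) Z) W u + ?g Z (D (lie_bracket X Y) W) u"
    by (rule metric[OF vector_field_lie_bracket[OF X Y] Z W])
  moreover have "lie_bracket X Y u (?g Z W) = X u (\<lambda>p. Y p (?g Z W)) - Y u (\<lambda>p. X p (?g Z W))"
    by (simp add: lie_bracket_def)
  ultimately have "?g (D X (D Y Z)) W u + ?g Z (D X (D Y W)) u - (?g (D Y (D X Z)) W u + ?g Z (D Y (D X W)) u)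
      = ?g (D (lie_bracket X Y) Z) W u + ?g Z (D (lie_bracket X Y) W) u"
    unfolding 2[OF X Y] 2[OF Y X] by simp
  moreover have "?g (curvature D X Y Z) W u = ?g (D X (D Y Z)) W u - ?g (D Y (D X Z)) W u - ?g (D (lie_bracket X Y) Z) W u"
    by (simp only: curvature_apply G_diff t tangent_space_diff D_vf vector_field_lie_bracket X Y Z W)
  moreover have "?g Z (curvature D X Y W) u = ?g Z (D X (D Y W)) u - ?g Z (D Y (D X W)) u - ?g Z (D (lie_bracket X Y) W) u"
    by (simp only: curvature_apply G_diff t tangent_space_diff D_vf vector_field_lie_bracket X Y Z W)
  ultimately show ?thesis by simp
qed

text \<open>The curvature tensor of type \<open>(0, 4)\<close>.\<close>
definition Rm :: "'a \<Rightarrow> 'a tvec \<Rightarrow> 'a tvec \<Rightarrow> 'a tvec \<Rightarrow> 'a tvec \<Rightarrow> real" where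
  "Rm u a b c d = G u (curvature_at A D u a b c) d"

text \<open>
  Curvature is linear over the smooth functions in each argument, so the fields chosen by \<open>extension\<close> may be
  replaced one after the other by any fields with the same values; the second argument is reduced to the
  first by antisymmetry.
\<close>
lemma Rm_fields:
  assumes X: "vector_field A X" and Y: "vector_field A Y" and Z: "vector_field A Z"
    and d: "d \<in> tangent_space A u"
  shows "Rm u (X u) (Y u) (Z u) d = G u (curvature D X Y Z u) d"
proof -
  note t = vector_field_tangent
  let ?X = "extension A u (X u)" and ?Y = "extension A u (Y u)" and ?Z = "extension A u (Z u)"
  have e: "vector_field A ?X" "vector_field A ?Y" "vector_field A ?Z"
    "?X u = X u" "?Y u = Y u" "?Z u = Z u"
    using extension t X Y Z by blast+
  have swap: "G u (curvature D X Y Z u) d = - G u (curvature D Y X Z u) d"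
    if "vector_field A X" "vector_field A Y" "vector_field A Z" for X Y Z
  proof -
    have "curvature D X Y Z u = (- 1) *\<^sub>T curvature D Y X Z u"
      using curvature_swap[OF that(2,1,3)] by (simp add: tscale_def fun_eq_iff)
    then show ?thesis using G_scale[OF t[OF curvature_vf[OF that(2,1,3)]] d, of "- 1"] by simp
  qed
  have 1: "G u (curvature D X Y Z u) d = G u (curvature D X' Y Z u) d"
    if "vector_field A X" "vector_field A X'" "vector_field A Y" "vector_field A Z" "X u = X' u" for X X' Y Z
  proof (rule tensorial_pointwise[OF _ _ that(1,2,5)])
    show "G u (curvature D (X + X') Y Z u) d = G u (curvature D X Y Z u) d + G u (curvature D X' Y Z u) d"
      if "vector_field A X" "vector_field A X'" for X X'
      using that \<open>vector_field A Y\<close> \<open>vector_field A Z\<close> d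
      by (simp only: curvature_add_left plus_fun_apply[of "curvature D X Y Z"] G_add t curvature_vf)
    show "G u (curvature D (fmult f X) Y Z u) d = f u * G u (curvature D X Y Z u) d"
      if "smooth_fun A f" "vector_field A X" for f X
      using that \<open>vector_field A Y\<close> \<open>vector_field A Z\<close> d
      by (simp only: curvature_fmult_left fmult_apply G_scale t curvature_vf)
  qed
  have 3: "G u (curvature D X Y Z u) d = G u (curvature D X Y Z' u) d"
    if "vector_field A Z" "vector_field A Z'" "vector_field A X" "vector_field A Y" "Z u = Z' u" for X Y Z Z'
  proof (rule tensorial_pointwise[OF _ _ that(1,2,5)])
    show "G u (curvature D X Y (Z + Z') u) d = G u (curvature D X Y Z u) d + G u (curvature D X Y Z' u) d"
      if "vector_field A Z" "vector_field A Z'" for Z Z'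
      using that \<open>vector_field A X\<close> \<open>vector_field A Y\<close> d
      by (simp only: curvature_add_right plus_fun_apply[of "curvature D X Y Z"] G_add t curvature_vf)
    show "G u (curvature D X Y (fmult f Z) u) d = f u * G u (curvature D X Y Z u) d"
      if "smooth_fun A f" "vector_field A Z" for f Z
      using that \<open>vector_field A X\<close> \<open>vector_field A Y\<close> d
      by (simp only: curvature_fmult_right fmult_apply G_scale t curvature_vf)
  qed
  have "G u (curvature D ?X ?Y ?Z u) d = G u (curvature D X ?Y ?Z u) d"
    by (intro 1 e X)
  also have "\<dots> = G u (curvature D X Y ?Z u) d"
    unfolding swap[OF X e(2,3)] swap[OF X Y e(3)] using 1[OF e(2) Y X e(3) e(5)] by simp
  also have "\<dots> = G u (curvature D X Y Z u) d"
    by (intro 3 e X Y Z)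
  finally show ?thesis unfolding Rm_def curvature_at_def .
qed

lemma curvature_at_tangent:
  assumes "a \<in> tangent_space A u" "b \<in> tangent_space A u" "c \<in> tangent_space A u"
  shows "curvature_at A D u a b c \<in> tangent_space A u"
  unfolding curvature_at_def
  by (intro vector_field_tangent curvature_vf assms[THEN extension, THEN conjunct1])

lemma Rm_linear:
  assumes T: "a \<in> tangent_space A u" "a' \<in> tangent_space A u" "b \<in> tangent_space A u"
    "c \<in> tangent_space A u" "d \<in> tangent_space A u"
  shows "Rm u (k *\<^sub>T a + l *\<^sub>T a') b c d = k * Rm u a b c d + l * Rm u a' b c d"
    and "Rm u a b c d = - Rm u b a c d"
    and "Rm u a b c d = - Rm u a b d c"
proof -
  note t = vector_field_tangent
  let ?e = "extension A u"
  have e: "vector_field A (?e x)" "?e x u = x" if "x \<in> tangent_space A u" for x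
    using extension[OF that] by auto
  note E = e[OF T(1)] e[OF T(2)] e[OF T(3)] e[OF T(4)] e[OF T(5)]
  have R: "Rm u a b c d = G u (curvature D (?e a) (?e b) (?e c) u) d"
    if "a \<in> tangent_space A u" "b \<in> tangent_space A u" "c \<in> tangent_space A u" "d \<in> tangent_space A u" for a b c d
    using Rm_fields[OF e(1)[OF that(1)] e(1)[OF that(2)] e(1)[OF that(3)] that(4)] e(2) that by simp
  let ?X = "fmult (\<lambda>_. k) (?e a) + fmult (\<lambda>_. l) (?e a')"
  have "?X u = k *\<^sub>T a + l *\<^sub>T a'" using E by (simp add: fmult_def)
  moreover have "vector_field A ?X" by (intro vector_field_add vector_field_fmult smooth_fun_const E)
  moreover have "curvature D ?X (?e b) (?e c) u = k *\<^sub>T curvature D (?e a) (?e b) (?e c) u + l *\<^sub>T curvature D (?e a') (?e b) (?e c) u"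
    using E by (simp only: curvature_add_left curvature_fmult_left smooth_fun_const vector_field_fmult plus_fun_apply fmult_apply)
  ultimately have "Rm u (k *\<^sub>T a + l *\<^sub>T a') b c d =
      G u (k *\<^sub>T curvature D (?e a) (?e b) (?e c) u + l *\<^sub>T curvature D (?e a') (?e b) (?e c) u) d"
    using Rm_fields[of ?X "?e b" "?e c" d u] E T by simp
  then show "Rm u (k *\<^sub>T a + l *\<^sub>T a') b c d = k * Rm u a b c d + l * Rm u a' b c d"
    using T E by (simp only: R G_add G_scale t curvature_vf tangent_space_scale)
  have "curvature D (?e a) (?e b) (?e c) u = (- 1) *\<^sub>T curvature D (?e b) (?e a) (?e c) u"
    using curvature_swap[OF E(5,1,7)] by (simp add: tscale_def fun_eq_iff)
  then show "Rm u a b c d = - Rm u b a c d"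
    using T E by (simp add: R G_scale t curvature_vf)
  show "Rm u a b c d = - Rm u a b d c"
    unfolding R[OF T(1,3,4,5)] R[OF T(1,3,5,4)]
    using curvature_skew[OF E(1,5,7,9), of u, unfolded E(8,10)]
      G_sym[OF T(4) t[OF curvature_vf[OF E(1,5,9)]]] by linarith
qed

text \<open>
  The vector \<open>c\<close> spans the orthogonal complement of \<open>x\<close> in the plane of \<open>a\<close> and \<open>b\<close>. As \<open>x\<close> is a unit vector,
  the change of basis has determinant \<open>- 1\<close>, and both \<open>Rm a b b a\<close> and the product \<open>G(a, a) G(b, b)\<close> change
  by the square of the determinant.
\<close>
lemma flag_curvature_basis_change:
  assumes T: "a \<in> tangent_space A u" "b \<in> tangent_space A u"
    and ab: "G u a b = 0" and x: "x = s *\<^sub>T a + t *\<^sub>T b" "G u x x = 1"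
  defines "c \<equiv> (- t * G u b b) *\<^sub>T a + (s * G u a a) *\<^sub>T b"
  shows "G u c c = G u a a * G u b b" and "G u c x = 0"
    and "flag_curvature A G D u a b = Rm u c x x c / G u c c"
proof -
  let ?p = "G u a a" and ?q = "G u b b"
  have ba: "G u b a = 0" using ab G_sym T by metis
  have lin: "G u (k *\<^sub>T a + l *\<^sub>T b) (k' *\<^sub>T a + l' *\<^sub>T b) = k * k' * ?p + l * l' * ?q" for k l k' l'
    using T by (simp add: G_add G_scale tangent_space_scale tangent_space_add ab ba)
  have xx: "s * s * ?p + t * t * ?q = 1" using x lin by simp
  have "G u c c = ?p * ?q * (s * s * ?p + t * t * ?q)"
    unfolding c_def lin by (simp add: algebra_simps)
  then show cc: "G u c c = ?p * ?q" using xx by simp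
  show "G u c x = 0" unfolding c_def x(1) lin by simp
  have tc: "c \<in> tangent_space A u" and tx: "x \<in> tangent_space A u"
    unfolding c_def x(1) using T by (auto intro: tangent_space_add tangent_space_scale)
  have "a = (s * s * ?p + t * t * ?q) *\<^sub>T a" "b = (s * s * ?p + t * t * ?q) *\<^sub>T b"
    unfolding xx by (simp_all add: tscale_def)
  \<comment> \<open>The inverse change of basis.\<close>
  then have a: "a = (- t) *\<^sub>T c + (s * ?p) *\<^sub>T x" and b: "b = s *\<^sub>T c + (t * ?q) *\<^sub>T x"
    unfolding c_def x(1) by (simp_all add: tscale_def fun_eq_iff algebra_simps)
  note L1 = Rm_linear(1) and S1 = Rm_linear(2) and S2 = Rm_linear(3)
  note ts = tc tx T
  have z: "Rm u c c y z = 0" "Rm u x x y z = 0" "Rm u y z c c = 0" "Rm u y z x x = 0"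
    if "y \<in> tangent_space A u" "z \<in> tangent_space A u" for y z
    using S1[of c u c c y z] S1[of x u x x y z] S2[of y u y z c c] S2[of y u y z x x] ts that by simp_all
  have L2: "Rm u y (k *\<^sub>T c + l *\<^sub>T x) z w = k * Rm u y c z w + l * Rm u y x z w"
    if "y \<in> tangent_space A u" "z \<in> tangent_space A u" "w \<in> tangent_space A u" for y z w k l
    using that ts S1[of y u y "k *\<^sub>T c + l *\<^sub>T x" z w] S1[of y u y c z w] S1[of y u y x z w]
    by (simp add: L1 tangent_space_add tangent_space_scale)
  have L4: "Rm u y z w (k *\<^sub>T c + l *\<^sub>T x) = k * Rm u y z w c + l * Rm u y z w x"
    if "y \<in> tangent_space A u" "z \<in> tangent_space A u" "w \<in> tangent_space A u" for y z w k l
    using that ts curvature_at_tangent[OF that]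
    by (simp add: Rm_def G_add G_scale tangent_space_scale del: plus_fun_apply)
  have L3: "Rm u y z (k *\<^sub>T c + l *\<^sub>T x) w = k * Rm u y z c w + l * Rm u y z x w"
    if "y \<in> tangent_space A u" "z \<in> tangent_space A u" "w \<in> tangent_space A u" for y z w k l
    using that ts S2[of y u y z "k *\<^sub>T c + l *\<^sub>T x" w] S2[of y u y z c w] S2[of y u y z x w]
    by (simp add: L4 tangent_space_add tangent_space_scale)
  have "Rm u (- t *\<^sub>T c + (s * ?p) *\<^sub>T x) (s *\<^sub>T c + (t * ?q) *\<^sub>T x) y z =
      - (s * s * ?p + t * t * ?q) * Rm u c x y z"
    if "y \<in> tangent_space A u" "z \<in> tangent_space A u" for y z
    using ts that S1[of x u x c y z]
    by (simp add: L1 L2 z tangent_space_add tangent_space_scale algebra_simps del: plus_fun_apply)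
  then have "Rm u a b b a = - (s * s * ?p + t * t * ?q) * Rm u c x b a"
    unfolding a[symmetric] b[symmetric] using T by blast
  moreover have "Rm u c x (s *\<^sub>T c + (t * ?q) *\<^sub>T x) (- t *\<^sub>T c + (s * ?p) *\<^sub>T x) =
      - (s * s * ?p + t * t * ?q) * Rm u c x x c"
    using ts S2[of c u c x c x]
    by (simp add: L3 L4 z tangent_space_add tangent_space_scale algebra_simps del: plus_fun_apply)
  then have "Rm u c x b a = - (s * s * ?p + t * t * ?q) * Rm u c x x c"
    unfolding a[symmetric] b[symmetric] .
  ultimately have "Rm u a b b a = Rm u c x x c" unfolding xx by simp
  then show "flag_curvature A G D u a b = Rm u c x x c / G u c c"
    using xx cc by (simp add: flag_curvature_def Rm_def)
qed

end

section \<open>Paracontact structures on a distribution\<close>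
lemma tscale_simps [simp]: "0 *\<^sub>T a = 0" "1 *\<^sub>T a = a" "c *\<^sub>T (0 :: 'a tvec) = 0"
  by (simp_all add: tscale_def fun_eq_iff)

text \<open>
  The quadratic function \<open>a + t b + t\<^sup>2 c\<close> vanishes for all small \<open>t \<noteq> 0\<close>; four such values \<open>\<plusminus>d\<close>, \<open>\<plusminus>d/2\<close>
  suffice to eliminate \<open>b\<close> and \<open>c\<close>.
\<close>
lemma quadratic_vanishes_at_0:
  fixes a b c g h :: real
  assumes g: "g \<noteq> 0" and "\<And>t. t * (2 * g + t * h) \<noteq> 0 \<Longrightarrow> a + t * b + t * t * c = 0"
  shows "a = 0"
proof -
  \<comment> \<open>For \<open>\<bar>t\<bar> \<le> d\<close> the term \<open>t h\<close> is too small to cancel \<open>2 g\<close>.\<close>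
  define d where "d = \<bar>g\<bar> / (\<bar>h\<bar> + 1)"
  have d: "d > 0" using g by (simp add: d_def)
  have *: "a + t * b + t * t * c = 0" if t: "t \<noteq> 0" "\<bar>t\<bar> \<le> d" for t
  proof -
    have "\<bar>t * h\<bar> \<le> d * (\<bar>h\<bar> + 1)"
      unfolding abs_mult using t by (intro mult_mono) auto
    also have "\<dots> = \<bar>g\<bar>" by (simp add: d_def)
    finally have "2 * g + t * h \<noteq> 0" using g by linarith
    then show ?thesis using assms(2) t by simp
  qed
  show ?thesis
    using *[of d] *[of "- d"] *[of "d / 2"] *[of "- (d / 2)"] d by (simp add: algebra_simps)
qed

text \<open>
  What the horizontal and the vertical half of a K-paracontact Finsler structure with a Finsler connection
  have in common: \<open>W\<close> is the distribution, \<open>pr\<close> the projection onto it, and \<open>\<xi>\<close> lies in \<open>W\<close>. The structure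
  equations are required on \<open>W\<close> only, and brackets enter through their projections, as \<open>HE\<close> is in general
  not integrable.
\<close>
locale paracontact_distribution = metric_connection A G D
  for A :: "('a::{t2_space, second_countable_topology}, 'b::euclidean_space) atlas"
    and G :: "'a \<Rightarrow> 'a tvec \<Rightarrow> 'a tvec \<Rightarrow> real"
    and D :: "'a vfield \<Rightarrow> 'a vfield \<Rightarrow> 'a vfield" +
  fixes W :: "'a \<Rightarrow> 'a tvec set" and pr :: "'a \<Rightarrow> 'a tvec \<Rightarrow> 'a tvec"
    and \<phi> :: "'a \<Rightarrow> 'a tvec \<Rightarrow> 'a tvec" and \<eta> :: "'a \<Rightarrow> 'a tvec \<Rightarrow> real" and \<xi> :: "'a vfield"
  assumes W_iff: "a \<in> W u \<longleftrightarrow> a \<in> tangent_space A u \<and> pr u a = a"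
    and pr_W: "a \<in> tangent_space A u \<Longrightarrow> pr u a \<in> W u"
    and pr_lincomb: "a \<in> tangent_space A u \<Longrightarrow> b \<in> tangent_space A u \<Longrightarrow>
      pr u (k *\<^sub>T a + l *\<^sub>T b) = k *\<^sub>T pr u a + l *\<^sub>T pr u b"
    and pr_vf: "vector_field A X \<Longrightarrow> vector_field A (\<lambda>u. pr u (X u))"
    and nondegenerate: "a \<in> W u \<Longrightarrow> (\<And>b. b \<in> W u \<Longrightarrow> G u a b = 0) \<Longrightarrow> a = 0"
    and D_pr: "vector_field A X \<Longrightarrow> vector_field A Y \<Longrightarrow> D X (\<lambda>u. pr u (Y u)) = (\<lambda>u. pr u (D X Y u))"
    and torsion_free: "vector_field A X \<Longrightarrow> vector_field A Y \<Longrightarrow> (\<And>u. X u \<in> W u) \<Longrightarrow> (\<And>u. Y u \<in> W u) \<Longrightarrow>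
      pr u (lie_bracket X Y u) = D X Y u - D Y X u"
    and phi: "tensor_11 A \<phi>" and phi_W: "a \<in> W u \<Longrightarrow> \<phi> u a \<in> W u"
    and eta: "one_form A \<eta>"
    and xi: "vector_field A \<xi>" and xi_W: "\<xi> u \<in> W u"
    and phi_phi: "a \<in> W u \<Longrightarrow> \<phi> u (\<phi> u a) = a - \<eta> u a *\<^sub>T \<xi> u"
    and eta_xi: "\<eta> u (\<xi> u) = 1"
    and G_phi_phi: "a \<in> W u \<Longrightarrow> b \<in> W u \<Longrightarrow> G u (\<phi> u a) (\<phi> u b) = - G u a b + \<eta> u a * \<eta> u b"
    and contact: "vector_field A X \<Longrightarrow> vector_field A Y \<Longrightarrow> (\<And>u. X u \<in> W u) \<Longrightarrow> (\<And>u. Y u \<in> W u) \<Longrightarrow>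
      X u (\<lambda>p. \<eta> p (Y p)) - Y u (\<lambda>p. \<eta> p (X p)) - \<eta> u (pr u (lie_bracket X Y u)) = G u (X u) (\<phi> u (Y u))"
    and killing: "vector_field A X \<Longrightarrow> vector_field A Y \<Longrightarrow> (\<And>u. X u \<in> W u) \<Longrightarrow> (\<And>u. Y u \<in> W u) \<Longrightarrow>
      \<xi> u (\<lambda>p. G p (X p) (Y p)) - G u (pr u (lie_bracket \<xi> X u)) (Y u) - G u (X u) (pr u (lie_bracket \<xi> Y u)) = 0"
begin

text \<open>The global smooth sections of \<open>W\<close>.\<close>
definition W_field :: "'a vfield \<Rightarrow> bool" where
  "W_field X \<longleftrightarrow> vector_field A X \<and> (\<forall>u. X u \<in> W u)"

lemma W_fieldD: "W_field X \<Longrightarrow> vector_field A X" "W_field X \<Longrightarrow> X u \<in> W u" "W_field X \<Longrightarrow> X u \<in> tangent_space A u"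
  by (auto simp: W_field_def W_iff)

lemma W_tangent: "a \<in> W u \<Longrightarrow> a \<in> tangent_space A u"
  by (simp add: W_iff)

lemma W_field_xi: "W_field \<xi>"
  by (simp add: W_field_def xi xi_W)

lemma phi_linear:
  assumes "a \<in> tangent_space A u" "b \<in> tangent_space A u"
  shows "\<phi> u (a - k *\<^sub>T b) = \<phi> u a - k *\<^sub>T \<phi> u b" "\<phi> u (k *\<^sub>T a) = k *\<^sub>T \<phi> u a"
    "\<phi> u a \<in> tangent_space A u"
proof -
  have *: "x - k *\<^sub>T y = x + (- k) *\<^sub>T y" for x y :: "'a tvec" by (simp add: tscale_def fun_eq_iff)
  have add: "\<phi> u (x + y) = \<phi> u x + \<phi> u y" and scale: "\<phi> u (r *\<^sub>T x) = r *\<^sub>T \<phi> u x"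
    if "x \<in> tangent_space A u" "y \<in> tangent_space A u" for x y r
    using phi that unfolding tensor_11_def by blast+
  show "\<phi> u (a - k *\<^sub>T b) = \<phi> u a - k *\<^sub>T \<phi> u b"
    unfolding * using add[OF assms(1) tangent_space_scale[OF assms(2)]] scale[OF assms(2,1)] by simp
  show "\<phi> u (k *\<^sub>T a) = k *\<^sub>T \<phi> u a" using scale[OF assms] .
  show "\<phi> u a \<in> tangent_space A u" using phi assms unfolding tensor_11_def by blast
qed

lemma W_field_phi: "W_field X \<Longrightarrow> W_field (\<lambda>u. \<phi> u (X u))"
  using phi phi_W unfolding tensor_11_def W_field_def by blast

lemma eta_scale: "a \<in> tangent_space A u \<Longrightarrow> \<eta> u (k *\<^sub>T a) = k * \<eta> u a"
  using eta unfolding one_form_def by blast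

text \<open>
  \<open>\<phi>\<^sup>2 \<xi> = \<xi> - \<eta>(\<xi>) \<xi> = 0\<close>, and applying the same formula to \<open>\<phi> \<xi>\<close> gives \<open>\<phi> \<xi> = t \<xi>\<close> with \<open>t = \<eta>(\<phi> \<xi>)\<close>;
  hence \<open>t\<^sup>2 \<xi> = 0\<close>.
\<close>
lemma phi_xi: "\<phi> u (\<xi> u) = 0"
proof -
  note xt = W_tangent[OF xi_W, of u]
  let ?t = "\<eta> u (\<phi> u (\<xi> u))"
  have p2: "\<phi> u (\<phi> u (\<xi> u)) = 0"
    using phi_phi[OF xi_W, of u] by (simp add: eta_xi)
  have "\<phi> u 0 = 0" using phi_linear(2)[OF xt xt, of 0] by simp
  then have "\<phi> u (\<xi> u) - ?t *\<^sub>T \<xi> u = 0"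
    using phi_phi[OF phi_W[OF xi_W], of u] p2 by simp
  then have p1: "\<phi> u (\<xi> u) = ?t *\<^sub>T \<xi> u" by simp
  have "?t *\<^sub>T (?t *\<^sub>T \<xi> u) = \<phi> u (\<phi> u (\<xi> u))"
    using phi_linear(2)[OF xt xt, of ?t] p1 by simp
  then have "?t *\<^sub>T (?t *\<^sub>T \<xi> u) = 0" using p2 by simp
  then have "\<eta> u (?t *\<^sub>T (?t *\<^sub>T \<xi> u)) = 0" using eta_scale[OF xt, of 0] by simp
  then have "?t = 0" using xt by (simp add: eta_scale tangent_space_scale eta_xi)
  then show ?thesis using p1 by simp
qed

lemma eta_eq_G: "a \<in> W u \<Longrightarrow> \<eta> u a = G u a (\<xi> u)"
  using G_phi_phi[of a u "\<xi> u"] xi_W[of u] phi_linear(3)[OF W_tangent W_tangent, of a u a]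
  by (simp add: phi_xi G_zero eta_xi del: zero_fun_apply)

lemma G_xi_xi: "G u (\<xi> u) (\<xi> u) = 1"
  using eta_eq_G[OF xi_W] eta_xi by metis

text \<open>Evaluating \<open>\<phi>\<^sup>3 a\<close> as \<open>\<phi> (\<phi>\<^sup>2 a)\<close> and as \<open>\<phi>\<^sup>2 (\<phi> a)\<close> yields \<open>\<eta>(\<phi> a) \<xi> = 0\<close>.\<close>
lemma eta_phi:
  assumes "a \<in> W u"
  shows "\<eta> u (\<phi> u a) = 0"
proof -
  note xt = W_tangent[OF xi_W, of u] and at = W_tangent[OF assms]
  have "\<phi> u (\<phi> u (\<phi> u a)) = \<phi> u a"
    using phi_phi[OF assms] phi_linear(1)[OF at xt, of "\<eta> u a"] by (simp add: phi_xi)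
  then have "\<eta> u (\<phi> u a) *\<^sub>T \<xi> u = 0"
    using phi_phi[OF phi_W[OF assms]] by simp
  then have "\<eta> u (\<eta> u (\<phi> u a) *\<^sub>T \<xi> u) = 0"
    using eta_scale[OF xt, of 0] by simp
  then show ?thesis using eta_scale[OF xt] eta_xi by simp
qed

lemma phi_skew:
  assumes a: "a \<in> W u" and b: "b \<in> W u"
  shows "G u (\<phi> u a) b = - G u a (\<phi> u b)"
proof -
  note xt = W_tangent[OF xi_W, of u] and pat = W_tangent[OF phi_W[OF a]] and bt = W_tangent[OF b]
  have "G u (\<phi> u a) b - \<eta> u b * G u (\<phi> u a) (\<xi> u) = G u (\<phi> u a) (\<phi> u (\<phi> u b))"
    unfolding phi_phi[OF b] using pat bt xt by (simp add: G_diff G_scale tangent_space_scale)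
  moreover have "G u (\<phi> u a) (\<phi> u (\<phi> u b)) = - G u a (\<phi> u b)"
    using G_phi_phi[OF a phi_W[OF b]] eta_phi[OF b] by simp
  moreover have "G u (\<phi> u a) (\<xi> u) = 0"
    using eta_eq_G[OF phi_W[OF a]] eta_phi[OF a] by simp
  ultimately show ?thesis by simp
qed

lemma G_phi_self: "a \<in> W u \<Longrightarrow> G u (\<phi> u a) a = 0"
  using phi_skew[of a u a] G_sym[OF W_tangent W_tangent, of a u "\<phi> u a"] phi_W[of a u] by simp

lemma W_field_D:
  assumes X: "vector_field A X" and Y: "W_field Y"
  shows "W_field (D X Y)"
proof -
  have "(\<lambda>u. pr u (Y u)) = Y" using W_fieldD(2)[OF Y] by (auto simp: W_iff)
  then have "pr u (D X Y u) = D X Y u" for u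
    using D_pr[OF X W_fieldD(1)[OF Y]] by metis
  then show ?thesis
    using vector_field_tangent[OF D_vf[OF X W_fieldD(1)[OF Y]]] D_vf[OF X W_fieldD(1)[OF Y]]
    by (simp add: W_field_def W_iff)
qed

lemma W_field_torsion:
  assumes "W_field X" "W_field Y"
  shows "pr u (lie_bracket X Y u) = D X Y u - D Y X u"
  by (rule torsion_free) (use assms in \<open>auto simp: W_field_def\<close>)

text \<open>
  With \<open>\<eta> = G(\<cdot>, \<xi>)\<close> the contact condition reads \<open>G(D\<^sub>X \<xi>, Y) - G(D\<^sub>Y \<xi>, X) = G(X, \<phi> Y)\<close> and the Killing
  condition \<open>G(D\<^sub>X \<xi>, Y) + G(D\<^sub>Y \<xi>, X) = 0\<close>; their sum is the claim, as \<open>\<phi>\<close> is skew.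
\<close>
lemma G_D_xi:
  assumes X: "W_field X" and Y: "W_field Y"
  shows "2 * G u (D X \<xi> u) (Y u) = - G u (\<phi> u (X u)) (Y u)"
proof -
  note t = W_fieldD(3)
  note vX = W_fieldD(1)[OF X] and vY = W_fieldD(1)[OF Y]
  have DD: "W_field (D X Y)" "W_field (D Y X)" "W_field (D X \<xi>)" "W_field (D Y \<xi>)" "W_field (D \<xi> X)" "W_field (D \<xi> Y)"
    by (intro W_field_D vX vY X Y xi W_field_xi)+
  note T = DD[THEN t, of u] t[OF X, of u] t[OF Y, of u] t[OF W_field_xi, of u]
  have eta: "(\<lambda>p. \<eta> p (Z p)) = (\<lambda>p. G p (Z p) (\<xi> p))" if "W_field Z" for Z
    using eta_eq_G[OF W_fieldD(2)[OF that]] by (intro ext)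
  have "pr u (lie_bracket X Y u) \<in> W u"
    by (intro pr_W vector_field_tangent vector_field_lie_bracket vX vY)
  note eb = eta_eq_G[OF this, unfolded W_field_torsion[OF X Y]]
  have "X u (\<lambda>p. \<eta> p (Y p)) - Y u (\<lambda>p. \<eta> p (X p)) - \<eta> u (pr u (lie_bracket X Y u)) = G u (X u) (\<phi> u (Y u))"
    by (rule contact[OF vX vY]) (simp_all add: W_fieldD(2) X Y)
  then have "G u (Y u) (D X \<xi> u) - G u (X u) (D Y \<xi> u) = G u (X u) (\<phi> u (Y u))"
    unfolding eta[OF X] eta[OF Y] metric[OF vX vY xi] metric[OF vY vX xi] W_field_torsion[OF X Y] eb
    using T by (simp add: G_diff)
  moreover have "\<xi> u (\<lambda>p. G p (X p) (Y p)) - G u (pr u (lie_bracket \<xi> X u)) (Y u) - G u (X u) (pr u (lie_bracket \<xi> Y u)) = 0"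
    by (rule killing[OF vX vY]) (simp_all add: W_fieldD(2) X Y)
  then have "G u (D X \<xi> u) (Y u) + G u (X u) (D Y \<xi> u) = 0"
    unfolding metric[OF xi vX vY] W_field_torsion[OF W_field_xi X] W_field_torsion[OF W_field_xi Y]
    using T by (simp add: G_diff)
  moreover have "G u (X u) (\<phi> u (Y u)) = - G u (\<phi> u (X u)) (Y u)"
    using phi_skew[OF W_fieldD(2)[OF X] W_fieldD(2)[OF Y]] by simp
  ultimately show ?thesis using G_sym[OF T(3,8)] by linarith
qed

text \<open>
  The component of \<open>[X, \<xi>]\<close> transversal to \<open>W\<close>, which measures the failure of \<open>W\<close> to be integrable in the
  direction of \<open>\<xi>\<close>.
\<close>
definition defect :: "'a vfield \<Rightarrow> 'a vfield" where
  "defect X = (\<lambda>u. lie_bracket X \<xi> u - pr u (lie_bracket X \<xi> u))"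

lemma vector_field_defect: "vector_field A X \<Longrightarrow> vector_field A (defect X)"
  using vector_field_diff[OF vector_field_lie_bracket[OF _ xi] pr_vf[OF vector_field_lie_bracket[OF _ xi]], of X X]
  by (simp add: defect_def fun_diff_def)

text \<open>
  Each of the terms of \<open>R(C, \<xi>) \<xi> = D\<^sub>C D\<^sub>\<xi> \<xi> - D\<^sub>\<xi> D\<^sub>C \<xi> - D\<^bsub>[C, \<xi>]\<^esub> \<xi>\<close> is paired with \<open>C\<close> and evaluated by
  \<open>G_D_xi\<close>. The first vanishes because \<open>D\<^sub>\<xi> \<xi>\<close> is orthogonal to \<open>W\<close>; in the second, the derivative of
  \<open>G(D\<^sub>C \<xi>, C) = 0\<close> along \<open>\<xi>\<close> moves \<open>D\<^sub>\<xi>\<close> to the other factor; in the third, the projection of \<open>[C, \<xi>]\<close> is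
  \<open>D\<^sub>C \<xi> - D\<^sub>\<xi> C\<close>. The terms \<open>G(\<phi> C, D\<^sub>\<xi> C)\<close> cancel and \<open>G(\<phi> C, \<phi> C)\<close> remains.
\<close>
lemma xi_curvature:
  assumes C: "W_field C"
  shows "G u (curvature D C \<xi> \<xi> u) (C u) =
    - 1 / 4 * (G u (C u) (C u) - (G u (C u) (\<xi> u))\<^sup>2) - G u (D (defect C) \<xi> u) (C u)"
proof -
  note t = W_fieldD(3)
  note vC = W_fieldD(1)[OF C]
  let ?P = "\<lambda>u. pr u (lie_bracket C \<xi> u)"
  have vb: "vector_field A (lie_bracket C \<xi>)" by (rule vector_field_lie_bracket[OF vC xi])
  have P: "W_field ?P"
    using pr_vf[OF vb] pr_W[OF vector_field_tangent[OF vb]] by (simp add: W_field_def)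
  have DD: "W_field (D C \<xi>)" "W_field (D \<xi> C)" "W_field (D \<xi> \<xi>)" "W_field (D C C)"
    "W_field (D \<xi> (D C \<xi>))" "W_field (D C (D \<xi> \<xi>))" "W_field (D ?P \<xi>)" "W_field (D (defect C) \<xi>)"
    "W_field (\<lambda>u. \<phi> u (C u))"
    by (intro W_field_D vC C xi W_field_xi W_fieldD(1)[OF P] vector_field_defect W_field_phi)+
  note vDD = DD[THEN W_fieldD(1)] and T = DD[THEN t, of u] t[OF C, of u] t[OF W_field_xi, of u]
  have "G u (D \<xi> \<xi> u) (Y u) = 0" if "W_field Y" for Y u
    using G_D_xi[OF W_field_xi that, of u] t[OF that] by (simp add: phi_xi G_zero del: zero_fun_apply)
  note Dxx = this
  have "G u (D C (D \<xi> \<xi>) u) (C u) = 0"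
    using metric[OF vC vDD(3) vC, of u] tangent_const[OF vector_field_tangent[OF vC, of u]]
    by (simp add: Dxx C DD)
  note 1 = this
  have "G u (D C \<xi> u) (C u) = 0" for u
    using G_D_xi[OF C C, of u] G_phi_self[OF W_fieldD(2)[OF C]] by simp
  then have "G u (D \<xi> (D C \<xi>) u) (C u) = - G u (D C \<xi> u) (D \<xi> C u)"
    using metric[OF xi vDD(1) vC, of u] tangent_const[OF vector_field_tangent[OF xi, of u]] by simp
  then have 2: "2 * G u (D \<xi> (D C \<xi>) u) (C u) = G u (\<phi> u (C u)) (D \<xi> C u)"
    using G_D_xi[OF C DD(2), of u] by simp
  have "2 * G u (D ?P \<xi> u) (C u) = - G u (\<phi> u (?P u)) (C u)"
    by (rule G_D_xi[OF P C])
  also have "\<dots> = G u (?P u) (\<phi> u (C u))"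
    using phi_skew[OF W_fieldD(2)[OF P] W_fieldD(2)[OF C]] by simp
  also have "\<dots> = G u (D C \<xi> u) (\<phi> u (C u)) - G u (D \<xi> C u) (\<phi> u (C u))"
    unfolding W_field_torsion[OF C W_field_xi] using T by (simp add: G_diff)
  finally have 3: "4 * G u (D ?P \<xi> u) (C u) =
      - G u (\<phi> u (C u)) (\<phi> u (C u)) - 2 * G u (\<phi> u (C u)) (D \<xi> C u)"
    using G_D_xi[OF C DD(9), of u] G_sym[OF T(2,9)] by simp
  have 4: "G u (\<phi> u (C u)) (\<phi> u (C u)) = - G u (C u) (C u) + (G u (C u) (\<xi> u))\<^sup>2"
    using G_phi_phi[OF W_fieldD(2)[OF C] W_fieldD(2)[OF C]] eta_eq_G[OF W_fieldD(2)[OF C]]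
    by (simp add: power2_eq_square)
  have "lie_bracket C \<xi> = ?P + defect C"
    by (simp add: defect_def fun_eq_iff)
  then have "D (lie_bracket C \<xi>) \<xi> u = D ?P \<xi> u + D (defect C) \<xi> u"
    using D_add_left[OF W_fieldD(1)[OF P] vector_field_defect[OF vC] xi] by (simp only: plus_fun_apply)
  then have "G u (curvature D C \<xi> \<xi> u) (C u) =
      G u (D C (D \<xi> \<xi>) u) (C u) - G u (D \<xi> (D C \<xi>) u) (C u) -
      (G u (D ?P \<xi> u) (C u) + G u (D (defect C) \<xi> u) (C u))"
    unfolding curvature_apply
    using T by (simp add: G_diff G_add tangent_space_diff tangent_space_add del: plus_fun_apply minus_apply)
  then show ?thesis using 1 2 3 4 by argo
qed

lemma pr_add: "a \<in> tangent_space A u \<Longrightarrow> b \<in> tangent_space A u \<Longrightarrow> pr u (a + b) = pr u a + pr u b"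
  using pr_lincomb[of a u b 1 1] by simp

lemma pr_scale: "a \<in> tangent_space A u \<Longrightarrow> pr u (k *\<^sub>T a) = k *\<^sub>T pr u a"
  using pr_lincomb[of a u a k 0] by simp

lemmas pr_simps = pr_add pr_scale

lemma W_field_add: "W_field X \<Longrightarrow> W_field Y \<Longrightarrow> W_field (X + Y)"
  by (auto simp: W_field_def W_iff pr_simps tangent_space_add vector_field_add)

lemma W_field_fmult: "smooth_fun A f \<Longrightarrow> W_field X \<Longrightarrow> W_field (fmult f X)"
  by (auto simp: W_field_def W_iff pr_simps tangent_space_scale vector_field_fmult fmult_apply)

lemma W_field_through:
  assumes "a \<in> W u"
  obtains X where "W_field X" "X u = a"
proof
  note e = extension[OF W_tangent[OF assms]]
  show "W_field (\<lambda>p. pr p (extension A u a p))"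
    using e pr_vf pr_W[OF vector_field_tangent] by (simp add: W_field_def)
  show "pr u (extension A u a u) = a"
    using e assms by (simp add: W_iff)
qed

lemma D_defect_add:
  assumes X: "W_field X" and Y: "W_field Y"
  shows "D (defect (X + Y)) \<xi> u = D (defect X) \<xi> u + D (defect Y) \<xi> u"
proof -
  note vX = W_fieldD(1)[OF X] and vY = W_fieldD(1)[OF Y]
  have "defect (X + Y) u = (defect X + defect Y) u" for u
    using vector_field_tangent[OF vector_field_lie_bracket[OF vX xi], of u]
      vector_field_tangent[OF vector_field_lie_bracket[OF vY xi], of u]
    unfolding defect_def lie_bracket_add_left[OF vX vY xi] by (simp add: pr_simps)
  then have "defect (X + Y) = defect X + defect Y" by (rule ext)
  then show ?thesis
    using D_add_left[OF vector_field_defect[OF vX] vector_field_defect[OF vY] xi] by simp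
qed

text \<open>
  The bracket \<open>[f X, \<xi>]\<close> differs from \<open>f [X, \<xi>]\<close> by a multiple of \<open>X\<close>, which lies in \<open>W\<close>; so the defect is
  linear over the smooth functions.
\<close>
lemma D_defect_fmult:
  assumes f: "smooth_fun A f" and X: "W_field X"
  shows "D (defect (fmult f X)) \<xi> u = f u *\<^sub>T D (defect X) \<xi> u"
proof -
  note vX = W_fieldD(1)[OF X]
  have "defect (fmult f X) u = fmult f (defect X) u" for u
    using vector_field_tangent[OF vector_field_lie_bracket[OF vX xi], of u]
      W_fieldD(2)[OF X, of u] W_fieldD(3)[OF X, of u]
    unfolding defect_def lie_bracket_fmult_left[OF f vX xi]
    by (simp add: pr_simps W_iff fmult_apply tangent_space_scale)
      (simp add: fun_eq_iff tscale_apply algebra_simps)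
  then have "defect (fmult f X) = fmult f (defect X)" by (rule ext)
  then show ?thesis
    using D_fmult_left[OF f vector_field_defect[OF vX] xi] by (simp add: fmult_apply)
qed

lemma D_defect_xi: "D (defect \<xi>) \<xi> u = 0"
proof -
  have "defect \<xi> u = fmult (\<lambda>_. 0) \<xi> u" for u
  proof -
    have "pr u 0 = 0" using pr_scale[OF tangent_space_zero, of u 0] by simp
    moreover have "lie_bracket \<xi> \<xi> u = 0" by (simp add: lie_bracket_def fun_eq_iff)
    ultimately show ?thesis by (simp add: defect_def fmult_apply)
  qed
  then have "defect \<xi> = fmult (\<lambda>_. 0) \<xi>" by (rule ext)
  then show ?thesis
    using D_fmult_left[OF smooth_fun_const xi xi, of 0] by (simp add: fmult_apply)
qed

lemma G_D_xi_xi: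
  assumes Z: "vector_field A Z"
  shows "G u (D Z \<xi> u) (\<xi> u) = 0"
proof -
  have "G u (D Z \<xi> u) (\<xi> u) + G u (\<xi> u) (D Z \<xi> u) = 0"
    using metric[OF Z xi xi, of u] tangent_const[OF vector_field_tangent[OF Z, of u], of 1] by (simp add: G_xi_xi)
  then show ?thesis
    using G_sym[OF vector_field_tangent[OF D_vf[OF Z xi]] vector_field_tangent[OF xi], of u] by simp
qed

text \<open>
  From right to left, the basis change reduces a plane to \<open>\<xi>\<close> and the vector orthogonal to it, for which
  \<open>xi_curvature\<close> gives the flag curvature. From left to right, \<open>xi_curvature\<close> gives the claim for \<open>X\<close> that are non-null and orthogonal to \<open>\<xi>\<close> at the
  point. The quadratic form \<open>q u X X\<close> is unchanged if \<open>X\<close> is replaced by its component orthogonal to \<open>\<xi>\<close>, and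
  a null \<open>X\<close> is perturbed to \<open>X + t Y\<close> with \<open>G(X, Y) \<noteq> 0\<close>, which is non-null for small \<open>t \<noteq> 0\<close>.
\<close>
theorem xi_flag_curvature_iff:
  "(\<forall>u a b. orthogonal_nonnull W G u a b \<and> \<xi> u \<in> plane a b \<longrightarrow> flag_curvature A G D u a b = - 1 / 4) \<longleftrightarrow>
   (\<forall>X u. W_field X \<longrightarrow> G u (D (defect X) \<xi> u) (X u) = 0)" (is "?L \<longleftrightarrow> ?R")
proof
  assume R: ?R
  show ?L
  proof (intro allI impI, elim conjE)
    fix u a b assume o: "orthogonal_nonnull W G u a b" and "\<xi> u \<in> plane a b"
    then obtain s t where x: "\<xi> u = s *\<^sub>T a + t *\<^sub>T b" by (auto simp: plane_def)
    have W: "a \<in> W u" "b \<in> W u" and ab: "G u a b = 0" "G u a a \<noteq> 0" "G u b b \<noteq> 0"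
      using o by (auto simp: orthogonal_nonnull_def)
    note T = W[THEN W_tangent]
    define c where "c = (- t * G u b b) *\<^sub>T a + (s * G u a a) *\<^sub>T b"
    note bc = flag_curvature_basis_change[OF T ab(1) x G_xi_xi, folded c_def]
    have "c \<in> W u"
      unfolding c_def using W T by (simp add: W_iff pr_lincomb tangent_space_add tangent_space_scale)
    then obtain C where C: "W_field C" "C u = c" by (rule W_field_through)
    have "G u (D (defect C) \<xi> u) c = 0" using R C by blast
    then have "Rm u c (\<xi> u) (\<xi> u) c = - 1 / 4 * G u c c"
      using Rm_fields[OF W_fieldD(1)[OF C(1)] xi xi, of c u] xi_curvature[OF C(1), of u] C(2)
        W_tangent[OF \<open>c \<in> W u\<close>] bc(2) by simp
    then show "flag_curvature A G D u a b = - 1 / 4"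
      using bc(1,3) ab by simp
  qed
next
  assume L: ?L
  define q where "q u X Y = G u (D (defect X) \<xi> u) (Y u)" for u X Y
  have nonnull: "q u X X = 0" if X: "W_field X" and o: "G u (X u) (\<xi> u) = 0" "G u (X u) (X u) \<noteq> 0" for u X
  proof -
    have "\<xi> u \<in> plane (X u) (\<xi> u)"
      unfolding plane_def by (intro CollectI exI[of _ 0] exI[of _ 1]) simp
    moreover have "orthogonal_nonnull W G u (X u) (\<xi> u)"
      using o W_fieldD(2)[OF X] xi_W G_xi_xi by (simp add: orthogonal_nonnull_def)
    ultimately have "flag_curvature A G D u (X u) (\<xi> u) = - 1 / 4" using L by blast
    then have "Rm u (X u) (\<xi> u) (\<xi> u) (X u) = - 1 / 4 * G u (X u) (X u)"
      using o by (simp add: flag_curvature_def Rm_def G_xi_xi field_simps)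
    then show ?thesis
      using Rm_fields[OF W_fieldD(1)[OF X] xi xi W_fieldD(3)[OF X, of u]] xi_curvature[OF X, of u] o
      by (simp add: q_def)
  qed
  have tD: "D (defect X) \<xi> u \<in> tangent_space A u" if "W_field X" for X u
    using that by (intro vector_field_tangent D_vf vector_field_defect W_fieldD(1) xi)
  have q_add: "q u (X + Y) Z = q u X Z + q u Y Z" "q u Z (X + Y) = q u Z X + q u Z Y"
    if "W_field X" "W_field Y" "W_field Z" for u X Y Z
    using that by (simp_all add: q_def D_defect_add G_add tD W_fieldD(3))
  have q_fmult: "q u (fmult f X) Z = f u * q u X Z" "q u Z (fmult f X) = f u * q u Z X"
    if "smooth_fun A f" "W_field X" "W_field Z" for u f X Z
    using that by (simp_all add: q_def D_defect_fmult fmult_apply G_scale tD W_fieldD(3))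
  have q_xi: "q u \<xi> Z = 0" "q u Z \<xi> = 0" if "W_field Z" for u Z
    using that
    by (simp_all add: q_def D_defect_xi G_zero W_fieldD(3) G_D_xi_xi vector_field_defect W_fieldD(1) del: zero_fun_apply)
  \<comment> \<open>The component orthogonal to the unit field \<open>\<xi>\<close>.\<close>
  define perp where "perp X = X + fmult (\<lambda>u. - G u (X u) (\<xi> u)) \<xi>" for X
  have sG: "smooth_fun A (\<lambda>u. - G u (X u) (\<xi> u))" if "W_field X" for X
    by (intro smooth_fun_uminus smooth_fun_G W_fieldD(1) that xi)
  have perp: "W_field (perp X)" "G u (perp X u) (\<xi> u) = 0" "q u (perp X) (perp X) = q u X X"
    if X: "W_field X" for u X
  proof -
    let ?f = "fmult (\<lambda>u. - G u (X u) (\<xi> u)) \<xi>"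
    have f: "W_field ?f" by (intro W_field_fmult sG X W_field_xi)
    show "W_field (perp X)" unfolding perp_def by (intro W_field_add X f)
    show "G u (perp X u) (\<xi> u) = 0"
      using W_fieldD(3)[OF X] W_fieldD(3)[OF W_field_xi]
      by (simp add: perp_def fmult_apply G_add G_scale G_xi_xi tangent_space_scale)
    show "q u (perp X) (perp X) = q u X X"
      unfolding perp_def using X f W_field_xi sG[OF X]
      by (simp add: q_add q_fmult q_xi W_field_add del: plus_fun_apply)
  qed
  have "q u X X = 0" if X: "W_field X" and X\<xi>: "G u (X u) (\<xi> u) = 0" for u X
  proof (cases "X u = 0")
    case True
    then show ?thesis using G_zero[OF tD[OF X]] by (simp add: q_def del: zero_fun_apply)
  next
    case False
    then obtain b where b: "b \<in> W u" "G u (X u) b \<noteq> 0"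
      using nondegenerate[OF W_fieldD(2)[OF X]] by blast
    obtain Y' where Y': "W_field Y'" "Y' u = b" using W_field_through[OF b(1)] .
    define Y where "Y = perp Y'"
    have Y: "W_field Y" and Y\<xi>: "G u (Y u) (\<xi> u) = 0" unfolding Y_def by (intro perp Y')+
    have XY: "G u (X u) (Y u) \<noteq> 0"
      using b(2) Y' X\<xi> W_fieldD(3)[OF X, of u] W_fieldD(3)[OF Y'(1), of u] W_fieldD(3)[OF W_field_xi, of u]
      by (simp add: Y_def perp_def fmult_apply G_add G_scale tangent_space_scale)
    show ?thesis
    proof (cases "G u (X u) (X u) = 0")
      case False
      then show ?thesis using nonnull X X\<xi> by blast
    next
      case True
      show ?thesis
      proof (rule quadratic_vanishes_at_0[OF XY])
        fix t assume nz: "t * (2 * G u (X u) (Y u) + t * G u (Y u) (Y u)) \<noteq> 0"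
        let ?tY = "fmult (\<lambda>_. t) Y"
        have tY: "W_field ?tY" by (intro W_field_fmult smooth_fun_const Y)
        note T = W_fieldD(3)[OF X, of u] W_fieldD(3)[OF Y, of u] W_fieldD(3)[OF W_field_xi, of u]
        have "G u ((X + ?tY) u) (\<xi> u) = 0"
          using T X\<xi> Y\<xi> by (simp add: fmult_apply G_add G_scale tangent_space_scale)
        moreover have "G u ((X + ?tY) u) ((X + ?tY) u) = t * (2 * G u (X u) (Y u) + t * G u (Y u) (Y u))"
          using T True G_sym[OF T(2,1)]
          by (simp add: fmult_apply G_add G_scale tangent_space_scale tangent_space_add algebra_simps)
        ultimately have "q u (X + ?tY) (X + ?tY) = 0"
          using nz nonnull[OF W_field_add[OF X tY]] by simp
        moreover have "q u (X + ?tY) (X + ?tY) = q u X X + t * (q u X Y + q u Y X) + t * t * q u Y Y"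
          using X Y tY
          by (simp add: q_add q_fmult W_field_add smooth_fun_const algebra_simps del: plus_fun_apply)
        ultimately show "q u X X + t * (q u X Y + q u Y X) + t * t * q u Y Y = 0" by simp
      qed
    qed
  qed
  then show ?R using perp unfolding q_def by metis
qed

end

section \<open>The horizontal and the vertical distribution\<close>
lemma (in manifold) smooth_fun_det:
  fixes M :: "'a \<Rightarrow> real^'n^'n"
  assumes "\<And>i j. smooth_fun A (\<lambda>p. M p $ i $ j)"
  shows "smooth_fun A (\<lambda>p. det (M p))"
  unfolding det_def by (intro smooth_fun_intros assms)

locale finsler_bundle =
  fixes B :: "('e::{t2_space, second_countable_topology}, 'm::{t2_space, second_countable_topology},
               'n::finite, 'k::finite) vector_bundle"
    and HE :: "'e \<Rightarrow> 'e tvec set"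
    and G :: "'e \<Rightarrow> 'e tvec \<Rightarrow> 'e tvec \<Rightarrow> real"
  assumes smooth_bundle: "smooth_vector_bundle B"
    and connection: "nonlinear_connection B HE"
    and pseudo_metric: "pseudo_metric B HE G"

sublocale finsler_bundle \<subseteq> symmetric_tensor "total_atlas B" G
proof
  show "smooth_manifold (total_atlas B)" using smooth_bundle by (simp add: smooth_vector_bundle_def)
  show "tensor_02 (total_atlas B) G" using pseudo_metric by (simp add: pseudo_metric_def)
  show "G u a b = G u b a" if "a \<in> TE B u" "b \<in> TE B u" for u a b
    using pseudo_metric that unfolding pseudo_metric_def by blast
qed

context finsler_bundle
begin

abbreviation "hr \<equiv> hor B HE"
abbreviation "vr \<equiv> ver B HE"

text \<open>
  In particular each \<open>HE p\<close> is a linear span, which is how the subspace properties of \<open>HE\<close> are obtained.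
\<close>
lemma HE_frame:
  obtains W and E :: "'n \<Rightarrow> 'e vfield" where "open W" "u \<in> W" "\<And>i. vfield_on_E B (E i)"
    "\<And>p. p \<in> W \<Longrightarrow> HE p = {\<Sum>i\<in>UNIV. (c $ i) *\<^sub>T E i p | c :: real^'n. True}"
    "\<And>p c. p \<in> W \<Longrightarrow> (\<Sum>i\<in>UNIV. ((c :: real^'n) $ i) *\<^sub>T E i p) = 0 \<Longrightarrow> c = 0"
proof -
  have "\<exists>W (X :: 'n \<Rightarrow> 'e vfield). open W \<and> u \<in> W \<and> (\<forall>i. vfield_on_E B (X i)) \<and>
        (\<forall>p\<in>W. HE p = {\<Sum>i\<in>UNIV. (c $ i) *\<^sub>T X i p | c :: real^'n. True} \<and>
           (\<forall>c :: real^'n. (\<Sum>i\<in>UNIV. (c $ i) *\<^sub>T X i p) = 0 \<longrightarrow> c = 0))"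
    using connection unfolding nonlinear_connection_def by blast
  then obtain W and X :: "'n \<Rightarrow> 'e vfield" where WX: "open W \<and> u \<in> W \<and> (\<forall>i. vfield_on_E B (X i)) \<and>
        (\<forall>p\<in>W. HE p = {\<Sum>i\<in>UNIV. (c $ i) *\<^sub>T X i p | c :: real^'n. True} \<and>
           (\<forall>c :: real^'n. (\<Sum>i\<in>UNIV. (c $ i) *\<^sub>T X i p) = 0 \<longrightarrow> c = 0))"
    by (elim exE)
  note W = conjunct2[OF conjunct2[OF WX]]
  show thesis
  proof (rule that[of W X])
    show "open W" "u \<in> W" using WX by (rule conjunct1, elim conjE)
    show "vfield_on_E B (X i)" for i by (rule spec[OF conjunct1[OF W]])
    fix p assume "p \<in> W"
    note p = bspec[OF conjunct2[OF W] this]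
    show "HE p = {\<Sum>i\<in>UNIV. (c $ i) *\<^sub>T X i p | c :: real^'n. True}" by (rule conjunct1[OF p])
    show "(\<Sum>i\<in>UNIV. (c $ i) *\<^sub>T X i p) = 0 \<Longrightarrow> c = 0" for c :: "real^'n"
      by (rule mp[OF spec[OF conjunct2[OF p]]])
  qed
qed

lemma HE_int_VE: "HE u \<inter> VE B u = {0}"
  and TE_decomposition: "TE B u = {a + b | a b. a \<in> HE u \<and> b \<in> VE B u}"
  using connection[unfolded nonlinear_connection_def, THEN conjunct2] by simp_all

lemma HE_VE_zero: "0 \<in> HE u" "0 \<in> VE B u" "a \<in> HE u \<Longrightarrow> a \<in> VE B u \<Longrightarrow> a = 0"
  using HE_int_VE by blast+

lemma HE_lincomb:
  assumes "a \<in> HE u" "b \<in> HE u"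
  shows "k *\<^sub>T a + l *\<^sub>T b \<in> HE u"
proof -
  obtain W and E :: "'n \<Rightarrow> 'e vfield" where "u \<in> W"
    and H: "\<And>p. p \<in> W \<Longrightarrow> HE p = {\<Sum>i\<in>UNIV. (c $ i) *\<^sub>T E i p | c :: real^'n. True}"
    by (rule HE_frame[of u]) (rule that, assumption+)
  then obtain c d :: "real^'n" where "a = (\<Sum>i\<in>UNIV. (c $ i) *\<^sub>T E i u)" "b = (\<Sum>i\<in>UNIV. (d $ i) *\<^sub>T E i u)"
    using assms by auto
  then have "k *\<^sub>T a + l *\<^sub>T b = (\<Sum>i\<in>UNIV. ((k *\<^sub>R c + l *\<^sub>R d) $ i) *\<^sub>T E i u)"
    by (simp add: fun_eq_iff tscale_apply sum_fun_apply sum_distrib_left sum.distrib algebra_simps)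
  then show ?thesis unfolding H[OF \<open>u \<in> W\<close>] by blast
qed

lemma VE_tangent: "b \<in> VE B u \<Longrightarrow> b \<in> TE B u"
  by (simp add: VE_def)

lemma HE_tangent: "a \<in> HE u \<Longrightarrow> a \<in> TE B u"
  unfolding TE_decomposition using HE_VE_zero(2)[of u] by (metis (mono_tags, lifting) add.right_neutral mem_Collect_eq)

lemma VE_lincomb: "a \<in> VE B u \<Longrightarrow> b \<in> VE B u \<Longrightarrow> k *\<^sub>T a + l *\<^sub>T b \<in> VE B u"
  by (simp add: VE_def tangent_space_add tangent_space_scale tscale_apply)

lemma HE_diff: "a \<in> HE u \<Longrightarrow> b \<in> HE u \<Longrightarrow> a - b \<in> HE u"
  and VE_diff: "a \<in> VE B u \<Longrightarrow> b \<in> VE B u \<Longrightarrow> a - b \<in> VE B u"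
proof -
  have *: "a - b = 1 *\<^sub>T a + (- 1) *\<^sub>T b" by (simp add: tscale_def fun_eq_iff)
  show "a \<in> HE u \<Longrightarrow> b \<in> HE u \<Longrightarrow> a - b \<in> HE u" "a \<in> VE B u \<Longrightarrow> b \<in> VE B u \<Longrightarrow> a - b \<in> VE B u"
    unfolding * by (fact HE_lincomb, fact VE_lincomb)
qed

lemma hor_eqI:
  assumes "a \<in> HE u" "v - a \<in> VE B u"
  shows "hr u v = a"
  unfolding hor_def
proof (rule the_equality)
  show "a \<in> HE u \<and> v - a \<in> VE B u" using assms by simp
  fix a' assume a': "a' \<in> HE u \<and> v - a' \<in> VE B u"
  have "(v - a) - (v - a') = a' - a" by simp
  then have "a' - a \<in> VE B u" using VE_diff[OF assms(2), of "v - a'"] a' by metis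
  then have "a' - a = 0" using HE_diff[of a' u a] a' assms(1) HE_VE_zero(3) by blast
  then show "a' = a" by simp
qed

lemma hor_ver:
  assumes "v \<in> TE B u"
  shows "hr u v \<in> HE u" "vr u v \<in> VE B u"
proof -
  obtain a b where ab: "v = a + b" "a \<in> HE u" "b \<in> VE B u"
    using assms unfolding TE_decomposition by blast
  then have "hr u v = a" by (intro hor_eqI) simp_all
  then show "hr u v \<in> HE u" "vr u v \<in> VE B u" using ab by (simp_all add: ver_def)
qed

lemma hor_HE: "a \<in> HE u \<Longrightarrow> hr u a = a" and ver_HE: "a \<in> HE u \<Longrightarrow> vr u a = 0"
  and hor_VE: "b \<in> VE B u \<Longrightarrow> hr u b = 0" and ver_VE: "b \<in> VE B u \<Longrightarrow> vr u b = b"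
  using hor_eqI[of a u a] hor_eqI[of 0 u b] HE_VE_zero(1,2)[of u] by (simp_all add: ver_def)

lemma hor_tangent: "v \<in> TE B u \<Longrightarrow> hr u v \<in> TE B u" and ver_tangent: "v \<in> TE B u \<Longrightarrow> vr u v \<in> TE B u"
  using hor_ver HE_tangent VE_tangent by blast+

lemma hor_lincomb:
  assumes "a \<in> TE B u" "b \<in> TE B u"
  shows "hr u (k *\<^sub>T a + l *\<^sub>T b) = k *\<^sub>T hr u a + l *\<^sub>T hr u b"
proof (rule hor_eqI)
  show "k *\<^sub>T hr u a + l *\<^sub>T hr u b \<in> HE u" by (intro HE_lincomb hor_ver assms)
  have "k *\<^sub>T a + l *\<^sub>T b - (k *\<^sub>T hr u a + l *\<^sub>T hr u b) = k *\<^sub>T vr u a + l *\<^sub>T vr u b"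
    by (simp add: ver_def fun_eq_iff tscale_apply algebra_simps)
  then show "k *\<^sub>T a + l *\<^sub>T b - (k *\<^sub>T hr u a + l *\<^sub>T hr u b) \<in> VE B u"
    using VE_lincomb[OF hor_ver(2)[OF assms(1)] hor_ver(2)[OF assms(2)]] by simp
qed

lemma ver_lincomb:
  assumes "a \<in> TE B u" "b \<in> TE B u"
  shows "vr u (k *\<^sub>T a + l *\<^sub>T b) = k *\<^sub>T vr u a + l *\<^sub>T vr u b"
  using hor_lincomb[OF assms, of k l] by (simp add: ver_def fun_eq_iff tscale_apply algebra_simps)

lemma HE_iff: "a \<in> HE u \<longleftrightarrow> a \<in> TE B u \<and> hr u a = a"
  using HE_tangent hor_HE hor_ver(1) by metis

lemma VE_iff: "a \<in> VE B u \<longleftrightarrow> a \<in> TE B u \<and> vr u a = a"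
  using VE_tangent ver_VE hor_ver(2) by metis

lemma G_split:
  "a \<in> TE B u \<Longrightarrow> b \<in> TE B u \<Longrightarrow> G u a b = G u (hr u a) (hr u b) + G u (vr u a) (vr u b)"
  using pseudo_metric unfolding pseudo_metric_def hmetric_def vmetric_def by blast

lemma G_hor_left: "a \<in> TE B u \<Longrightarrow> b \<in> TE B u \<Longrightarrow> G u (hr u a) b = G u (hr u a) (hr u b)"
  using G_split[of "hr u a" u b] hor_ver[of a u] hor_ver[of b u]
  by (simp add: hor_tangent hor_HE ver_HE G_zero VE_tangent del: zero_fun_apply)

text \<open>The decomposition of \<open>G\<close> makes \<open>HE\<close> and \<open>VE\<close> orthogonal, so the projection is self-adjoint.\<close>
lemma hor_adjoint: "a \<in> TE B u \<Longrightarrow> b \<in> TE B u \<Longrightarrow> G u (hr u a) b = G u a (hr u b)"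
  using G_hor_left[of a u b] G_hor_left[of b u a] G_sym[of a u "hr u b"] G_sym[of "hr u a" u "hr u b"]
  by (simp add: hor_tangent)

lemma nondegenerate_HE: "a \<in> HE u \<Longrightarrow> (\<And>b. b \<in> HE u \<Longrightarrow> G u a b = 0) \<Longrightarrow> a = 0"
  using pseudo_metric unfolding pseudo_metric_def nondegenerate_on_def hmetric_def
  by (metis hor_HE)

lemma nondegenerate_VE: "a \<in> VE B u \<Longrightarrow> (\<And>b. b \<in> VE B u \<Longrightarrow> G u a b = 0) \<Longrightarrow> a = 0"
  using pseudo_metric unfolding pseudo_metric_def nondegenerate_on_def vmetric_def
  by (metis ver_VE)

text \<open>
  Let \<open>X\<^sup>H = \<Sum>\<^sub>i c\<^sub>i E\<^sub>i\<close> in a local frame of \<open>HE\<close>. As the projection is self-adjoint,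
  \<open>\<Sum>\<^sub>i c\<^sub>i G(E\<^sub>i, E\<^sub>j) = G(X, E\<^sub>j)\<close>, a linear system with smooth data whose matrix is invertible because \<open>G\<close> is
  non-degenerate on \<open>HE\<close>. Cramer's rule shows that the \<open>c\<^sub>i\<close> are smooth.
\<close>
lemma vector_field_hpart:
  assumes X: "vfield_on_E B X"
  shows "vfield_on_E B (hpart B HE X)"
proof (rule vector_fieldI)
  note tX = vector_field_tangent[OF X]
  show "hpart B HE X p \<in> TE B p" for p
    unfolding hpart_def by (rule hor_tangent[OF tX])
  fix f assume f: "smooth_fun (total_atlas B) f"
  show "smooth_fun (total_atlas B) (\<lambda>p. hpart B HE X p f)"
  proof (rule smooth_fun_local_quotient)
    fix u
    obtain W and E :: "'n \<Rightarrow> 'e vfield" where W: "open W" "u \<in> W" and E: "\<And>i. vfield_on_E B (E i)"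
      and H: "\<And>p. p \<in> W \<Longrightarrow> HE p = {\<Sum>i\<in>UNIV. (c $ i) *\<^sub>T E i p | c :: real^'n. True}"
      and ind: "\<And>p c. p \<in> W \<Longrightarrow> (\<Sum>i\<in>UNIV. ((c :: real^'n) $ i) *\<^sub>T E i p) = 0 \<Longrightarrow> c = 0"
      by (rule HE_frame[of u]) (rule that, assumption+)
    note tE = vector_field_tangent[OF E]
    \<comment> \<open>The Gram matrix of the frame, and its modifications in Cramer's rule.\<close>
    define M where "M p = (\<chi> j i. G p (E i p) (E j p))" for p
    define N where "N k p = (\<chi> i j. if j = k then G p (X p) (E i p) else M p $ i $ j)" for k p
    have sM: "smooth_fun (total_atlas B) (\<lambda>p. M p $ i $ j)" for i j
      by (simp add: M_def smooth_fun_G E)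
    have sN: "smooth_fun (total_atlas B) (\<lambda>p. N k p $ i $ j)" for k i j
      by (cases "j = k") (simp_all add: N_def smooth_fun_G E X sM)
    have MV: "(M p *v c) $ j = G p (\<Sum>i\<in>UNIV. (c $ i) *\<^sub>T E i p) (E j p)" for p c j
      using G_sum[where I = UNIV and e = "\<lambda>i. E i p" and c = "\<lambda>i. c $ i", OF tE tE, of j]
      by (simp add: M_def matrix_vector_mult_def mult.commute)
    have det: "det (M p) \<noteq> 0" if p: "p \<in> W" for p
    proof -
      have "c = 0" if "M p *v c = 0" for c
      proof (rule ind[OF p], rule nondegenerate_HE)
        let ?v = "\<Sum>i\<in>UNIV. (c $ i) *\<^sub>T E i p"
        show v: "?v \<in> HE p" unfolding H[OF p] by blast
        fix b assume "b \<in> HE p"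
        then obtain d :: "real^'n" where b: "b = (\<Sum>j\<in>UNIV. (d $ j) *\<^sub>T E j p)" unfolding H[OF p] by blast
        have tb: "b \<in> TE B p" and tv: "?v \<in> TE B p" using HE_tangent \<open>b \<in> HE p\<close> v by blast+
        have "G p (E j p) ?v = 0" for j
          using MV[of p c j] that G_sym[OF tv tE] by simp
        then show "G p ?v b = 0"
          using G_sum[where I = UNIV and e = "\<lambda>i. E i p" and c = "\<lambda>i. d $ i", OF tE tv] G_sym[OF tv tb] unfolding b[symmetric] by simp
      qed
      then show ?thesis
        using invertible_det_nz[of "M p"] invertible_left_inverse matrix_left_invertible_ker by blast
    qed
    have val: "hpart B HE X p f = (\<Sum>k\<in>UNIV. det (N k p) * E k p f) / det (M p)" if p: "p \<in> W" for p
    proof -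
      have "hr p (X p) \<in> HE p" by (rule hor_ver[OF tX])
      then obtain c :: "real^'n" where c: "hr p (X p) = (\<Sum>i\<in>UNIV. (c $ i) *\<^sub>T E i p)" unfolding H[OF p] by blast
      have "E j p \<in> HE p" for j
      proof -
        have "(\<Sum>i\<in>UNIV. ((axis j 1 :: real^'n) $ i) *\<^sub>T E i p) = E j p"
          by (simp add: fun_eq_iff sum_fun_apply tscale_apply axis_def if_distrib[of "\<lambda>x. x * _"] sum.delta cong: if_cong)
        then show ?thesis
          unfolding H[OF p] by (intro CollectI exI[of _ "axis j 1"] conjI TrueI) (rule sym)
      qed
      then have "G p (hr p (X p)) (E j p) = G p (X p) (E j p)" for j
        using hor_adjoint[OF tX tE] hor_HE by metis
      then have "M p *v c = (\<chi> j. G p (X p) (E j p))"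
        using MV[of p c] by (simp add: vec_eq_iff c)
      then have "c = (\<chi> k. det (N k p) / det (M p))"
        unfolding cramer[OF det[OF p]] by (simp add: N_def cong: if_cong)
      then have "c $ k = det (N k p) / det (M p)" for k by simp
      then show ?thesis
        unfolding hpart_def c by (simp add: sum_fun_apply tscale_apply sum_divide_distrib)
    qed
    show "\<exists>W N g. open W \<and> u \<in> W \<and> smooth_fun (total_atlas B) N \<and> smooth_fun (total_atlas B) g \<and>
        (\<forall>p\<in>W. g p \<noteq> 0 \<and> hpart B HE X p f = N p / g p)"
    proof (intro exI conjI ballI)
      show "smooth_fun (total_atlas B) (\<lambda>p. \<Sum>k\<in>UNIV. det (N k p) * E k p f)"
        by (intro smooth_fun_sum smooth_fun_mult smooth_fun_det sN vector_field_smooth E)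
      show "smooth_fun (total_atlas B) (\<lambda>p. det (M p))"
        by (intro smooth_fun_det sM)
    qed (fact W det val)+
  qed
qed

lemma vpart_eq: "vpart B HE X = X - hpart B HE X"
  by (simp add: vpart_def ver_def hpart_def fun_eq_iff)

lemma vector_field_vpart: "vfield_on_E B X \<Longrightarrow> vfield_on_E B (vpart B HE X)"
  unfolding vpart_eq by (intro vector_field_diff vector_field_hpart)

text \<open>
  Vertical vectors annihilate the functions \<open>g \<circ> \<pi>\<close>, hence \<open>X (Y (g \<circ> \<pi>)) = X(0) = 0\<close> for vertical \<open>X\<close> and \<open>Y\<close>.
\<close>
lemma VE_integrable:
  assumes X: "vfield_on_E B X" "\<And>u. X u \<in> VE B u" and Y: "vfield_on_E B Y" "\<And>u. Y u \<in> VE B u"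
  shows "lie_bracket X Y u \<in> VE B u"
proof -
  have "lie_bracket X Y u (g \<circ> bproj B) = 0" if "smooth_fun (base_atlas B) g" for g
    using that X(2) Y(2) tangent_const[OF vector_field_tangent[OF X(1)]] tangent_const[OF vector_field_tangent[OF Y(1)]]
    by (simp add: lie_bracket_def VE_def)
  then show ?thesis
    using vector_field_tangent[OF vector_field_lie_bracket[OF X(1) Y(1)]] by (simp add: VE_def)
qed

end

section \<open>Flag curvatures of K-paracontact Finsler structures\<close>
theorem theorem4p9:
  fixes B :: "('e::{t2_space, second_countable_topology}, 'm::{t2_space, second_countable_topology},
               'n::finite, 'k::finite) vector_bundle"
    and HE :: "'e \<Rightarrow> 'e tvec set"
    and \<phi> :: "'e \<Rightarrow> 'e tvec \<Rightarrow> 'e tvec"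
    and \<eta> :: "'e \<Rightarrow> 'e tvec \<Rightarrow> real"
    and \<xi> :: "'e vfield"
    and G :: "'e \<Rightarrow> 'e tvec \<Rightarrow> 'e tvec \<Rightarrow> real"
    and D :: "'e vfield \<Rightarrow> 'e vfield \<Rightarrow> 'e vfield"
  assumes "smooth_vector_bundle B"
    and "nonlinear_connection B HE"
    and "K_paracontact_Finsler B HE \<phi> \<eta> \<xi> G"
    and "Finsler_connection B HE G D"
  shows "(\<forall>u a b. orthogonal_nonnull (VE B) G u a b \<and> vpart B HE \<xi> u \<in> plane a b \<longrightarrow>
            flag_curvature (total_atlas B) G D u a b = - 1 / 4) \<and>
         ((\<forall>u a b. orthogonal_nonnull HE G u a b \<and> hpart B HE \<xi> u \<in> plane a b \<longrightarrow>
             flag_curvature (total_atlas B) G D u a b = - 1 / 4) \<longleftrightarrow>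
          (\<forall>X. vfield_on_E B X \<longrightarrow> (\<forall>u.
             G u (D (vpart B HE (lie_bracket (hpart B HE X) (hpart B HE \<xi>))) (hpart B HE \<xi>) u)
                 (hpart B HE X u) = 0)))"
proof -
  have pcm: "paracontact_metric_Finsler B HE \<phi> \<eta> \<xi> G"
    and killing: "\<And>X Y u. vfield_on_E B X \<Longrightarrow> vfield_on_E B Y \<Longrightarrow>
      lie_deriv_02 (hpart B HE \<xi>) (hmetric B HE G) X Y u = 0"
      "\<And>X Y u. vfield_on_E B X \<Longrightarrow> vfield_on_E B Y \<Longrightarrow>
      lie_deriv_02 (vpart B HE \<xi>) (vmetric B HE G) X Y u = 0"
    using assms(3) unfolding K_paracontact_Finsler_def by blast+
  then have apm: "almost_paracontact_metric_Finsler B HE \<phi> \<eta> \<xi> G"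
    and contact: "\<And>X Y u. vfield_on_E B X \<Longrightarrow> vfield_on_E B Y \<Longrightarrow>
      ext_deriv (hform B HE \<eta>) X Y u = fundamental_form \<phi> G u (hpart B HE X u) (hpart B HE Y u)"
      "\<And>X Y u. vfield_on_E B X \<Longrightarrow> vfield_on_E B Y \<Longrightarrow>
      ext_deriv (vform B HE \<eta>) X Y u = fundamental_form \<phi> G u (vpart B HE X u) (vpart B HE Y u)"
    unfolding paracontact_metric_Finsler_def by blast+
  then have ap: "almost_paracontact_Finsler B HE \<phi> \<eta> \<xi>" and pm: "pseudo_metric B HE G"
    and Gphi: "\<And>u a b. a \<in> TE B u \<Longrightarrow> b \<in> TE B u \<Longrightarrow> hmetric B HE G u (\<phi> u a) (\<phi> u b) =
          - hmetric B HE G u a b + hform B HE \<eta> u a * hform B HE \<eta> u b"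
      "\<And>u a b. a \<in> TE B u \<Longrightarrow> b \<in> TE B u \<Longrightarrow> vmetric B HE G u (\<phi> u a) (\<phi> u b) =
          - vmetric B HE G u a b + vform B HE \<eta> u a * vform B HE \<eta> u b"
    unfolding almost_paracontact_metric_Finsler_def by blast+
  have phi: "tensor_11 (total_atlas B) \<phi>" and eta: "one_form (total_atlas B) \<eta>" and xi: "vfield_on_E B \<xi>"
    and phi_HE: "\<And>u a. a \<in> HE u \<Longrightarrow> \<phi> u a \<in> HE u" and phi_VE: "\<And>u a. a \<in> VE B u \<Longrightarrow> \<phi> u a \<in> VE B u"
    and phi_phi: "\<And>u a. a \<in> TE B u \<Longrightarrow> \<phi> u (\<phi> u a) =
        a - hform B HE \<eta> u a *\<^sub>T hpart B HE \<xi> u - vform B HE \<eta> u a *\<^sub>T vpart B HE \<xi> u"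
    and eta_xi: "\<And>u. hform B HE \<eta> u (hpart B HE \<xi> u) = 1" "\<And>u. vform B HE \<eta> u (vpart B HE \<xi> u) = 1"
    using ap unfolding almost_paracontact_Finsler_def by blast+
  have lin: "linear_connection (total_atlas B) D"
    and D_pr: "\<And>X Y. vfield_on_E B X \<Longrightarrow> vfield_on_E B Y \<Longrightarrow> D X (hpart B HE Y) = hpart B HE (D X Y)"
      "\<And>X Y. vfield_on_E B X \<Longrightarrow> vfield_on_E B Y \<Longrightarrow> D X (vpart B HE Y) = vpart B HE (D X Y)"
    and metrical: "metrical B G D"
    and torsion: "\<And>X Y. vfield_on_E B X \<Longrightarrow> vfield_on_E B Y \<Longrightarrow>
        D (hpart B HE X) (hpart B HE Y) - D (hpart B HE Y) (hpart B HE X)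
          - hpart B HE (lie_bracket (hpart B HE X) (hpart B HE Y)) = 0"
      "\<And>X Y. vfield_on_E B X \<Longrightarrow> vfield_on_E B Y \<Longrightarrow>
        D (vpart B HE X) (vpart B HE Y) - D (vpart B HE Y) (vpart B HE X)
          - vpart B HE (lie_bracket (vpart B HE X) (vpart B HE Y)) = 0"
    using assms(4) unfolding Finsler_connection_def d_connection_def symmetric_connection_def by blast+
  interpret finsler_bundle B HE G by unfold_locales (fact assms(1) assms(2) pm)+
  interpret metric_connection "total_atlas B" G D
  proof
    show "linear_connection (total_atlas B) D" by (fact lin)
    fix X Y Z u assume "vfield_on_E B X" "vfield_on_E B Y" "vfield_on_E B Z"
    then have "X u (\<lambda>p. G p (Y p) (Z p)) - G u (D X Y u) (Z u) - G u (Y u) (D X Z u) = 0"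
      using metrical unfolding metrical_def by blast
    then show "X u (\<lambda>p. G p (Y p) (Z p)) = G u (D X Y u) (Z u) + G u (Y u) (D X Z u)" by simp
  qed
  have eta0: "\<eta> u 0 = 0" for u
    using eta tangent_space_zero[of u] unfolding one_form_def by (metis tscale_simps(1) mult_zero_left)
  have hp: "hpart B HE X = X" if "\<And>u. X u \<in> HE u" for X
    using hor_HE[OF that] by (simp add: hpart_def fun_eq_iff)
  have vp: "vpart B HE X = X" if "\<And>u. X u \<in> VE B u" for X
    using ver_VE[OF that] by (simp add: vpart_def fun_eq_iff)
  have xiH: "hpart B HE \<xi> u \<in> HE u" and xiV: "vpart B HE \<xi> u \<in> VE B u" for u
    using hor_ver[OF vector_field_tangent[OF xi]] by (simp_all add: hpart_def vpart_def)
  interpret H: paracontact_distribution "total_atlas B" G D HE hr \<phi> \<eta> "hpart B HE \<xi>"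
  proof
    fix u :: 'e and X Y :: "'e vfield"
    assume X: "vfield_on_E B X" "\<And>u. X u \<in> HE u" and Y: "vfield_on_E B Y" "\<And>u. Y u \<in> HE u"
    show "hr u (lie_bracket X Y u) = D X Y u - D Y X u"
      using fun_cong[OF torsion(1)[OF X(1) Y(1)], of u] unfolding hp[OF X(2)] hp[OF Y(2)] by (simp add: hpart_def)
    show "X u (\<lambda>p. \<eta> p (Y p)) - Y u (\<lambda>p. \<eta> p (X p)) - \<eta> u (hr u (lie_bracket X Y u)) = G u (X u) (\<phi> u (Y u))"
      using contact(1)[OF X(1) Y(1), of u] X(2) Y(2)
      by (simp add: ext_deriv_def hform_def fundamental_form_def hp hor_HE)
    show "hpart B HE \<xi> u (\<lambda>p. G p (X p) (Y p)) - G u (hr u (lie_bracket (hpart B HE \<xi>) X u)) (Y u) -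
        G u (X u) (hr u (lie_bracket (hpart B HE \<xi>) Y u)) = 0"
      using killing(1)[OF X(1) Y(1), of u] X(2) Y(2)
      by (simp add: lie_deriv_02_def hmetric_def hor_HE)
  next
    fix u a b assume a: "a \<in> HE u"
    then show "\<phi> u (\<phi> u a) = a - \<eta> u a *\<^sub>T hpart B HE \<xi> u"
      using phi_phi[of a u] by (simp add: HE_tangent hform_def vform_def hor_HE ver_HE eta0 del: zero_fun_apply)
    assume b: "b \<in> HE u"
    show "G u (\<phi> u a) (\<phi> u b) = - G u a b + \<eta> u a * \<eta> u b"
      using Gphi(1)[of a u b] a b by (simp add: HE_tangent hmetric_def hform_def hor_HE phi_HE)
  next
    show "\<eta> u (hpart B HE \<xi> u) = 1" for u
      using eta_xi(1)[of u] by (simp add: hform_def hor_HE[OF xiH])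
    show "vfield_on_E B X \<Longrightarrow> vfield_on_E B Y \<Longrightarrow> D X (\<lambda>u. hr u (Y u)) = (\<lambda>u. hr u (D X Y u))" for X Y
      using D_pr(1) unfolding hpart_def .
    show "vfield_on_E B X \<Longrightarrow> vfield_on_E B (\<lambda>u. hr u (X u))" for X
      using vector_field_hpart unfolding hpart_def .
  qed (fact HE_iff hor_ver(1) hor_lincomb nondegenerate_HE phi phi_HE eta vector_field_hpart[OF xi] xiH)+
  interpret V: paracontact_distribution "total_atlas B" G D "VE B" vr \<phi> \<eta> "vpart B HE \<xi>"
  proof
    fix u :: 'e and X Y :: "'e vfield"
    assume X: "vfield_on_E B X" "\<And>u. X u \<in> VE B u" and Y: "vfield_on_E B Y" "\<And>u. Y u \<in> VE B u"
    show "vr u (lie_bracket X Y u) = D X Y u - D Y X u"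
      using fun_cong[OF torsion(2)[OF X(1) Y(1)], of u] unfolding vp[OF X(2)] vp[OF Y(2)] by (simp add: vpart_def)
    show "X u (\<lambda>p. \<eta> p (Y p)) - Y u (\<lambda>p. \<eta> p (X p)) - \<eta> u (vr u (lie_bracket X Y u)) = G u (X u) (\<phi> u (Y u))"
      using contact(2)[OF X(1) Y(1), of u] X(2) Y(2)
      by (simp add: ext_deriv_def vform_def fundamental_form_def vp ver_VE)
    show "vpart B HE \<xi> u (\<lambda>p. G p (X p) (Y p)) - G u (vr u (lie_bracket (vpart B HE \<xi>) X u)) (Y u) -
        G u (X u) (vr u (lie_bracket (vpart B HE \<xi>) Y u)) = 0"
      using killing(2)[OF X(1) Y(1), of u] X(2) Y(2)
      by (simp add: lie_deriv_02_def vmetric_def ver_VE)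
  next
    fix u a b assume a: "a \<in> VE B u"
    then show "\<phi> u (\<phi> u a) = a - \<eta> u a *\<^sub>T vpart B HE \<xi> u"
      using phi_phi[of a u] by (simp add: VE_tangent hform_def vform_def hor_VE ver_VE eta0 del: zero_fun_apply)
    assume b: "b \<in> VE B u"
    show "G u (\<phi> u a) (\<phi> u b) = - G u a b + \<eta> u a * \<eta> u b"
      using Gphi(2)[of a u b] a b by (simp add: VE_tangent vmetric_def vform_def ver_VE phi_VE)
  next
    show "\<eta> u (vpart B HE \<xi> u) = 1" for u
      using eta_xi(2)[of u] by (simp add: vform_def ver_VE[OF xiV])
    show "vfield_on_E B X \<Longrightarrow> vfield_on_E B Y \<Longrightarrow> D X (\<lambda>u. vr u (Y u)) = (\<lambda>u. vr u (D X Y u))" for X Y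
      using D_pr(2) unfolding vpart_def .
    show "vfield_on_E B X \<Longrightarrow> vfield_on_E B (\<lambda>u. vr u (X u))" for X
      using vector_field_vpart unfolding vpart_def .
  qed (fact VE_iff hor_ver(2) ver_lincomb nondegenerate_VE phi phi_VE eta vector_field_vpart[OF xi] xiV)+
  \<comment> \<open>By integrability of \<open>VE\<close> there is no defect in the vertical case.\<close>
  have "G u (D (V.defect X) (vpart B HE \<xi>) u) (X u) = 0" if "V.W_field X" for X u
  proof -
    have "V.defect X p = fmult (\<lambda>_. 0) X p" for p
      using VE_integrable[OF V.W_fieldD(1,2)[OF that] V.W_fieldD(1,2)[OF V.W_field_xi], of p]
      by (simp add: V.defect_def ver_VE fmult_apply)
    then have "V.defect X = fmult (\<lambda>_. 0) X" by (rule ext)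
    then show ?thesis
      using D_fmult_left[OF smooth_fun_const V.W_fieldD(1)[OF that] vector_field_vpart[OF xi], of 0]
        G_zero(1)[OF V.W_fieldD(3)[OF that]] by (simp add: fmult_apply del: zero_fun_apply)
  qed
  then have i: "\<forall>u a b. orthogonal_nonnull (VE B) G u a b \<and> vpart B HE \<xi> u \<in> plane a b \<longrightarrow>
            flag_curvature (total_atlas B) G D u a b = - 1 / 4"
    using V.xi_flag_curvature_iff by blast
  have defect: "H.defect X = vpart B HE (lie_bracket X (hpart B HE \<xi>))" for X
    by (simp add: H.defect_def vpart_def ver_def)
  \<comment> \<open>The sections of \<open>HE\<close> are the horizontal parts of vector fields.\<close>
  have "(\<forall>X u. H.W_field X \<longrightarrow> G u (D (H.defect X) (hpart B HE \<xi>) u) (X u) = 0) \<longleftrightarrow>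
      (\<forall>X. vfield_on_E B X \<longrightarrow> (\<forall>u.
         G u (D (vpart B HE (lie_bracket (hpart B HE X) (hpart B HE \<xi>))) (hpart B HE \<xi>) u)
             (hpart B HE X u) = 0))" (is "?L \<longleftrightarrow> ?R")
  proof
    assume ?L
    moreover have "H.W_field (hpart B HE X)" if "vfield_on_E B X" for X
      using vector_field_hpart[OF that] hor_ver(1)[OF vector_field_tangent[OF that]]
      by (simp add: H.W_field_def hpart_def)
    ultimately show ?R unfolding defect by blast
  next
    assume ?R
    moreover have "hpart B HE X = X" "vfield_on_E B X" if "H.W_field X" for X
      using that hp by (simp_all add: H.W_field_def)
    ultimately show ?L unfolding defect by metis
  qed
  then show ?thesis using i H.xi_flag_curvature_iff by blast
qed

end
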